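(* Let $g$ be a totally positive function of Gaussian type and let $\alpha,\beta>0$. Then $\mathcal{G}(g,\alpha\mathbb{Z}\times\beta\mathbb{Z})$ is a frame for $L^2(\mathbb{R})$ if and only if $\alpha\beta<1$.
   Context: Fourier transform: $\hat f(\xi)=\int_{\mathbb{R}} f(x)e^{-2\pi i x\xi}\,dx$. A function $g$ on $\mathbb{R}$ is called totally positive of Gaussian type if its Fourier transform factors as $\hat g(\xi)=\prod_{j=1}^n(1+2\pi i\delta_j\xi)^{-1}e^{-c\xi^2}$ for some $n\in\mathbb{N}\cup\{0\}$, $\delta_1,\dots,\delta_n\in\mathbb{R}$ and $c>0$. Time-frequency shifts: $M_\xi T_x g(t)=e^{2\pi i\xi t}g(t-x)$. For $\Omega\subseteq\mathbb{R}^2$, $\mathcal{G}(g,\Omega)=\{M_\nu T_\mu g:(\mu,\nu)\in\Omega\}$. It is a frame for $L^2(\mathbb{R})$ if there exist $A,B>0$ such that $A\|f\|_2^2\le\sum_{(\mu,\nu)\in\Omega}|\langle f,M_\nu T_\mu g\rangle|^2\le B\|f\|_2^2$ for all $f\in L^2(\mathbb{R})$. *)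

theory Defs
  imports "HOL-Analysis.Analysis"
begin

definition fourier :: "(real \<Rightarrow> complex) \<Rightarrow> real \<Rightarrow> complex" where
  "fourier f \<xi> =
     (LINT x|lebesgue. f x * exp (- (2 * complex_of_real pi * \<i> * of_real x * of_real \<xi>)))"

text \<open>
  The integrability condition is what makes the Fourier integral meaningful. The case \<open>n = 0\<close> (pure
  Gaussian) and vanishing \<open>\<delta> j\<close> are allowed.
\<close>
definition tp_gaussian_type :: "(real \<Rightarrow> complex) \<Rightarrow> bool" where
  "tp_gaussian_type g \<longleftrightarrow>
     integrable lebesgue g \<and>
     (\<exists>(n::nat) (\<delta>::nat \<Rightarrow> real) (c::real). c > 0 \<and>
        (\<forall>\<xi>::real. fourier g \<xi> =
           (\<Prod>j=1..n. inverse (1 + 2 * complex_of_real pi * \<i> * of_real (\<delta> j) * of_real \<xi>))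
           * of_real (exp (- c * \<xi>^2))))"

text \<open>
  \<open>L\<^sup>2(\<real>)\<close> is represented by functions rather than classes modulo null sets; all notions
  below are invariant under changes on null sets.
\<close>
definition L2 :: "(real \<Rightarrow> complex) set" where
  "L2 = {f. f \<in> borel_measurable lebesgue \<and> integrable lebesgue (\<lambda>x. (norm (f x))^2)}"

definition L2_norm :: "(real \<Rightarrow> complex) \<Rightarrow> real" where
  "L2_norm f = sqrt (LINT x|lebesgue. (norm (f x))^2)"

definition L2_inner :: "(real \<Rightarrow> complex) \<Rightarrow> (real \<Rightarrow> complex) \<Rightarrow> complex" where
  "L2_inner f h = (LINT x|lebesgue. f x * cnj (h x))"

definition translation :: "real \<Rightarrow> (real \<Rightarrow> complex) \<Rightarrow> real \<Rightarrow> complex" where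
  "translation x g t = g (t - x)"

definition modulation :: "real \<Rightarrow> (real \<Rightarrow> complex) \<Rightarrow> real \<Rightarrow> complex" where
  "modulation \<xi> g t = exp (2 * complex_of_real pi * \<i> * of_real \<xi> * of_real t) * g t"

text \<open>
  Frames are indexed families in \<open>L\<^sup>2(\<real>)\<close>. Summability is required explicitly because
  \<open>infsum\<close> of a divergent real family is 0.
\<close>
definition L2_frame :: "'i set \<Rightarrow> ('i \<Rightarrow> real \<Rightarrow> complex) \<Rightarrow> bool" where
  "L2_frame I e \<longleftrightarrow>
     (\<forall>i\<in>I. e i \<in> L2) \<and>
     (\<exists>A B :: real. A > 0 \<and> B > 0 \<and>
        (\<forall>f\<in>L2.
           (\<lambda>i. (norm (L2_inner f (e i)))^2) summable_on I \<and>
           A * (L2_norm f)^2 \<le> (\<Sum>\<^sub>\<infinity>i\<in>I. (norm (L2_inner f (e i)))^2) \<and>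
           (\<Sum>\<^sub>\<infinity>i\<in>I. (norm (L2_inner f (e i)))^2) \<le> B * (L2_norm f)^2))"

definition gabor_system :: "(real \<Rightarrow> complex) \<Rightarrow> real \<times> real \<Rightarrow> real \<Rightarrow> complex" where
  "gabor_system g = (\<lambda>(\<mu>, \<nu>). modulation \<nu> (translation \<mu> g))"

definition rect_lattice :: "real \<Rightarrow> real \<Rightarrow> (real \<times> real) set" where
  "rect_lattice \<alpha> \<beta> = range (\<lambda>k::int. \<alpha> * of_int k) \<times> range (\<lambda>l::int. \<beta> * of_int l)"

end

theory Submission
  imports Defs "HOL-Probability.Probability" "HOL-Complex_Analysis.Complex_Analysis"
    "HOL-Real_Asymp.Real_Asymp"
begin

text \<open>
  Put \<open>L = 1 / \<beta>\<close>. Unfolding \<open>\<langle>f, M\<^sub>\<nu> T\<^sub>\<mu> g\<rangle>\<close> over a period and applying Parseval in the modulation index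
  turns the frame inequality into uniform \<open>\<ell>\<^sup>2\<close> bounds, for all \<open>x\<close>, for the sampling map
  \<open>c \<mapsto> (F (x - \<alpha> k))\<^sub>k\<close> with \<open>F t = (\<Sum>j. c j * g (t + j L))\<close>.

  If \<open>\<alpha> < L\<close>, the map is injective on bounded sequences: \<open>g\<close> is an iterated exponential average of a
  Gaussian, and by Rolle's theorem undoing one average moves the zeros of \<open>F\<close> by at most one sampling
  step. For the Gaussian, \<open>F\<close> becomes a Laurent series of growth \<open>exp (a t\<^sup>2)\<close>; dividing out zeros of
  density \<open>1 / \<alpha> > 1 / L\<close> and applying the maximum principle on large annuli forces it to vanish.
  Compactness turns injectivity into a lower bound for the supremum norm, and slowly decaying
  exponential weights turn this into an \<open>\<ell>\<^sup>2\<close> bound.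

  If \<open>\<alpha> > L\<close>, a dimension count produces coefficients with almost vanishing samples. If \<open>\<alpha> = L\<close>, the
  coefficients \<open>(-1)\<^sup>j\<close> give an antiperiodic \<open>F\<close>, which has a zero and hence vanishes on a translate of
  \<open>L \<int>\<close>.
\<close>

section \<open>Sums over the integers and sampled shift sums\<close>

text \<open>Rolle's theorem and the intermediate value theorem force the core argument to be real:
  the generator is replaced a.e. by a real function, and complex coefficients are split into real
  and imaginary parts once the real estimate is available. Undoing an average destroys the exact
  lattice of zeros, which is why the Gaussian uniqueness statement allows nodes at bounded distance
  from \<alpha> \<int>. It is decided by two quadratic exponents: growth of the Laurent series
  contributes \<open>a * \<alpha>\<^sup>2 * n\<^sup>2\<close>, the zeros contribute
  \<open>- a * L * \<alpha> * n\<^sup>2\<close>, and the sum is negative exactly when \<alpha> < L.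
  Stability passes through bounded sequences because a box of sequences is compact for entrywise
  convergence and shift sums are continuous for it, whereas the mass of a square summable sequence
  can escape to infinity. Escape is harmless in the supremum norm: translating the coefficients by
  \<open>m\<close> only moves the sampling point by \<open>m * L\<close>, so a near-maximal entry
  can always be brought to index 0.\<close>

abbreviation int_count :: "int measure" where
  "int_count \<equiv> count_space UNIV"

lemma sigma_finite_int_count: "sigma_finite_measure int_count"
  by (rule sigma_finite_measure_count_space)

lemma bij_int_shift: "bij (\<lambda>j::int. j + m)"
  by (rule bij_betw_byWitness[where f' = "\<lambda>j. j - m"]) auto

lemma bij_int_uminus: "bij (uminus :: int \<Rightarrow> int)"
  by (rule bij_betw_byWitness[where f' = uminus]) auto

lemma nn_integral_int_shift:
  "(\<integral>\<^sup>+j. f (j + m) \<partial>int_count) = (\<integral>\<^sup>+j. f j \<partial>int_count)" for m :: int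
  using nn_integral_bij_count_space[OF bij_int_shift[of m], of f] by simp

lemma integral_int_shift:
  fixes f :: "int \<Rightarrow> 'a::{banach, second_countable_topology}"
  shows "(LINT j|int_count. f (j + m)) = (LINT j|int_count. f j)"
  using integral_bij_count_space[OF bij_int_shift[of m], of f] by simp

lemma nn_integral_int_uminus:
  "(\<integral>\<^sup>+j. f (- j) \<partial>int_count) = (\<integral>\<^sup>+j. f j \<partial>int_count)"
  using nn_integral_bij_count_space[OF bij_int_uminus, of f] by simp

lemma int_sum_integral_swap:
  fixes f :: "int \<Rightarrow> 'b \<Rightarrow> 'a::{banach, second_countable_topology}"
  assumes "sigma_finite_measure N" and [measurable]: "\<And>j. f j \<in> borel_measurable N"
    and fin: "(\<integral>\<^sup>+j. (\<integral>\<^sup>+x. ennreal (norm (f j x)) \<partial>N) \<partial>int_count) < \<infinity>"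
  shows "(LINT j|int_count. LINT x|N. f j x) = (LINT x|N. LINT j|int_count. f j x)"
    and "integrable N (\<lambda>x. LINT j|int_count. f j x)"
    and "integrable int_count (\<lambda>j. LINT x|N. f j x)"
    and "AE x in N. integrable int_count (\<lambda>j. f j x)"
proof -
  interpret C: sigma_finite_measure int_count by (rule sigma_finite_int_count)
  interpret N: sigma_finite_measure N by fact
  interpret P: pair_sigma_finite int_count N ..
  have [measurable]: "(\<lambda>(j, x). f j x) \<in> borel_measurable (int_count \<Otimes>\<^sub>M N)"
    by (rule measurable_pair_measure_countable1) auto
  have int: "integrable (int_count \<Otimes>\<^sub>M N) (\<lambda>(j, x). f j x)"
  proof (rule integrableI_bounded)
    have "(\<integral>\<^sup>+ z. ennreal (norm (case z of (j, x) \<Rightarrow> f j x)) \<partial>(int_count \<Otimes>\<^sub>M N))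
       = (\<integral>\<^sup>+j. (\<integral>\<^sup>+x. ennreal (norm (f j x)) \<partial>N) \<partial>int_count)"
      using N.nn_integral_fst [of "\<lambda>z. ennreal (norm (case z of (j, x) \<Rightarrow> f j x))" int_count] by simp
    with fin show "(\<integral>\<^sup>+ z. ennreal (norm (case z of (j, x) \<Rightarrow> f j x)) \<partial>(int_count \<Otimes>\<^sub>M N)) < \<infinity>"
      by simp
  qed simp
  show "(LINT j|int_count. LINT x|N. f j x) = (LINT x|N. LINT j|int_count. f j x)"
    using P.Fubini_integral [OF int] by simp
  show "integrable N (\<lambda>x. LINT j|int_count. f j x)"
    using P.integrable_snd [OF int] by simp
  show "integrable int_count (\<lambda>j. LINT x|N. f j x)"
    using P.integrable_fst [OF int] by simp
  show "AE x in N. integrable int_count (\<lambda>j. f j x)"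
    using P.AE_integrable_snd [OF int] by simp
qed

lemma nn_integral_int_swap:
  assumes "sigma_finite_measure N" and [measurable]: "\<And>j. f j \<in> borel_measurable N"
  shows "(\<integral>\<^sup>+j. (\<integral>\<^sup>+x. f j x \<partial>N) \<partial>int_count) = (\<integral>\<^sup>+x. (\<integral>\<^sup>+j. f j x \<partial>int_count) \<partial>N)"
proof -
  interpret C: sigma_finite_measure int_count by (rule sigma_finite_int_count)
  interpret N: sigma_finite_measure N by fact
  interpret P: pair_sigma_finite int_count N ..
  have "(\<lambda>(j, x). f j x) \<in> borel_measurable (int_count \<Otimes>\<^sub>M N)"
    by (rule measurable_pair_measure_countable1) auto
  then show ?thesis
    by (rule P.Fubini' [symmetric])
qed

lemma integrable_exp_abs_int:
  assumes "b > 0"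
  shows "integrable int_count (\<lambda>j. exp (- (b * \<bar>real_of_int j\<bar>)))"
proof -
  let ?f = "\<lambda>j::int. exp (- (b * \<bar>real_of_int j\<bar>))"
  have geo: "Infinite_Set_Sum.abs_summable_on (\<lambda>n::nat. exp (- (b * real n))) UNIV"
  proof -
    have "exp (- (b * real n)) = exp (- b) ^ n" for n
      by (simp add: exp_of_nat_mult [symmetric] mult.commute)
    moreover have "summable (\<lambda>n. exp (- b) ^ n)"
      using assms by (intro summable_geometric) auto
    ultimately show ?thesis
      by (simp add: abs_summable_on_nat_iff')
  qed
  have "Infinite_Set_Sum.abs_summable_on ?f (range int)"
    using geo by (subst abs_summable_on_reindex_iff [symmetric]) (auto simp: inj_on_def)
  moreover have "Infinite_Set_Sum.abs_summable_on ?f (range (\<lambda>n. - int n))"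
    using geo by (subst abs_summable_on_reindex_iff [symmetric]) (auto simp: inj_on_def)
  ultimately have "Infinite_Set_Sum.abs_summable_on ?f ((range int \<union> range (\<lambda>n. - int n)))"
    by (rule abs_summable_on_union)
  moreover have "range int \<union> range (\<lambda>n. - int n) = UNIV"
    by (auto simp: image_iff) (metis int_cases2)
  ultimately show ?thesis
    by (simp add: abs_summable_on_def)
qed

text \<open>Uniformity in \<open>t\<close> comes from rounding \<open>t\<close> down to a multiple
  of \<open>L\<close>: this costs a factor \<open>exp (a * L)\<close>, and the remaining shift is
  absorbed by the translation invariance of the sum. The 1 added to the constant makes it
  positive.\<close>

lemma nn_integral_exp_abs_int_bound:
  assumes "a > 0" "L > 0"
  obtains K :: real where "K > 0"
    "\<And>t. (\<integral>\<^sup>+j. ennreal (exp (- (a * \<bar>t + of_int j * L\<bar>))) \<partial>int_count) \<le> ennreal K"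
proof -
  define S where "S = (LINT j|int_count. exp (- (a * L * \<bar>real_of_int j\<bar>)))"
  have int: "integrable int_count (\<lambda>j. exp (- (a * L * \<bar>real_of_int j\<bar>)))"
    using assms by (intro integrable_exp_abs_int) auto
  have "S \<ge> 0"
    unfolding S_def by (intro integral_nonneg_AE) auto
  have S: "(\<integral>\<^sup>+j. ennreal (exp (- (a * L * \<bar>real_of_int j\<bar>))) \<partial>int_count) = ennreal S"
    unfolding S_def by (intro nn_integral_eq_integral int) auto
  show ?thesis
  proof (rule that [of "exp (a * L) * S + 1"])
    show "exp (a * L) * S + 1 > 0"
      using \<open>S \<ge> 0\<close> by (simp add: add_nonneg_pos)
    fix t
    define m where "m = \<lfloor>t / L\<rfloor>"
    have m: "of_int m * L \<le> t" "t < (of_int m + 1) * L"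
      using assms unfolding m_def
      by (metis floor_divide_lower, metis floor_divide_upper)
    have le: "exp (- (a * \<bar>t + of_int j * L\<bar>))
        \<le> exp (a * L) * exp (- (a * L * \<bar>real_of_int (j + m)\<bar>))" for j
    proof -
      have "L * \<bar>real_of_int (j + m)\<bar> = \<bar>real_of_int (j + m) * L\<bar>"
        using assms by (simp add: abs_mult)
      also have "\<dots> \<le> \<bar>t + of_int j * L\<bar> + L"
        using m by (simp add: algebra_simps)
      finally have "a * (L * \<bar>real_of_int (j + m)\<bar>) \<le> a * (\<bar>t + of_int j * L\<bar> + L)"
        using assms by (intro mult_left_mono) auto
      then show ?thesis
        by (simp add: exp_add [symmetric] algebra_simps)
    qed
    have "(\<integral>\<^sup>+j. ennreal (exp (- (a * \<bar>t + of_int j * L\<bar>))) \<partial>int_count)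
        \<le> (\<integral>\<^sup>+j. ennreal (exp (a * L)) * ennreal (exp (- (a * L * \<bar>real_of_int (j + m)\<bar>))) \<partial>int_count)"
      using le by (intro nn_integral_mono) (simp add: ennreal_mult [symmetric] ennreal_leI)
    also have "\<dots> = ennreal (exp (a * L)) * ennreal S"
      by (subst nn_integral_cmult, simp)
        (subst nn_integral_int_shift [of "\<lambda>j. ennreal (exp (- (a * L * \<bar>real_of_int j\<bar>)))"], simp add: S)
    also have "\<dots> \<le> ennreal (exp (a * L) * S + 1)"
      using \<open>S \<ge> 0\<close> by (simp add: ennreal_mult [symmetric] ennreal_leI)
    finally show "(\<integral>\<^sup>+j. ennreal (exp (- (a * \<bar>t + of_int j * L\<bar>))) \<partial>int_count)
        \<le> ennreal (exp (a * L) * S + 1)" .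
  qed
qed

text \<open>Series over \<open>\<int>\<close> are integrals over the counting measure, so that Fubini's theorem and dominated
  convergence apply to them directly.\<close>

definition fiber ::
    "real \<Rightarrow> (real \<Rightarrow> real) \<Rightarrow> (int \<Rightarrow> 'a::{banach, second_countable_topology}) \<Rightarrow> real \<Rightarrow> 'a" where
  "fiber L g c t = (LINT j|int_count. g (t + of_int j * L) *\<^sub>R c j)"

text \<open>Gaussian decay would not survive averaging against a one-sided exponential density.
  Exponential decay at an unspecified rate does, and it suffices for all estimates on shift
  sums.\<close>

definition exp_decay :: "(real \<Rightarrow> real) \<Rightarrow> bool" where
  "exp_decay g \<longleftrightarrow> continuous_on UNIV g \<and> (\<exists>C a. a > 0 \<and> (\<forall>x. \<bar>g x\<bar> \<le> C * exp (- (a * \<bar>x\<bar>))))"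

lemma exp_decayE:
  assumes "exp_decay g"
  obtains C a where "a > 0" "C > 0" "\<And>x. \<bar>g x\<bar> \<le> C * exp (- (a * \<bar>x\<bar>))" "continuous_on UNIV g"
proof -
  from assms obtain C a where *: "a > 0" "\<And>x. \<bar>g x\<bar> \<le> C * exp (- (a * \<bar>x\<bar>))" "continuous_on UNIV g"
    by (auto simp: exp_decay_def)
  have "\<bar>g x\<bar> \<le> (max C 1) * exp (- (a * \<bar>x\<bar>))" for x
    by (rule order_trans [OF *(2)]) (intro mult_right_mono, auto)
  with that [of a "max C 1"] * show ?thesis by auto
qed

lemma integrable_exp_abs_shift:
  fixes a L t :: real
  assumes "a > 0" "L > 0"
  shows "integrable int_count (\<lambda>j. exp (- (a * \<bar>t + of_int j * L\<bar>)))"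
proof -
  let ?f = "\<lambda>j::int. exp (- (a * \<bar>t + of_int j * L\<bar>))"
  obtain K :: real where
    K: "\<And>t. (\<integral>\<^sup>+j. ennreal (exp (- (a * \<bar>t + of_int j * L\<bar>))) \<partial>int_count) \<le> ennreal K"
    using nn_integral_exp_abs_int_bound [OF assms] by blast
  have "(\<integral>\<^sup>+j. ennreal (?f j) \<partial>int_count) < \<infinity>"
    by (rule le_less_trans [OF K]) simp
  then show ?thesis
    by (intro integrableI_nonneg) auto
qed

lemma integral_exp_abs_int_bound:
  assumes "a > 0" "L > 0"
  obtains K :: real where "K > 0"
    "\<And>t. (LINT j|int_count. exp (- (a * \<bar>t + of_int j * L\<bar>))) \<le> K"
    "\<And>t. (\<integral>\<^sup>+j. ennreal (exp (- (a * \<bar>t + of_int j * L\<bar>))) \<partial>int_count) \<le> ennreal K"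
proof -
  obtain K :: real where K: "K > 0"
    "\<And>t. (\<integral>\<^sup>+j. ennreal (exp (- (a * \<bar>t + of_int j * L\<bar>))) \<partial>int_count) \<le> ennreal K"
    using nn_integral_exp_abs_int_bound [OF assms] by metis
  have "(LINT j|int_count. exp (- (a * \<bar>t + of_int j * L\<bar>))) \<le> K" for t
  proof -
    have "ennreal (LINT j|int_count. exp (- (a * \<bar>t + of_int j * L\<bar>))) \<le> ennreal K"
      using K(2) [of t] by (subst nn_integral_eq_integral [symmetric, OF integrable_exp_abs_shift [OF assms]]) auto
    then show ?thesis
      using K(1) by simp
  qed
  with K that show ?thesis by blast
qed

lemma integrable_fiber:
  fixes c :: "int \<Rightarrow> 'a::{banach, second_countable_topology}"
  assumes "exp_decay g" "L > 0" "\<And>j. norm (c j) \<le> M"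
  shows "integrable int_count (\<lambda>j. g (t + of_int j * L) *\<^sub>R c j)"
proof -
  obtain C a where *: "a > 0" "C > 0" "\<And>x. \<bar>g x\<bar> \<le> C * exp (- (a * \<bar>x\<bar>))"
    using exp_decayE [OF assms(1)] by metis
  show ?thesis
  proof (rule Bochner_Integration.integrable_bound)
    show "integrable int_count (\<lambda>j. C * M * exp (- (a * \<bar>t + of_int j * L\<bar>)))"
      using * assms by (intro integrable_mult_right integrable_exp_abs_shift)
    have "norm (g (t + of_int j * L) *\<^sub>R c j) \<le> norm (C * M * exp (- (a * \<bar>t + of_int j * L\<bar>)))" for j
    proof -
      have "norm (g (t + of_int j * L) *\<^sub>R c j) \<le> (C * exp (- (a * \<bar>t + of_int j * L\<bar>))) * M"
        unfolding norm_scaleR by (intro mult_mono *) (use * assms in auto)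
      also have "\<dots> \<le> norm (C * M * exp (- (a * \<bar>t + of_int j * L\<bar>)))"
        by (simp add: mult_ac)
      finally show ?thesis .
    qed
    then show "AE j in int_count. norm (g (t + of_int j * L) *\<^sub>R c j)
        \<le> norm (C * M * exp (- (a * \<bar>t + of_int j * L\<bar>)))" by simp
  qed auto
qed

text \<open>This covariance is what allows any index to be moved to 0, and what makes the
  alternating sum antiperiodic at critical density.\<close>

lemma fiber_shift:
  "fiber L g (\<lambda>j. c (j + m)) t = fiber L g c (t - of_int m * L)"
proof -
  have "fiber L g (\<lambda>j. c (j + m)) t
      = (LINT j|int_count. (\<lambda>j. g (t - of_int m * L + of_int j * L) *\<^sub>R c j) (j + m))"
    unfolding fiber_def by (intro Bochner_Integration.integral_cong) (auto simp: algebra_simps)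
  then show ?thesis
    unfolding fiber_def by (subst (asm) integral_int_shift)
qed

lemma fiber_bounded_exp:
  assumes "exp_decay g" "L > 0"
  obtains K where "K > 0" "\<And>(c :: int \<Rightarrow> 'a::{banach, second_countable_topology}) M t.
      (\<And>j. norm (c j) \<le> M) \<Longrightarrow> norm (fiber L g c t) \<le> K * M"
proof -
  obtain C a where *: "a > 0" "C > 0" "\<And>x. \<bar>g x\<bar> \<le> C * exp (- (a * \<bar>x\<bar>))"
    using exp_decayE [OF assms(1)] by metis
  obtain K where K: "K > 0" "\<And>t. (LINT j|int_count. exp (- (a * \<bar>t + of_int j * L\<bar>))) \<le> K"
    using integral_exp_abs_int_bound [OF *(1) assms(2)] by metis
  show ?thesis
  proof (rule that [of "C * K"])
    show "C * K > 0" using * K by simp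
    fix c :: "int \<Rightarrow> 'a" and M t
    assume c: "\<And>j. norm (c j) \<le> M"
    have M: "M \<ge> 0" using c [of 0] norm_ge_zero order_trans by blast
    have "norm (fiber L g c t) \<le> (LINT j|int_count. norm (g (t + of_int j * L) *\<^sub>R c j))"
      unfolding fiber_def by (rule integral_norm_bound)
    also have "\<dots> \<le> (LINT j|int_count. C * M * exp (- (a * \<bar>t + of_int j * L\<bar>)))"
    proof (rule integral_mono)
      show "integrable int_count (\<lambda>j. norm (g (t + of_int j * L) *\<^sub>R c j))"
        using assms c by (intro integrable_norm integrable_fiber)
      show "integrable int_count (\<lambda>j. C * M * exp (- (a * \<bar>t + of_int j * L\<bar>)))"
        using * assms by (intro integrable_mult_right integrable_exp_abs_shift)
      fix j
      have "norm (g (t + of_int j * L) *\<^sub>R c j) \<le> (C * exp (- (a * \<bar>t + of_int j * L\<bar>))) * M"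
        unfolding norm_scaleR by (intro mult_mono *) (use * c in auto)
      then show "norm (g (t + of_int j * L) *\<^sub>R c j) \<le> C * M * exp (- (a * \<bar>t + of_int j * L\<bar>))"
        by (simp add: mult_ac)
    qed
    also have "\<dots> = C * M * (LINT j|int_count. exp (- (a * \<bar>t + of_int j * L\<bar>)))"
      by simp
    also have "\<dots> \<le> C * M * K"
      using * K M by (intro mult_left_mono) auto
    finally show "norm (fiber L g c t) \<le> C * K * M"
      by (simp add: mult_ac)
  qed
qed

text \<open>Only entrywise convergence of bounded coefficients is assumed, as a compactness argument
  provides. Since \<open>t n\<close> stays within a distance \<open>D\<close> of \<open>s\<close>,
  the terms are dominated by those at \<open>s\<close> up to the factor
  \<open>exp (a * D)\<close>.\<close>

lemma tendsto_fiber: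
  fixes c :: "nat \<Rightarrow> int \<Rightarrow> 'a::{banach, second_countable_topology}"
  assumes g: "exp_decay g" and L: "L > 0"
    and M: "\<And>n j. norm (c n j) \<le> M" and c: "\<And>j. (\<lambda>n. c n j) \<longlonglongrightarrow> d j" and t: "t \<longlonglongrightarrow> s"
  shows "(\<lambda>n. fiber L g (c n) (t n)) \<longlonglongrightarrow> fiber L g d s"
proof -
  obtain C a where *: "a > 0" "C > 0" "\<And>x. \<bar>g x\<bar> \<le> C * exp (- (a * \<bar>x\<bar>))"
    and cont: "continuous_on UNIV g"
    using exp_decayE [OF g] by metis
  have "(\<lambda>n. t n - s) \<longlonglongrightarrow> s - s"
    by (intro tendsto_intros t)
  then have "Bseq (\<lambda>n. t n - s)"
    by (intro convergent_imp_Bseq convergentI)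
  then obtain D where D: "D > 0" "\<And>n. \<bar>t n - s\<bar> \<le> D"
    by (auto simp: Bseq_def)
  show ?thesis
    unfolding fiber_def
  proof (rule integral_dominated_convergence)
    show "integrable int_count (\<lambda>j. C * M * exp (a * D) * exp (- (a * \<bar>s + of_int j * L\<bar>)))"
      using * L by (intro integrable_mult_right integrable_exp_abs_shift)
    have "(\<lambda>n. g (t n + of_int j * L) *\<^sub>R c n j) \<longlonglongrightarrow> g (s + of_int j * L) *\<^sub>R d j" for j
      by (intro tendsto_intros c continuous_on_tendsto_compose [OF cont] t) auto
    then show "AE j in int_count. (\<lambda>n. g (t n + of_int j * L) *\<^sub>R c n j) \<longlonglongrightarrow> g (s + of_int j * L) *\<^sub>R d j"
      by simp
    fix n
    have "norm (g (t n + of_int j * L) *\<^sub>R c n j) \<le> C * M * exp (a * D) * exp (- (a * \<bar>s + of_int j * L\<bar>))" for j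
    proof -
      have "norm (g (t n + of_int j * L) *\<^sub>R c n j) \<le> (C * exp (- (a * \<bar>t n + of_int j * L\<bar>))) * M"
        unfolding norm_scaleR by (intro mult_mono *) (use * M in auto)
      also have "\<dots> \<le> (C * exp (a * D - a * \<bar>s + of_int j * L\<bar>)) * M"
      proof -
        have "\<bar>s + of_int j * L\<bar> \<le> \<bar>t n + of_int j * L\<bar> + D"
          using D(2) [of n] by linarith
        then have "a * \<bar>s + of_int j * L\<bar> \<le> a * (\<bar>t n + of_int j * L\<bar> + D)"
          using * by (intro mult_left_mono) auto
        moreover have "M \<ge> 0" using M norm_ge_zero order_trans by blast
        ultimately show ?thesis
          using * by (intro mult_right_mono mult_left_mono) (auto simp: algebra_simps)
      qed
      finally show ?thesis
        by (simp add: exp_diff exp_minus field_simps)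
    qed
    then show "AE j in int_count. norm (g (t n + of_int j * L) *\<^sub>R c n j)
        \<le> C * M * exp (a * D) * exp (- (a * \<bar>s + of_int j * L\<bar>))"
      by simp
  qed auto
qed

lemma continuous_on_fiber:
  fixes c :: "int \<Rightarrow> 'a::{banach, second_countable_topology}"
  assumes "exp_decay g" "L > 0" "\<And>j. norm (c j) \<le> M"
  shows "continuous_on UNIV (fiber L g c)"
  unfolding continuous_on_sequentially comp_def
  using tendsto_fiber [OF assms(1,2), of "\<lambda>_. c" M] assms(3) by auto

lemma nn_integral_fiber_bounded:
  assumes "exp_decay g" "L > 0"
  obtains K where "K > 0" "\<And>(c :: int \<Rightarrow> 'a::{banach, second_countable_topology}) M t.
      (\<And>j. norm (c j) \<le> M) \<Longrightarrow>
      (\<integral>\<^sup>+j. ennreal (norm (g (t + of_int j * L) *\<^sub>R c j)) \<partial>int_count) \<le> ennreal (K * M)"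
proof -
  have g': "exp_decay (\<lambda>x. \<bar>g x\<bar>)"
    using assms(1) by (auto simp: exp_decay_def intro!: continuous_intros)
  obtain K where K: "K > 0" "\<And>(c :: int \<Rightarrow> real) M t.
      (\<And>j. norm (c j) \<le> M) \<Longrightarrow> norm (fiber L (\<lambda>x. \<bar>g x\<bar>) c t) \<le> K * M"
    using fiber_bounded_exp [OF g' assms(2), where 'a = real] by metis
  show ?thesis
  proof (rule that [OF K(1)])
    fix c :: "int \<Rightarrow> 'a" and M t
    assume c: "\<And>j. norm (c j) \<le> M"
    have "(\<integral>\<^sup>+j. ennreal (norm (g (t + of_int j * L) *\<^sub>R c j)) \<partial>int_count)
        = ennreal (fiber L (\<lambda>x. \<bar>g x\<bar>) (\<lambda>j. norm (c j)) t)"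
      using nn_integral_eq_integral [OF integrable_norm [OF integrable_fiber [OF assms c, of t]]]
      by (simp add: fiber_def)
    also have "\<dots> \<le> ennreal (K * M)"
      using K(2) [of "\<lambda>j. norm (c j)" M t] c by (intro ennreal_leI) auto
    finally show "(\<integral>\<^sup>+j. ennreal (norm (g (t + of_int j * L) *\<^sub>R c j)) \<partial>int_count) \<le> ennreal (K * M)" .
  qed
qed

text \<open>Schur's test. Cauchy-Schwarz for the kernel written as
  \<open>sqrt (E k j) * sqrt (E k j)\<close> spends one factor on the row sums, bounded by
  \<open>K\<close>; the other factor is summed over \<open>k\<close> afterwards and gives the column
  bound \<open>K2\<close>.\<close>

lemma nn_integral_fiber_le:
  assumes g: "exp_decay g" and L: "L > 0" and "\<alpha> > 0"
  obtains B where "B > 0" "\<And>(c :: int \<Rightarrow> 'a::{banach, second_countable_topology}) x.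
    (\<integral>\<^sup>+k. ennreal ((norm (fiber L g c (x - of_int k * \<alpha>)))\<^sup>2) \<partial>int_count)
      \<le> ennreal B * (\<integral>\<^sup>+j. ennreal ((norm (c j))\<^sup>2) \<partial>int_count)"
proof -
  obtain C a where *: "a > 0" "C > 0" "\<And>x. \<bar>g x\<bar> \<le> C * exp (- (a * \<bar>x\<bar>))"
    using exp_decayE [OF g] by metis
  obtain K where K: "K > 0"
    "\<And>t. (\<integral>\<^sup>+j. ennreal (exp (- (a * \<bar>t + of_int j * L\<bar>))) \<partial>int_count) \<le> ennreal K"
    using integral_exp_abs_int_bound [OF *(1) L] by metis
  obtain K2 where K2: "K2 > 0"
    "\<And>t. (\<integral>\<^sup>+k. ennreal (exp (- (a * \<bar>t + of_int k * \<alpha>\<bar>))) \<partial>int_count) \<le> ennreal K2"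
    using integral_exp_abs_int_bound [OF *(1) \<open>\<alpha> > 0\<close>] by metis
  show ?thesis
  proof (rule that [of "C\<^sup>2 * K * K2"])
    show "C\<^sup>2 * K * K2 > 0" using * K K2 by simp
    fix c :: "int \<Rightarrow> 'a" and x
    define E where "E k j = exp (- (a * \<bar>x - of_int k * \<alpha> + of_int j * L\<bar>))" for k j :: int
    have le: "ennreal ((norm (fiber L g c (x - of_int k * \<alpha>)))\<^sup>2)
        \<le> ennreal (C\<^sup>2 * K) * (\<integral>\<^sup>+j. ennreal (E k j) * ennreal ((norm (c j))\<^sup>2) \<partial>int_count)" for k
    proof -
      \<comment> \<open>If the series does not converge absolutely, \<open>fiber\<close> has the
        default value 0 and the estimate is trivial.\<close>
      have "ennreal (norm (fiber L g c (x - of_int k * \<alpha>)))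
          \<le> (\<integral>\<^sup>+j. ennreal (norm (g (x - of_int k * \<alpha> + of_int j * L) *\<^sub>R c j)) \<partial>int_count)"
        unfolding fiber_def
        by (cases "integrable int_count (\<lambda>j. g (x - of_int k * \<alpha> + of_int j * L) *\<^sub>R c j)")
          (rule integral_norm_bound_ennreal, assumption, simp add: not_integrable_integral_eq)
      also have "\<dots> \<le> (\<integral>\<^sup>+j. ennreal (sqrt (E k j)) * ennreal (C * (sqrt (E k j) * norm (c j))) \<partial>int_count)"
      proof (intro nn_integral_mono)
        fix j
        have "norm (g (x - of_int k * \<alpha> + of_int j * L) *\<^sub>R c j) \<le> (C * E k j) * norm (c j)"
          unfolding norm_scaleR E_def by (intro mult_mono *) (use * in auto)
        also have "E k j = sqrt (E k j) * sqrt (E k j)"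
          unfolding E_def by simp
        also have "C * (sqrt (E k j) * sqrt (E k j)) * norm (c j)
            = sqrt (E k j) * (C * (sqrt (E k j) * norm (c j)))"
          by (simp add: mult_ac)
        finally show "ennreal (norm (g (x - of_int k * \<alpha> + of_int j * L) *\<^sub>R c j))
            \<le> ennreal (sqrt (E k j)) * ennreal (C * (sqrt (E k j) * norm (c j)))"
          using * by (subst ennreal_mult [symmetric]) (auto intro!: ennreal_leI simp: E_def)
      qed
      finally have "(ennreal (norm (fiber L g c (x - of_int k * \<alpha>))))\<^sup>2 \<le>
          (\<integral>\<^sup>+j. ennreal (sqrt (E k j)) * ennreal (C * (sqrt (E k j) * norm (c j))) \<partial>int_count)\<^sup>2"
        by (rule power_mono) simp
      also have "\<dots> \<le> (\<integral>\<^sup>+j. (ennreal (sqrt (E k j)))\<^sup>2 \<partial>int_count)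
          * (\<integral>\<^sup>+j. (ennreal (C * (sqrt (E k j) * norm (c j))))\<^sup>2 \<partial>int_count)"
        by (rule Cauchy_Schwarz_nn_integral) auto
      also have "(\<lambda>j. (ennreal (sqrt (E k j)))\<^sup>2) = (\<lambda>j. ennreal (E k j))"
        by (auto simp: ennreal_power E_def)
      also have "(\<lambda>j. (ennreal (C * (sqrt (E k j) * norm (c j))))\<^sup>2)
          = (\<lambda>j. ennreal (C\<^sup>2) * (ennreal (E k j) * ennreal ((norm (c j))\<^sup>2)))"
        using * by (auto simp: ennreal_power E_def power_mult_distrib ennreal_mult [symmetric])
      also have "(\<integral>\<^sup>+j. ennreal (E k j) \<partial>int_count) * (\<integral>\<^sup>+j. ennreal (C\<^sup>2) * (ennreal (E k j) * ennreal ((norm (c j))\<^sup>2)) \<partial>int_count)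
         \<le> ennreal K * (\<integral>\<^sup>+j. ennreal (C\<^sup>2) * (ennreal (E k j) * ennreal ((norm (c j))\<^sup>2)) \<partial>int_count)"
        unfolding E_def by (intro mult_right_mono K) auto
      also have "\<dots> = ennreal (C\<^sup>2 * K) * (\<integral>\<^sup>+j. ennreal (E k j) * ennreal ((norm (c j))\<^sup>2) \<partial>int_count)"
        using * K by (subst nn_integral_cmult) (auto simp: ennreal_mult mult_ac)
      finally show ?thesis
        by (simp add: ennreal_power)
    qed
    have "(\<integral>\<^sup>+k. ennreal ((norm (fiber L g c (x - of_int k * \<alpha>)))\<^sup>2) \<partial>int_count)
      \<le> (\<integral>\<^sup>+k. ennreal (C\<^sup>2 * K) * (\<integral>\<^sup>+j. ennreal (E k j) * ennreal ((norm (c j))\<^sup>2) \<partial>int_count) \<partial>int_count)"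
      by (intro nn_integral_mono le)
    also have "\<dots> = ennreal (C\<^sup>2 * K) * (\<integral>\<^sup>+k. (\<integral>\<^sup>+j. ennreal (E k j) * ennreal ((norm (c j))\<^sup>2) \<partial>int_count) \<partial>int_count)"
      by (subst nn_integral_cmult) auto
    finally have le1: "(\<integral>\<^sup>+k. ennreal ((norm (fiber L g c (x - of_int k * \<alpha>)))\<^sup>2) \<partial>int_count)
      \<le> ennreal (C\<^sup>2 * K) * (\<integral>\<^sup>+k. (\<integral>\<^sup>+j. ennreal (E k j) * ennreal ((norm (c j))\<^sup>2) \<partial>int_count) \<partial>int_count)" .
    have "(\<integral>\<^sup>+k. (\<integral>\<^sup>+j. ennreal (E k j) * ennreal ((norm (c j))\<^sup>2) \<partial>int_count) \<partial>int_count)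
        = (\<integral>\<^sup>+j. (\<integral>\<^sup>+k. ennreal (E k j) * ennreal ((norm (c j))\<^sup>2) \<partial>int_count) \<partial>int_count)"
      by (rule nn_integral_count_space_nn_integral) auto
    also have "\<dots> = (\<integral>\<^sup>+j. ennreal ((norm (c j))\<^sup>2) * (\<integral>\<^sup>+k. ennreal (E k j) \<partial>int_count) \<partial>int_count)"
      by (subst nn_integral_multc) (auto simp: mult.commute)
    also have "\<dots> \<le> (\<integral>\<^sup>+j. ennreal ((norm (c j))\<^sup>2) * ennreal K2 \<partial>int_count)"
    proof (intro nn_integral_mono mult_left_mono)
      fix j :: int
      have "(\<integral>\<^sup>+k. ennreal (E k j) \<partial>int_count)
          = (\<integral>\<^sup>+k. (\<lambda>k. ennreal (exp (- (a * \<bar>x + of_int j * L + of_int k * \<alpha>\<bar>)))) (- k) \<partial>int_count)"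
        unfolding E_def by (intro nn_integral_cong) (auto simp: algebra_simps)
      also have "\<dots> = (\<integral>\<^sup>+k. ennreal (exp (- (a * \<bar>x + of_int j * L + of_int k * \<alpha>\<bar>))) \<partial>int_count)"
        by (rule nn_integral_int_uminus)
      also have "\<dots> \<le> ennreal K2" by (rule K2)
      finally show "(\<integral>\<^sup>+k. ennreal (E k j) \<partial>int_count) \<le> ennreal K2" .
    qed auto
    also have "\<dots> = (\<integral>\<^sup>+j. ennreal ((norm (c j))\<^sup>2) \<partial>int_count) * ennreal K2"
      by (subst nn_integral_multc) auto
    finally have "(\<integral>\<^sup>+k. (\<integral>\<^sup>+j. ennreal (E k j) * ennreal ((norm (c j))\<^sup>2) \<partial>int_count) \<partial>int_count)
      \<le> (\<integral>\<^sup>+j. ennreal ((norm (c j))\<^sup>2) \<partial>int_count) * ennreal K2" .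
    then have "ennreal (C\<^sup>2 * K) * (\<integral>\<^sup>+k. (\<integral>\<^sup>+j. ennreal (E k j) * ennreal ((norm (c j))\<^sup>2) \<partial>int_count) \<partial>int_count)
      \<le> ennreal (C\<^sup>2 * K) * ((\<integral>\<^sup>+j. ennreal ((norm (c j))\<^sup>2) \<partial>int_count) * ennreal K2)"
      by (rule mult_left_mono) simp
    note order_trans [OF le1 this]
    also have "\<dots> = ennreal (C\<^sup>2 * K * K2) * (\<integral>\<^sup>+j. ennreal ((norm (c j))\<^sup>2) \<partial>int_count)"
      using K K2 * by (simp add: ennreal_mult mult_ac)
    finally show "(\<integral>\<^sup>+k. ennreal ((norm (fiber L g c (x - of_int k * \<alpha>)))\<^sup>2) \<partial>int_count)
      \<le> ennreal (C\<^sup>2 * K * K2) * (\<integral>\<^sup>+j. ennreal ((norm (c j))\<^sup>2) \<partial>int_count)" .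
  qed
qed

section \<open>Sums of Gaussians are determined by their zeros\<close>

lemma exp_decay_gaussian:
  assumes "a > 0"
  shows "exp_decay (\<lambda>x. A * exp (- (a * x\<^sup>2)))"
  unfolding exp_decay_def
proof (intro conjI exI allI)
  show "continuous_on UNIV (\<lambda>x. A * exp (- (a * x\<^sup>2)))" by (intro continuous_intros)
  show "(0::real) < 1" by simp
  fix x :: real
  have "\<bar>x\<bar> \<le> a * x\<^sup>2 + 1 / (4 * a)"
  proof -
    have "0 \<le> a * (\<bar>x\<bar> - 1 / (2 * a))\<^sup>2" using assms by simp
    also have "\<dots> = a * x\<^sup>2 - \<bar>x\<bar> + 1 / (4 * a)"
      using assms by (simp add: power2_diff power_divide field_simps) (simp add: power2_eq_square)
    finally show ?thesis by simp
  qed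
  then have "exp (- (a * x\<^sup>2)) \<le> exp (1 / (4 * a) - 1 * \<bar>x\<bar>)" by simp
  then have "\<bar>A\<bar> * exp (- (a * x\<^sup>2)) \<le> \<bar>A\<bar> * exp (1 / (4 * a) - 1 * \<bar>x\<bar>)"
    by (intro mult_left_mono) auto
  then show "\<bar>A * exp (- (a * x\<^sup>2))\<bar> \<le> (\<bar>A\<bar> * exp (1 / (4 * a))) * exp (- (1 * \<bar>x\<bar>))"
    by (simp add: abs_mult exp_diff exp_minus field_simps)
qed

text \<open>Zeros are removed one at a time: the factors already split off do not vanish at the new
  point, so the cofactor does, and its difference quotient extends holomorphically across that
  point.\<close>

lemma holomorphic_factor_zeros:
  assumes "finite Z" "open S" "h holomorphic_on S" "Z \<subseteq> S" "\<And>z. z \<in> Z \<Longrightarrow> h z = 0"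
  shows "\<exists>h1. h1 holomorphic_on S \<and> (\<forall>w\<in>S. h w = (\<Prod>z\<in>Z. w - z) * h1 w)"
  using assms(1,4,5)
proof (induction Z)
  case empty
  then show ?case using assms(3) by auto
next
  case (insert z Z)
  then obtain h1 where h1: "h1 holomorphic_on S" "\<forall>w\<in>S. h w = (\<Prod>z\<in>Z. w - z) * h1 w"
    by auto
  let ?h2 = "\<lambda>w. if w = z then deriv h1 z else (h1 w - h1 z) / (w - z)"
  have "(\<Prod>z'\<in>Z. z - z') \<noteq> 0" using insert by (auto simp: prod_zero_iff)
  moreover have "h z = 0" "z \<in> S" using insert by auto
  ultimately have "h1 z = 0" using h1(2) by auto
  have "?h2 holomorphic_on S" using pole_lemma_open [OF h1(1) assms(2)] .
  moreover have "h w = (\<Prod>z\<in>insert z Z. w - z) * ?h2 w" if "w \<in> S" for w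
    using that insert h1(2) \<open>h1 z = 0\<close> \<open>h z = 0\<close> by auto
  ultimately show ?case by blast
qed

lemma integral_int_indicator:
  fixes f :: "int \<Rightarrow> 'a::{banach, second_countable_topology}"
  assumes "finite A"
  shows "(LINT j|int_count. indicator A j *\<^sub>R f j) = (\<Sum>j\<in>A. f j)"
proof -
  have sub: "{j \<in> UNIV. indicator A j *\<^sub>R f j \<noteq> 0} \<subseteq> A"
    by (auto simp: indicator_def split: if_splits)
  have "(LINT j|int_count. indicator A j *\<^sub>R f j) = (\<Sum>j | j \<in> UNIV \<and> indicator A j *\<^sub>R f j \<noteq> 0. indicator A j *\<^sub>R f j)"
    by (rule lebesgue_integral_count_space_finite_support) (rule finite_subset [OF sub assms])
  also have "\<dots> = (\<Sum>j\<in>A. f j)"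
    using sub assms by (intro sum.mono_neutral_cong_left) auto
  finally show ?thesis .
qed

text \<open>Orthogonality of characters, used with period 1 to extract Laurent coefficients and with
  the period of the modulations for Fourier series.\<close>

lemma integral_exp_period:
  fixes L :: real and l :: int
  assumes "L > 0"
  shows "(LINT x|lborel. indicator {0..<L} x *\<^sub>R exp (2 * of_real pi * \<i> * of_int l * of_real x / of_real L))
    = (if l = 0 then of_real L else 0 :: complex)"
proof -
  have "(LINT x|lborel. indicator {0..<L} x *\<^sub>R exp (2 * of_real pi * \<i> * of_int l * of_real x / of_real L))
     = (LINT x|lborel. indicator {0..L} x *\<^sub>R exp (2 * of_real pi * \<i> * of_int l * of_real x / of_real L))"
  proof (rule integral_cong_AE)
    show "AE x in lborel. indicator {0..<L} x *\<^sub>R exp (2 * of_real pi * \<i> * of_int l * of_real x / of_real L)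
       = indicator {0..L} x *\<^sub>R (exp (2 * of_real pi * \<i> * of_int l * of_real x / of_real L) :: complex)"
      using AE_lborel_singleton [of L] by eventually_elim (auto simp: indicator_def)
  qed auto
  also have "\<dots> = (if l = 0 then of_real L else 0)"
  proof (cases "l = 0")
    case True
    then show ?thesis using assms by (simp add: scaleR_conv_of_real)
  next
    case False
    define k :: complex where "k = 2 * of_real pi * \<i> * of_int l / of_real L"
    have k: "k \<noteq> 0" using False assms by (simp add: k_def)
    have "(LINT x|lborel. indicator {0..L} x *\<^sub>R exp (k * of_real x)) = exp (k * of_real L) / k - exp (k * of_real 0) / k"
    proof (rule integral_FTC_Icc)
      show "0 \<le> L" using assms by simp
      show "continuous_on {0..L} (\<lambda>x. exp (k * of_real x))" by (intro continuous_intros)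
      fix x :: real
      have "((\<lambda>x. exp (k * x) / k) has_field_derivative exp (k * of_real x)) (at (of_real x))"
        using k by (auto intro!: derivative_eq_intros)
      then have "((\<lambda>x. exp (k * of_real x) / k) has_vector_derivative exp (k * of_real x)) (at x)"
        by (rule has_vector_derivative_real_field)
      then show "((\<lambda>x. exp (k * of_real x) / k) has_vector_derivative exp (k * of_real x)) (at x within {0..L})"
        by (rule has_vector_derivative_at_within)
    qed
    also have "exp (k * of_real L) = exp (of_int (2 * l) * (of_real pi * \<i>))"
      using assms by (simp add: k_def mult_ac)
    also have "\<dots> = 1"
      using exp_integer_2pi [of "of_int l"] by (simp add: mult_ac)
    finally show ?thesis using False by (simp add: k_def mult_ac)
  qed
  finally show ?thesis .
qed

section \<open>The Laurent series attached to a sum of Gaussians\<close>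

context
  fixes a L M :: real and c :: "int \<Rightarrow> real"
  assumes a: "a > 0" and L: "L > 0" and M: "\<And>j. \<bar>c j\<bar> \<le> M"
begin

text \<open>In the variable \<open>w = exp (- 2 a L t)\<close> a sum of Gaussians is, up to the factor \<open>exp (- a t\<^sup>2)\<close>,
  a Laurent series.\<close>

definition laurent_coeff :: "int \<Rightarrow> complex" where
  "laurent_coeff j = of_real (c j * exp (- (a * L\<^sup>2 * (of_int j)\<^sup>2)))"

definition laurent :: "complex \<Rightarrow> complex" where
  "laurent w = (LINT j|int_count. laurent_coeff j * w powi j)"

text \<open>Complete the square: \<open>- a L^2 j^2 - 2 a L t j = a t^2 - a (t + j L)^2\<close>.
  Convergence and growth on a circle thereby reduce to Gaussian shift sums.\<close>

lemma norm_laurent_term: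
  assumes "norm w = exp (- (2 * a * L * t))"
  shows "norm (laurent_coeff j * w powi j) = exp (a * t\<^sup>2) * (exp (- (a * (t + of_int j * L)\<^sup>2)) * \<bar>c j\<bar>)"
proof -
  have "norm (w powi j) = exp (of_int j * (- (2 * a * L * t)))"
    using assms by (simp add: norm_power_int powr_real_of_int' [symmetric] exp_powr_real mult_ac)
  then show ?thesis
    by (simp add: laurent_coeff_def norm_mult abs_mult exp_add [symmetric] algebra_simps power2_eq_square)
qed

lemma norm_exp_form:
  assumes "w \<noteq> 0"
  obtains t where "norm (w::complex) = exp (- (2 * a * L * t))"
proof
  show "norm w = exp (- (2 * a * L * (- ln (norm w) / (2 * a * L))))"
    using assms a L by simp
qed

lemma integrable_laurent:
  assumes "w \<noteq> 0"
  shows "integrable int_count (\<lambda>j. norm (laurent_coeff j * w powi j))"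
    and "integrable int_count (\<lambda>j. laurent_coeff j * w powi j)"
proof -
  obtain t where t: "norm w = exp (- (2 * a * L * t))" using norm_exp_form [OF assms] .
  have "integrable int_count (\<lambda>j. (\<lambda>x. 1 * exp (- (a * x\<^sup>2))) (t + of_int j * L) *\<^sub>R \<bar>c j\<bar>)"
    by (rule integrable_fiber [where M = M, OF exp_decay_gaussian [OF a] L]) (simp add: M)
  then have "integrable int_count (\<lambda>j. exp (a * t\<^sup>2) * (exp (- (a * (t + of_int j * L)\<^sup>2)) * \<bar>c j\<bar>))"
    by (intro integrable_mult_right) simp
  then show "integrable int_count (\<lambda>j. norm (laurent_coeff j * w powi j))"
    by (simp only: norm_laurent_term [OF t])
  then show "integrable int_count (\<lambda>j. laurent_coeff j * w powi j)"
    by (rule integrable_norm_cancel) simp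
qed

text \<open>The Gaussian shift sum is bounded uniformly in \<open>t\<close>, so only the prefactor
  of the completed square remains. This growth, quadratic in the logarithm of the radius, is what
  the zeros have to beat.\<close>

lemma laurent_bound:
  obtains K where "K \<ge> 0" "\<And>w t. norm w = exp (- (2 * a * L * t)) \<Longrightarrow> norm (laurent w) \<le> K * exp (a * t\<^sup>2)"
proof -
  obtain K where K: "K > 0" "\<And>c M t. (\<And>j. norm (c j) \<le> M) \<Longrightarrow> norm (fiber L (\<lambda>x. 1 * exp (- (a * x\<^sup>2))) (c :: int \<Rightarrow> real) t) \<le> K * M"
    using fiber_bounded_exp [OF exp_decay_gaussian [OF a] L] by metis
  show ?thesis
  proof (rule that [of "K * M"])
    show "K * M \<ge> 0" using K M [of 0] by auto
    fix w :: complex and t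
    assume t: "norm w = exp (- (2 * a * L * t))"
    have "norm (laurent w) \<le> (LINT j|int_count. norm (laurent_coeff j * w powi j))"
      unfolding laurent_def by (rule integral_norm_bound)
    also have "\<dots> = exp (a * t\<^sup>2) * fiber L (\<lambda>x. 1 * exp (- (a * x\<^sup>2))) (\<lambda>j. \<bar>c j\<bar>) t"
      by (simp add: norm_laurent_term [OF t] fiber_def)
    also have "\<dots> \<le> exp (a * t\<^sup>2) * (K * M)"
      using K(2) [of "\<lambda>j. \<bar>c j\<bar>" M t] M by (intro mult_left_mono) auto
    finally show "norm (laurent w) \<le> K * M * exp (a * t\<^sup>2)" by (simp add: mult_ac)
  qed
qed

text \<open>Carries a real zero \<open>t\<close> of the shift sum to a zero of
  \<open>laurent\<close> on the positive half-line.\<close>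

lemma laurent_real:
  "laurent (of_real (exp (- (2 * a * L * t)))) = of_real (exp (a * t\<^sup>2) * fiber L (\<lambda>x. exp (- (a * x\<^sup>2))) c t)"
proof -
  have "laurent_coeff j * of_real (exp (- (2 * a * L * t))) powi j
      = of_real (exp (a * t\<^sup>2) * (exp (- (a * (t + of_int j * L)\<^sup>2)) * c j))" for j
  proof -
    have "exp (- (2 * a * L * t)) powi j = exp (of_int j * (- (2 * a * L * t)))"
      by (simp add: powr_real_of_int' [symmetric] exp_powr_real mult_ac)
    then have "laurent_coeff j * of_real (exp (- (2 * a * L * t))) powi j
       = of_real (c j * exp (- (a * L\<^sup>2 * (of_int j)\<^sup>2)) * exp (of_int j * (- (2 * a * L * t))))"
      unfolding laurent_coeff_def of_real_power_int [symmetric] by simp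
    also have "c j * exp (- (a * L\<^sup>2 * (of_int j)\<^sup>2)) * exp (of_int j * (- (2 * a * L * t)))
      = exp (a * t\<^sup>2) * (exp (- (a * (t + of_int j * L)\<^sup>2)) * c j)"
      by (simp add: mult_ac) (simp add: exp_add [symmetric] algebra_simps power2_eq_square)
    finally show ?thesis .
  qed
  then show ?thesis
    unfolding laurent_def fiber_def
    by (simp only: real_scaleR_def integral_complex_of_real integral_mult_right_zero [symmetric])
qed

text \<open>Weierstrass test on a disc that stays away from 0: terms with \<open>j \<ge> 0\<close>
  are dominated by their size at the outer radius \<open>R\<close>, terms with \<open>j < 0\<close>
  by their size at the inner radius \<open>r\<close>, so the sum of both is a summable
  majorant.\<close>

lemma holomorphic_laurent: "laurent holomorphic_on - {0}"
proof (rule holomorphic_uniform_sequence)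
  show "open (- {0 :: complex})" by auto
  let ?h = "\<lambda>(n::nat) w. \<Sum>j\<in>{- int n..int n}. laurent_coeff j * w powi j"
  show "?h n holomorphic_on - {0}" for n
    by (intro holomorphic_intros) auto
  fix x :: complex
  assume "x \<in> - {0}"
  then have x: "norm x > 0" by auto
  show "\<exists>d>0. cball x d \<subseteq> - {0} \<and> uniform_limit (cball x d) ?h laurent sequentially"
  proof (intro exI conjI)
    let ?d = "norm x / 2"
    show "?d > 0" using x by simp
    show sub: "cball x ?d \<subseteq> - {0}"
      using x by (auto simp: dist_norm)
    define r R where "r = (of_real (norm x / 2) :: complex)" and "R = (of_real (2 * norm x) :: complex)"
    define m where "m j = norm (laurent_coeff j * r powi j) + norm (laurent_coeff j * R powi j)" for j
    have r: "r \<noteq> 0" "R \<noteq> 0" using x by (auto simp: r_def R_def)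
    have int_m: "integrable int_count m"
      unfolding m_def using r by (intro Bochner_Integration.integrable_add integrable_laurent)
    have le_m: "norm (laurent_coeff j * w powi j) \<le> m j" if "w \<in> cball x ?d" for w j
    proof -
      have w: "norm w \<le> norm R" "norm r \<le> norm w"
        using that x norm_triangle_ineq2 [of x w] norm_triangle_ineq2 [of w x]
        by (auto simp: r_def R_def dist_norm norm_minus_commute)
      have rp: "norm r > 0" using r by simp
      have "norm w powi j \<le> norm r powi j + norm R powi j"
      proof (cases "j \<ge> 0")
        case True
        then have "norm w powi j \<le> norm R powi j"
          using w rp by (intro power_int_mono) auto
        then show ?thesis by (simp add: add_increasing zero_le_power_int)
      next
        case False
        then have "norm w powi j \<le> norm r powi j"
          using w rp by (auto simp: power_int_def intro!: power_mono le_imp_inverse_le)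
        then show ?thesis by (simp add: add_increasing2 zero_le_power_int)
      qed
      then have "norm (laurent_coeff j) * norm w powi j \<le> norm (laurent_coeff j) * (norm r powi j + norm R powi j)"
        by (intro mult_left_mono) auto
      then show ?thesis
        by (simp add: m_def norm_mult norm_power_int algebra_simps)
    qed
    define e where "e n = (LINT j|int_count. indicator (- {- int n..int n}) j * m j)" for n :: nat
    have "e \<longlonglongrightarrow> (LINT j|int_count. 0)"
      unfolding e_def
    proof (rule integral_dominated_convergence [where w = m])
      show "AE j in int_count. (\<lambda>n. indicator (- {- int n..int n}) j * m j) \<longlonglongrightarrow> 0"
      proof (intro AE_I2)
        fix j
        have "eventually (\<lambda>n. indicator (- {- int n..int n}) j * m j = 0) sequentially"
          using eventually_ge_at_top [of "nat \<bar>j\<bar>"] by eventually_elim (auto simp: indicator_def)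
        then show "(\<lambda>n. indicator (- {- int n..int n}) j * m j) \<longlonglongrightarrow> 0"
          by (rule tendsto_eventually)
      qed
      show "AE j in int_count. norm (indicator (- {- int n..int n}) j * m j) \<le> m j" for n :: nat
        by (auto simp: indicator_def m_def)
    qed (use int_m in auto)
    then have e: "e \<longlonglongrightarrow> 0" by simp
    have bound: "norm (laurent w - ?h n w) \<le> e n" if w: "w \<in> cball x ?d" for w n
    proof -
      have "w \<noteq> 0" using sub w by auto
      let ?A = "{- int n..int n}"
      have fs: "(LINT j|int_count. indicator ?A j *\<^sub>R (laurent_coeff j * w powi j)) = ?h n w"
        by (rule integral_int_indicator) simp
      have "laurent w - ?h n w = (LINT j|int_count. laurent_coeff j * w powi j - indicator ?A j *\<^sub>R (laurent_coeff j * w powi j))"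
        unfolding laurent_def fs [symmetric]
        by (intro Bochner_Integration.integral_diff [symmetric] integrable_laurent \<open>w \<noteq> 0\<close> integrable_mult_indicator) auto
      also have "\<dots> = (LINT j|int_count. indicator (- ?A) j *\<^sub>R (laurent_coeff j * w powi j))"
        by (intro Bochner_Integration.integral_cong) (auto simp: indicator_def)
      also have "norm \<dots> \<le> (LINT j|int_count. norm (indicator (- ?A) j *\<^sub>R (laurent_coeff j * w powi j)))"
        by (rule integral_norm_bound)
      also have "\<dots> \<le> (LINT j|int_count. indicator (- ?A) j * m j)"
      proof (rule integral_mono)
        show "integrable int_count (\<lambda>j. norm (indicator (- ?A) j *\<^sub>R (laurent_coeff j * w powi j)))"
          by (intro integrable_norm integrable_mult_indicator integrable_laurent \<open>w \<noteq> 0\<close>) auto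
        have "integrable int_count (\<lambda>j. indicator (- ?A) j *\<^sub>R m j)"
          by (intro integrable_mult_indicator int_m) auto
        then show "integrable int_count (\<lambda>j. indicator (- ?A) j * m j)"
          by simp
      qed (use le_m [OF w] in \<open>auto simp: indicator_def\<close>)
      finally show ?thesis unfolding e_def .
    qed
    show "uniform_limit (cball x ?d) ?h laurent sequentially"
    proof (rule uniform_limitI)
      fix \<epsilon> :: real assume "\<epsilon> > 0"
      then have "eventually (\<lambda>n. e n < \<epsilon>) sequentially"
        by (intro order_tendstoD(2) [OF e]) auto
      then show "\<forall>\<^sub>F n in sequentially. \<forall>w\<in>cball x ?d. dist (?h n w) (laurent w) < \<epsilon>"
      proof eventually_elim
        case (elim n)
        show ?case
        proof
          fix w assume "w \<in> cball x ?d"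
          from le_less_trans [OF bound [OF this] elim] show "dist (?h n w) (laurent w) < \<epsilon>"
            by (simp only: dist_norm norm_minus_commute)
        qed
      qed
    qed
  qed
qed

text \<open>Cauchy's coefficient formula: integrating over the unit circle against the character of
  index \<open>- p\<close> and interchanging with the series leaves a single term.\<close>

lemma laurent_zero_imp:
  assumes "\<And>w. w \<noteq> 0 \<Longrightarrow> laurent w = 0"
  shows "c p = 0"
proof -
  \<comment> \<open>The division by \<open>of_real 1\<close> makes the expression an instance of
    \<open>integral_exp_period\<close> at period 1.\<close>
  define f where "f j x = indicator {0..<1::real} x *\<^sub>R (laurent_coeff j * exp (2 * of_real pi * \<i> * of_int (j - p) * of_real x / of_real 1))" for j x
  have nf: "norm (f j x) = indicator {0..<1} x * norm (laurent_coeff j)" for j x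
  proof -
    have "norm (exp (2 * of_real pi * \<i> * of_int (j - p) * of_real x / of_real 1 :: complex)) = 1"
      by (subst norm_exp_eq_Re) simp
    then show ?thesis by (simp only: f_def norm_scaleR norm_mult) (simp add: indicator_def)
  qed
  have meas: "f j \<in> borel_measurable lborel" for j
    unfolding f_def by measurable
  have "(\<integral>\<^sup>+j. (\<integral>\<^sup>+x. ennreal (norm (f j x)) \<partial>lborel) \<partial>int_count) = (\<integral>\<^sup>+j. ennreal (norm (laurent_coeff j)) \<partial>int_count)"
  proof (intro nn_integral_cong)
    fix j
    have "(\<integral>\<^sup>+x. ennreal (norm (f j x)) \<partial>lborel) = (\<integral>\<^sup>+x. ennreal (norm (laurent_coeff j)) * indicator {0..<1::real} x \<partial>lborel)"
      unfolding nf by (intro nn_integral_cong) (simp add: indicator_def)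
    then show "(\<integral>\<^sup>+x. ennreal (norm (f j x)) \<partial>lborel) = ennreal (norm (laurent_coeff j))"
      by (simp add: nn_integral_cmult_indicator)
  qed
  also have "\<dots> < \<infinity>"
    using integrable_laurent(2) [of 1] by (simp add: integrable_iff_bounded)
  finally have swap: "(LINT j|int_count. LINT x|lborel. f j x) = (LINT x|lborel. LINT j|int_count. f j x)"
    using int_sum_integral_swap(1) [OF lborel.sigma_finite_measure_axioms, of f] meas by blast
  have "(LINT j|int_count. f j x) = 0" for x
  proof -
    let ?w = "exp (2 * of_real pi * \<i> * of_real x) :: complex"
    have "f j x = (indicator {0..<1} x *\<^sub>R ?w powi (- p)) * (laurent_coeff j * ?w powi j)" for j
    proof -
      have "?w powi j = exp (of_int j * (2 * of_real pi * \<i> * of_real x))" for j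
        by (simp only: exp_power_int)
      then have "?w powi j * ?w powi (- p) = exp (2 * of_real pi * \<i> * of_int (j - p) * of_real x / of_real 1)"
        by (simp add: exp_add [symmetric] algebra_simps)
      then show ?thesis by (simp add: f_def mult_ac)
    qed
    then have "(LINT j|int_count. f j x) = (indicator {0..<1} x *\<^sub>R ?w powi (- p)) * laurent ?w"
      unfolding laurent_def by simp
    also have "laurent ?w = 0" by (rule assms) simp
    finally show ?thesis by simp
  qed
  moreover have "(LINT x|lborel. f j x) = (if j = p then laurent_coeff p else 0)" for j
  proof -
    have "(LINT x|lborel. f j x) = laurent_coeff j * (LINT x|lborel. indicator {0..<1::real} x *\<^sub>R exp (2 * of_real pi * \<i> * of_int (j - p) * of_real x / of_real 1))"
      unfolding f_def by (simp only: mult_scaleR_right [symmetric] integral_mult_right_zero)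
    then show ?thesis using integral_exp_period [of 1 "j - p"] by simp
  qed
  ultimately have "(LINT j|int_count. (if j = p then laurent_coeff p else 0)) = 0"
    using swap by simp
  moreover have "(LINT j|int_count. (if j = p then laurent_coeff p else 0)) = laurent_coeff p"
    by (subst lebesgue_integral_count_space_finite_support) (auto simp: if_distrib)
  ultimately have "laurent_coeff p = 0" by simp
  then show ?thesis by (simp add: laurent_coeff_def)
qed

text \<open>A count in the style of Jensen's formula. Every zero inside an annulus gains the ratio
  between its modulus and a boundary radius; the product of these gains is \<open>E n\<close>, of
  order \<open>exp (a * L * \<alpha> * n\<^sup>2)\<close>, while the growth of the series on the
  boundary costs only \<open>exp (a * \<alpha>\<^sup>2 * n\<^sup>2)\<close> to leading order. All
  other losses are exponential in \<open>n\<close>.\<close>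

lemma gaussian_sum_unique:
  fixes \<alpha> D :: real and y :: "int \<Rightarrow> real"
  assumes \<alpha>: "0 < \<alpha>" "\<alpha> < L" and "inj y" and y: "\<And>k. \<bar>y k - \<alpha> * of_int k\<bar> \<le> D"
    and zero: "\<And>k. fiber L (\<lambda>x. exp (- (a * x\<^sup>2))) c (y k) = 0"
  shows "c p = 0"
proof (rule laurent_zero_imp)
  obtain K where K: "K \<ge> 0" "\<And>w t. norm w = exp (- (2 * a * L * t)) \<Longrightarrow> norm (laurent w) \<le> K * exp (a * t\<^sup>2)"
    using laurent_bound by metis
  define b where "b = 2 * a * L"
  have b: "b > 0" using a L by (simp add: b_def)
  have D: "D \<ge> 0" using y [of 0] by simp
  define z where "z k = exp (- (b * y k))" for k
  have z_pos: "z k > 0" for k by (simp add: z_def)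
  have "inj z" using \<open>inj y\<close> b by (auto simp: inj_on_def z_def)
  have lz: "laurent (of_real (z k)) = 0" for k
    using laurent_real [of "y k"] zero [of k] by (simp add: z_def b_def)
  fix w0 :: complex assume "w0 \<noteq> 0"
  then have w0: "norm w0 > 0" by simp
  \<comment> \<open>When \<open>t\<close> and \<open>y k\<close> differ by at least 1, the radii
    \<open>exp (- b t)\<close> and \<open>z k\<close> differ by at least the fraction
    \<open>\<kappa>\<close> of the larger one.\<close>
  define \<kappa> where "\<kappa> = 1 - exp (- b)"
  have \<kappa>: "\<kappa> > 0" using b by (simp add: \<kappa>_def)
  \<comment> \<open>\<open>W\<close> bounds \<open>z k\<close> for \<open>k > 0\<close> and
    \<open>1 / z k\<close> for \<open>k < 0\<close>. The power \<open>B ^ n\<close> then collects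
    the size of all factors at the fixed point \<open>w0\<close> together with the
    \<open>2 * n\<close> losses \<open>\<kappa>\<close> on the boundary.\<close>
  define W where "W = exp (b * D)"
  define B where "B = (1 + W / norm w0) * (1 + norm w0 * W) / \<kappa>\<^sup>2"
  have B: "B > 0" using \<kappa> w0 by (auto simp: B_def W_def intro!: divide_pos_pos mult_pos_pos add_pos_nonneg)
  \<comment> \<open>In the variable \<open>t\<close>, the boundary circles at \<open>T n\<close> and
    \<open>- T n\<close> lie at least one unit beyond every node whose index is at most
    \<open>n\<close> in absolute value.\<close>
  define T where "T n = \<alpha> * real n + D + 1" for n :: nat
  define E where "E n = (\<Prod>k=1..n. exp (b * (\<alpha> * (real n - real k))))" for n :: nat
  have key: "norm (laurent w0) \<le> K * exp (a * (T n)\<^sup>2) * B ^ n / E n"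
    if n: "exp (- (b * T n)) < norm w0" "norm w0 < exp (b * T n)" for n
  proof -
    \<comment> \<open>Index 0 is left out, so that each side carries exactly \<open>n\<close> zeros,
      in agreement with the power \<open>w ^ n\<close> in the weight below.\<close>
    define Z where "Z = (\<lambda>k. complex_of_real (z k)) ` ({1..int n} \<union> {- int n..-1})"
    have injZ: "inj_on (\<lambda>k. complex_of_real (z k)) A" for A
      using \<open>inj z\<close> by (auto simp: inj_on_def)
    obtain h where h: "h holomorphic_on - {0}" "\<And>w. w \<in> - {0} \<Longrightarrow> laurent w = (\<Prod>z\<in>Z. w - z) * h w"
    proof -
      have "finite Z" by (simp add: Z_def)
      moreover have "Z \<subseteq> - {0}"
        unfolding Z_def using z_pos by (auto simp: less_le)
      moreover have "laurent u = 0" if "u \<in> Z" for u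
        using that lz unfolding Z_def by blast
      ultimately have "\<exists>h. h holomorphic_on - {0} \<and> (\<forall>w\<in>- {0}. laurent w = (\<Prod>z\<in>Z. w - z) * h w)"
        by (intro holomorphic_factor_zeros holomorphic_laurent) auto
      then show thesis using that by blast
    qed
    have prodZ: "norm (\<Prod>z\<in>Z. w - z) = (\<Prod>k=1..n. norm (w - of_real (z (int k)))) * (\<Prod>k=1..n. norm (w - of_real (z (- int k))))" for w
    proof -
      have "(\<Prod>z\<in>Z. w - z) = (\<Prod>k\<in>{1..int n} \<union> {- int n..-1}. w - of_real (z k))"
        unfolding Z_def by (subst prod.reindex [OF injZ]) simp
      also have "\<dots> = (\<Prod>k\<in>{1..int n}. w - of_real (z k)) * (\<Prod>k\<in>{- int n..-1}. w - of_real (z k))"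
        by (rule prod.union_disjoint) auto
      also have "(\<Prod>k\<in>{1..int n}. w - of_real (z k)) = (\<Prod>k=1..n. w - of_real (z (int k)))"
        by (rule prod.reindex_bij_witness [of _ int nat]) auto
      also have "(\<Prod>k\<in>{- int n..-1}. w - of_real (z k)) = (\<Prod>k=1..n. w - of_real (z (- int k)))"
        by (rule prod.reindex_bij_witness [of _ "\<lambda>k. - int k" "\<lambda>k. nat (- k)"]) auto
      finally show ?thesis by (simp add: norm_mult prod_norm)
    qed
    define P where "P = (\<Prod>k=1..n. z (- int k))"
    have P: "P > 0" unfolding P_def by (intro prod_pos) (auto simp: z_pos)
    \<comment> \<open>The weight balances the two circles. On the inner one the zeros of positive
      index carry the gain over \<open>norm w\<close> and those of negative index contribute their
      own modulus; on the outer one the gain sits with the negative indices. In both cases the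
      product of the factors is at least
      \<open>norm w ^ n * P * (\<kappa> ^ (2 * n) * E n)\<close>.\<close>
    define f where "f w = h w * w ^ n * of_real P" for w
    have Tn: "T n \<ge> 1" using \<alpha> D by (simp add: T_def)
    have E_pos: "E n > 0" unfolding E_def by (intro prod_pos) auto
    have ybd: "\<bar>y k\<bar> \<le> T n - 1" if "\<bar>k\<bar> \<le> int n" for k
    proof -
      have "\<bar>\<alpha> * of_int k\<bar> \<le> \<alpha> * real n"
        using \<alpha> that by (simp add: abs_mult)
      then show ?thesis using y [of k] by (simp add: T_def abs_le_iff)
    qed
    have gap: "exp u - 1 \<ge> \<kappa> * exp u" if "u \<ge> b" for u
    proof -
      have "1 \<le> exp (- b + u)" using that by simp
      also have "\<dots> = exp (- b) * exp u" by (rule exp_add)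
      finally show ?thesis unfolding \<kappa>_def left_diff_distrib by simp
    qed
    have ty: "T n - y (int k) \<ge> \<alpha> * (real n - real k)" "T n + y (- int k) \<ge> \<alpha> * (real n - real k)" for k
      using y [of "int k"] y [of "- int k"] D by (auto simp: T_def algebra_simps abs_le_iff)
    have lower: "\<bar>\<rho> - z k\<bar> \<ge> \<kappa> * max \<rho> (z k)"
      if "\<rho> = exp (- (b * t))" "\<bar>t - y k\<bar> \<ge> 1" for \<rho> t k
    proof -
      have bb: "b * \<bar>t - y k\<bar> \<ge> b" using that(2) b by simp
      show ?thesis
      proof (cases "t \<ge> y k")
        case True
        then have "b * (t - y k) \<ge> b" using bb by simp
        then have "\<rho> * (exp (b * (t - y k)) - 1) \<ge> \<rho> * (\<kappa> * exp (b * (t - y k)))"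
          using that by (intro mult_left_mono gap) auto
        moreover have "\<rho> * exp (b * (t - y k)) = z k"
          unfolding z_def that(1) mult_exp_exp by (simp add: right_diff_distrib)
        moreover have "\<rho> \<le> z k" using True b that by (simp add: z_def)
        ultimately show ?thesis by (simp add: right_diff_distrib mult.left_commute max_absorb2)
      next
        case False
        then have "b * (y k - t) \<ge> b" using bb by simp
        then have "z k * (exp (b * (y k - t)) - 1) \<ge> z k * (\<kappa> * exp (b * (y k - t)))"
          using z_pos [of k] by (intro mult_left_mono gap) auto
        moreover have "z k * exp (b * (y k - t)) = \<rho>"
          unfolding z_def that(1) mult_exp_exp by (simp add: right_diff_distrib)
        moreover have "z k \<le> \<rho>" using False b that by (simp add: z_def)
        ultimately show ?thesis by (simp add: right_diff_distrib mult.left_commute max_absorb1)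
      qed
    qed
    have norm_diff_ge: "norm (w - of_real (z k)) \<ge> \<bar>norm w - z k\<bar>" for w :: complex and k
      using norm_triangle_ineq3 [of w "of_real (z k)"] z_pos [of k] by simp
    have bd: "norm (f w) \<le> K * exp (a * (T n)\<^sup>2) / (\<kappa> ^ (2 * n) * E n)"
      if w: "norm w = exp (- (b * t))" and t: "t = T n \<or> t = - T n" for w t
    proof -
      have t2: "t\<^sup>2 = (T n)\<^sup>2" using t by auto
      have wnz: "w \<in> - {0}" using w by auto
      have far: "\<bar>t - y k\<bar> \<ge> 1" if "\<bar>k\<bar> \<le> int n" for k
        using ybd [OF that] t by (auto simp: abs_le_iff)
      have "norm (\<Prod>z\<in>Z. w - z) \<ge> norm w ^ n * P * (\<kappa> ^ (2 * n) * E n)"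
      proof (cases "t = T n")
        case True
        have "(\<Prod>k=1..n. norm (w - of_real (z (int k)))) \<ge> (\<Prod>k=1..n. \<kappa> * (norm w * exp (b * (\<alpha> * (real n - real k)))))"
        proof (intro prod_mono conjI)
          fix k assume k: "k \<in> {1..n}"
          have "norm w * exp (b * (\<alpha> * (real n - real k))) \<le> norm w * exp (b * (T n - y (int k)))"
            using ty(1) [of k] b by (intro mult_left_mono) auto
          also have "\<dots> = z (int k)"
            unfolding w True z_def mult_exp_exp by (simp add: right_diff_distrib)
          finally have "\<kappa> * (norm w * exp (b * (\<alpha> * (real n - real k)))) \<le> \<kappa> * max (norm w) (z (int k))"
            using \<kappa> by (intro mult_left_mono) auto
          also have "\<dots> \<le> \<bar>norm w - z (int k)\<bar>"
            using k by (intro lower [OF w] far) auto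
          finally show "\<kappa> * (norm w * exp (b * (\<alpha> * (real n - real k)))) \<le> norm (w - of_real (z (int k)))"
            using norm_diff_ge order_trans by blast
        qed (use \<kappa> in auto)
        moreover have "(\<Prod>k=1..n. norm (w - of_real (z (- int k)))) \<ge> (\<Prod>k=1..n. \<kappa> * z (- int k))"
        proof (intro prod_mono conjI)
          fix k assume k: "k \<in> {1..n}"
          have "\<kappa> * z (- int k) \<le> \<kappa> * max (norm w) (z (- int k))"
            using \<kappa> by (intro mult_left_mono) auto
          also have "\<dots> \<le> \<bar>norm w - z (- int k)\<bar>"
            using k by (intro lower [OF w] far) auto
          finally show "\<kappa> * z (- int k) \<le> norm (w - of_real (z (- int k)))"
            using norm_diff_ge order_trans by blast
        qed (use \<kappa> z_pos in \<open>auto simp: less_imp_le\<close>)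
        ultimately have "norm (\<Prod>z\<in>Z. w - z) \<ge> (\<Prod>k=1..n. \<kappa> * (norm w * exp (b * (\<alpha> * (real n - real k))))) * (\<Prod>k=1..n. \<kappa> * z (- int k))"
          unfolding prodZ using \<kappa> z_pos by (intro mult_mono) (auto intro!: prod_nonneg simp: less_imp_le)
        then show ?thesis
          by (simp add: prod.distrib P_def E_def power_mult power2_eq_square power_mult_distrib mult_ac)
      next
        case False
        then have t': "t = - T n" using t by simp
        have "(\<Prod>k=1..n. norm (w - of_real (z (int k)))) \<ge> (\<Prod>k=1..n. \<kappa> * norm w)"
        proof (intro prod_mono conjI)
          fix k assume k: "k \<in> {1..n}"
          have "\<kappa> * norm w \<le> \<kappa> * max (norm w) (z (int k))"
            using \<kappa> by (intro mult_left_mono) auto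
          also have "\<dots> \<le> \<bar>norm w - z (int k)\<bar>"
            using k by (intro lower [OF w] far) auto
          finally show "\<kappa> * norm w \<le> norm (w - of_real (z (int k)))"
            using norm_diff_ge order_trans by blast
        qed (use \<kappa> in auto)
        moreover have "(\<Prod>k=1..n. norm (w - of_real (z (- int k)))) \<ge> (\<Prod>k=1..n. \<kappa> * (z (- int k) * exp (b * (\<alpha> * (real n - real k)))))"
        proof (intro prod_mono conjI)
          fix k assume k: "k \<in> {1..n}"
          have "z (- int k) * exp (b * (\<alpha> * (real n - real k))) \<le> z (- int k) * exp (b * (T n + y (- int k)))"
            using ty(2) [of k] b z_pos by (intro mult_left_mono) (auto simp: less_imp_le)
          also have "\<dots> = norm w"
            unfolding w t' z_def mult_exp_exp by (simp add: distrib_left)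
          finally have "\<kappa> * (z (- int k) * exp (b * (\<alpha> * (real n - real k)))) \<le> \<kappa> * max (norm w) (z (- int k))"
            using \<kappa> by (intro mult_left_mono) auto
          also have "\<dots> \<le> \<bar>norm w - z (- int k)\<bar>"
            using k by (intro lower [OF w] far) auto
          finally show "\<kappa> * (z (- int k) * exp (b * (\<alpha> * (real n - real k)))) \<le> norm (w - of_real (z (- int k)))"
            using norm_diff_ge order_trans by blast
        qed (use \<kappa> z_pos in \<open>auto simp: less_imp_le\<close>)
        ultimately have "norm (\<Prod>z\<in>Z. w - z) \<ge> (\<Prod>k=1..n. \<kappa> * norm w) * (\<Prod>k=1..n. \<kappa> * (z (- int k) * exp (b * (\<alpha> * (real n - real k)))))"
          unfolding prodZ using \<kappa> z_pos by (intro mult_mono) (auto intro!: prod_nonneg simp: less_imp_le)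
        then show ?thesis
          by (simp add: prod.distrib P_def E_def power_mult power2_eq_square power_mult_distrib mult_ac)
      qed
      then have "norm w ^ n * P * (\<kappa> ^ (2 * n) * E n) * norm (h w) \<le> norm (\<Prod>z\<in>Z. w - z) * norm (h w)"
        by (intro mult_right_mono) auto
      also have "\<dots> = norm (laurent w)"
        by (simp add: h(2) [OF wnz] norm_mult)
      also have "\<dots> \<le> K * exp (a * (T n)\<^sup>2)"
        using K(2) [of w t] w t2 by (simp add: b_def)
      finally show ?thesis
        using \<kappa> E_pos P by (simp add: f_def norm_mult norm_power field_simps)
    qed
    let ?S = "{w :: complex. exp (- (b * T n)) < norm w \<and> norm w < exp (b * T n)}"
    have closS: "closure ?S \<subseteq> {w. exp (- (b * T n)) \<le> norm w \<and> norm w \<le> exp (b * T n)}"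
    proof (rule closure_minimal)
      show "closed {w :: complex. exp (- (b * T n)) \<le> norm w \<and> norm w \<le> exp (b * T n)}"
        by (intro closed_Collect_conj closed_Collect_le continuous_intros)
    qed auto
    have openS: "open ?S"
      by (intro open_Collect_conj open_Collect_less continuous_intros)
    have sub0: "{w. exp (- (b * T n)) \<le> norm w \<and> norm w \<le> exp (b * T n)} \<subseteq> - {0 :: complex}"
      by (auto simp: not_le)
    have holf: "f holomorphic_on - {0}"
      unfolding f_def by (intro holomorphic_intros h)
    have "norm (f w0) \<le> K * exp (a * (T n)\<^sup>2) / (\<kappa> ^ (2 * n) * E n)"
    proof (rule maximum_modulus_frontier [where f = f and S = ?S])
      show "f holomorphic_on interior ?S"
      proof -
        have "?S \<subseteq> - {0}"
          using sub0 by (auto simp: less_imp_le)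
        then have "interior ?S \<subseteq> - {0}"
          by (rule order_trans [OF interior_subset])
        then show ?thesis
          by (rule holomorphic_on_subset [OF holf])
      qed
      show "continuous_on (closure ?S) f"
        using holf closS sub0 holomorphic_on_imp_continuous_on continuous_on_subset by blast
      show "bounded ?S"
        by (rule bounded_subset [of "ball 0 (exp (b * T n))"]) auto
      show "w0 \<in> ?S" using n by simp
      fix w assume "w \<in> frontier ?S"
      then have w: "w \<in> closure ?S" "w \<notin> ?S"
        using openS by (auto simp: frontier_def interior_open)
      with closS have "norm w = exp (- (b * T n)) \<or> norm w = exp (- (b * (- T n)))"
        by force
      then show "norm (f w) \<le> K * exp (a * (T n)\<^sup>2) / (\<kappa> ^ (2 * n) * E n)"
        using bd by blast
    qed
    moreover have "norm (laurent w0) \<le> ((1 + W / norm w0) * (1 + norm w0 * W)) ^ n * norm (f w0)"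
    proof -
      have "(\<Prod>k=1..n. norm (w0 - of_real (z (int k)))) \<le> (\<Prod>k=1..n. norm w0 * (1 + W / norm w0))"
      proof (intro prod_mono conjI)
        fix k assume k: "k \<in> {1..n}"
        have "y (int k) \<ge> - D"
        proof -
          have "\<alpha> * real k \<ge> 0" using \<alpha> by simp
          then show ?thesis using y [of "int k"] by (simp add: abs_le_iff)
        qed
        then have "b * (- D) \<le> b * y (int k)" using b by (intro mult_left_mono) auto
        then have "z (int k) \<le> W" by (simp add: z_def W_def)
        moreover have "norm (w0 - of_real (z (int k))) \<le> norm w0 + z (int k)"
          using norm_triangle_ineq4 [of w0 "of_real (z (int k))"] z_pos [of "int k"] by simp
        ultimately show "norm (w0 - of_real (z (int k))) \<le> norm w0 * (1 + W / norm w0)"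
          using w0 by (simp add: algebra_simps)
      qed auto
      moreover have "(\<Prod>k=1..n. norm (w0 - of_real (z (- int k)))) \<le> (\<Prod>k=1..n. z (- int k) * (1 + norm w0 * W))"
      proof (intro prod_mono conjI)
        fix k assume k: "k \<in> {1..n}"
        have "y (- int k) \<le> D"
        proof -
          have "\<alpha> * real k \<ge> 0" using \<alpha> by simp
          then show ?thesis using y [of "- int k"] by (simp add: abs_le_iff)
        qed
        then have "b * y (- int k) \<le> b * D" using b by (intro mult_left_mono) auto
        then have "1 \<le> z (- int k) * W" unfolding z_def W_def mult_exp_exp by simp
        then have "norm w0 * 1 \<le> norm w0 * (z (- int k) * W)" by (intro mult_left_mono) auto
        moreover have "norm (w0 - of_real (z (- int k))) \<le> norm w0 + z (- int k)"
          using norm_triangle_ineq4 [of w0 "of_real (z (- int k))"] z_pos [of "- int k"] by simp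
        ultimately show "norm (w0 - of_real (z (- int k))) \<le> z (- int k) * (1 + norm w0 * W)"
          by (simp add: algebra_simps)
      qed auto
      ultimately have "norm (\<Prod>z\<in>Z. w0 - z) \<le> (\<Prod>k=1..n. norm w0 * (1 + W / norm w0)) * (\<Prod>k=1..n. z (- int k) * (1 + norm w0 * W))"
        unfolding prodZ by (intro mult_mono prod_nonneg) (auto simp: W_def)
      then have "norm (\<Prod>z\<in>Z. w0 - z) * norm (h w0) \<le> (\<Prod>k=1..n. norm w0 * (1 + W / norm w0)) * (\<Prod>k=1..n. z (- int k) * (1 + norm w0 * W)) * norm (h w0)"
        by (intro mult_right_mono) auto
      moreover have "norm (laurent w0) = norm (\<Prod>z\<in>Z. w0 - z) * norm (h w0)"
        using h(2) [of w0] w0 by (simp add: norm_mult)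
      ultimately show ?thesis
        using abs_of_pos [OF P] by (simp add: f_def norm_mult norm_power prod.distrib power_mult_distrib mult_ac) (simp add: P_def mult_ac)
    qed
    moreover have "((1 + W / norm w0) * (1 + norm w0 * W)) ^ n * norm (f w0)
        \<le> ((1 + W / norm w0) * (1 + norm w0 * W)) ^ n * (K * exp (a * (T n)\<^sup>2) / (\<kappa> ^ (2 * n) * E n))"
      using calculation(1) by (intro mult_left_mono zero_le_power) (auto simp: W_def)
    ultimately have "norm (laurent w0) \<le> ((1 + W / norm w0) * (1 + norm w0 * W)) ^ n * (K * exp (a * (T n)\<^sup>2) / (\<kappa> ^ (2 * n) * E n))"
      by linarith
    also have "\<dots> = K * exp (a * (T n)\<^sup>2) * B ^ n / E n"
      by (simp add: B_def power_divide power_mult [symmetric] mult_ac)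
    finally show ?thesis .
  qed
  \<comment> \<open>Here \<alpha> < L enters: after expanding \<open>T n\<close> and
    \<open>E n\<close>, the coefficient of \<open>n\<^sup>2\<close> in the exponent is
    \<open>- q\<close>.\<close>
  define q where "q = a * \<alpha> * (L - \<alpha>)"
  have q: "q > 0" using a \<alpha> by (simp add: q_def)
  define s r where "s = 2 * a * \<alpha> * (D + 1) + a * L * \<alpha> + ln B" and "r = a * (D + 1)\<^sup>2"
  have E_eq: "E n = exp (a * L * \<alpha> * (real n * (real n - 1)))" for n
  proof -
    have "(\<Sum>k=1..n. real n - real k) = real n * (real n - 1) / 2"
    proof -
      have "(\<Sum>k=1..n. real k) = real n * (real n + 1) / 2"
        by (induction n) (auto simp: field_simps)
      then show ?thesis by (simp add: sum_subtractf field_simps)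
    qed
    then have "(\<Sum>k=1..n. b * (\<alpha> * (real n - real k))) = b * (\<alpha> * (real n * (real n - 1) / 2))"
      by (simp only: sum_distrib_left [symmetric])
    moreover have "E n = exp (\<Sum>k=1..n. b * (\<alpha> * (real n - real k)))"
      unfolding E_def by (rule exp_sum [symmetric]) simp
    ultimately have "E n = exp (b * (\<alpha> * (real n * (real n - 1) / 2)))"
      by (simp only:)
    also have "b * (\<alpha> * (real n * (real n - 1) / 2)) = a * L * \<alpha> * (real n * (real n - 1))"
      by (simp add: b_def)
    finally show ?thesis .
  qed
  have bound_eq: "K * exp (a * (T n)\<^sup>2) * B ^ n / E n = K * exp (- q * real n ^ 2 + s * real n + r)" for n
  proof -
    have "B ^ n = exp (real n * ln B)" using B by (simp add: exp_of_nat_mult)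
    then have "exp (a * (T n)\<^sup>2) * B ^ n / E n = exp (a * (T n)\<^sup>2 + real n * ln B - a * L * \<alpha> * (real n * (real n - 1)))"
      by (simp add: E_eq exp_add exp_diff)
    also have "a * (T n)\<^sup>2 + real n * ln B - a * L * \<alpha> * (real n * (real n - 1)) = - q * real n ^ 2 + s * real n + r"
      by (simp add: T_def q_def s_def r_def power2_eq_square algebra_simps)
    finally have "K * (exp (a * (T n)\<^sup>2) * B ^ n / E n) = K * exp (- q * real n ^ 2 + s * real n + r)"
      by (rule arg_cong)
    then show ?thesis by (simp only: mult.assoc times_divide_eq_right)
  qed
  have lim: "(\<lambda>n. K * exp (- q * real n ^ 2 + s * real n + r)) \<longlonglongrightarrow> K * 0"
    using q by (intro tendsto_mult tendsto_const) real_asymp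
  have "filterlim (\<lambda>n. b * T n) at_top sequentially"
    unfolding T_def using b \<alpha> by real_asymp
  then have "eventually (\<lambda>n. b * T n > max (ln (norm w0)) (- ln (norm w0))) sequentially"
    unfolding filterlim_at_top_dense by blast
  then have "eventually (\<lambda>n. norm (laurent w0) \<le> K * exp (- q * real n ^ 2 + s * real n + r)) sequentially"
  proof eventually_elim
    case (elim n)
    then have "exp (- (b * T n)) < exp (ln (norm w0))" "exp (ln (norm w0)) < exp (b * T n)"
      by auto
    then show ?case using key [of n] unfolding bound_eq exp_ln [OF w0] by blast
  qed
  then have "norm (laurent w0) \<le> K * 0"
    by (intro tendsto_lowerbound [OF lim]) auto
  then show "laurent w0 = 0" by simp
qed

end

section \<open>Exponential averages and Rolle's theorem\<close>

abbreviation expd :: "real measure" where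
  "expd \<equiv> density lborel (\<lambda>s. ennreal (exponential_density 1 s))"

text \<open>Convolution with the law of \<delta> times a standard exponential variable, whose
  Fourier transform is one factor \<open>inverse (1 + 2 * pi * \<i> * \<delta> * \<xi>)\<close>.
  Integrating over the variable itself treats positive, negative and zero \<delta> alike.\<close>

definition exp_avg :: "real \<Rightarrow> (real \<Rightarrow> real) \<Rightarrow> real \<Rightarrow> real" where
  "exp_avg \<delta> \<phi> x = (LINT s|expd. \<phi> (x - \<delta> * s))"

lemma prob_space_expd: "prob_space expd"
  by (rule prob_space_exponential_density) simp

interpretation expd: prob_space expd
  by (rule prob_space_expd)

lemma AE_expd_nonneg: "AE s in expd. s \<ge> 0"
  by (subst AE_density) (auto simp: exponential_density_def)

lemma integrable_expd_bounded:
  fixes \<phi> :: "real \<Rightarrow> real"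
  assumes "continuous_on UNIV \<phi>" "\<And>x. \<bar>\<phi> x\<bar> \<le> M"
  shows "integrable expd (\<lambda>s. \<phi> (x - \<delta> * s))"
proof (rule expd.integrable_const_bound [where B = M])
  show "AE s in expd. norm (\<phi> (x - \<delta> * s)) \<le> M" using assms by simp
  have "(\<lambda>s. \<phi> (x - \<delta> * s)) \<in> borel_measurable borel"
    by (intro borel_measurable_continuous_onI continuous_on_compose2 [OF assms(1)] continuous_intros) auto
  then show "(\<lambda>s. \<phi> (x - \<delta> * s)) \<in> borel_measurable expd" by simp
qed

lemma continuous_on_exp_avg:
  assumes cont: "continuous_on UNIV \<phi>" and M: "\<And>x. \<bar>\<phi> x\<bar> \<le> M"
  shows "continuous_on UNIV (exp_avg \<delta> \<phi>)"
proof -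
  have "(\<lambda>n. exp_avg \<delta> \<phi> (u n)) \<longlonglongrightarrow> exp_avg \<delta> \<phi> x" if u: "u \<longlonglongrightarrow> x" for u x
    unfolding exp_avg_def
  proof (rule integral_dominated_convergence [where w = "\<lambda>_. M"])
    show "AE s in expd. (\<lambda>n. \<phi> (u n - \<delta> * s)) \<longlonglongrightarrow> \<phi> (x - \<delta> * s)"
      by (intro AE_I2 continuous_on_tendsto_compose [OF cont] tendsto_intros u) auto
    show "(\<lambda>s. \<phi> (x - \<delta> * s)) \<in> borel_measurable expd" for x
      using integrable_expd_bounded [OF cont M] by blast
    then show "(\<lambda>s. \<phi> (x - \<delta> * s)) \<in> borel_measurable expd" for x .
  qed (use M in auto)
  then show ?thesis
    by (auto simp: continuous_on_sequentially comp_def)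
qed

lemma exp_decay_bounded:
  assumes "exp_decay g"
  obtains M where "\<And>x. \<bar>g x\<bar> \<le> M"
proof -
  obtain C a where *: "a > 0" "C > 0" "\<And>x. \<bar>g x\<bar> \<le> C * exp (- (a * \<bar>x\<bar>))"
    using exp_decayE [OF assms] by metis
  have "\<bar>g x\<bar> \<le> C" for x
  proof -
    have "C * exp (- (a * \<bar>x\<bar>)) \<le> C * 1"
      using * by (intro mult_left_mono) auto
    with *(3) [of x] show ?thesis by simp
  qed
  with that show ?thesis by blast
qed

lemma integrable_expd_exp_half: "integrable expd (\<lambda>s. exp (s / 2))"
proof (rule integrableI_nonneg)
  have "(\<integral>\<^sup>+s. ennreal (exp (s / 2)) \<partial>expd)
      = (\<integral>\<^sup>+s. ennreal (exponential_density 1 s) * ennreal (exp (s / 2)) \<partial>lborel)"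
    by (rule nn_integral_density) auto
  also have "\<dots> = (\<integral>\<^sup>+s. 2 * ennreal (exponential_density (1/2) s) \<partial>lborel)"
  proof (rule nn_integral_cong)
    fix s :: real
    have "exponential_density 1 s * exp (s / 2) = 2 * exponential_density (1/2) s"
      by (auto simp: exponential_density_def mult_exp_exp)
    then show "ennreal (exponential_density 1 s) * ennreal (exp (s / 2)) = 2 * ennreal (exponential_density (1/2) s)"
      by (metis ennreal_mult' ennreal_mult'' ennreal_numeral exp_ge_zero zero_le_numeral)
  qed
  also have "\<dots> = 2 * emeasure (density lborel (exponential_density (1/2))) UNIV"
    by (subst nn_integral_cmult) (auto simp: emeasure_density)
  also have "\<dots> = 2"
    using prob_space.emeasure_space_1 [OF prob_space_exponential_density [of "1/2"]] by simp
  finally show "(\<integral>\<^sup>+s. ennreal (exp (s / 2)) \<partial>expd) < \<infinity>" by simp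
qed auto

lemma exp_decay_exp_avg:
  assumes "exp_decay g"
  shows "exp_decay (exp_avg \<delta> g)"
proof -
  obtain C a where *: "a > 0" "C > 0" "\<And>x. \<bar>g x\<bar> \<le> C * exp (- (a * \<bar>x\<bar>))" "continuous_on UNIV g"
    using exp_decayE [OF assms] by metis
  obtain M where M: "\<And>x. \<bar>g x\<bar> \<le> M" using exp_decay_bounded [OF assms] by metis
  \<comment> \<open>The new rate must not exceed the old one, and
    \<open>b * |\<delta>| \<le> 1/2\<close> keeps the cost \<open>exp (b * |\<delta>| * s)\<close>
    of displacing the argument below the integrable \<open>exp (s / 2)\<close>.\<close>
  define b where "b = min a (1 / (2 * \<bar>\<delta>\<bar> + 1))"
  have b: "b > 0" "b \<le> a" "b * \<bar>\<delta>\<bar> \<le> 1/2"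
  proof -
    show "b > 0" "b \<le> a" using * by (auto simp: b_def)
    have "b * \<bar>\<delta>\<bar> \<le> 1 / (2 * \<bar>\<delta>\<bar> + 1) * \<bar>\<delta>\<bar>"
      by (intro mult_right_mono) (auto simp: b_def)
    also have "\<dots> \<le> 1/2" by (simp add: field_simps)
    finally show "b * \<bar>\<delta>\<bar> \<le> 1/2" .
  qed
  show ?thesis
    unfolding exp_decay_def
  proof (intro conjI exI allI)
    show "continuous_on UNIV (exp_avg \<delta> g)" using *(4) M by (rule continuous_on_exp_avg)
    show "b > 0" by fact
    fix x
    have "\<bar>exp_avg \<delta> g x\<bar> \<le> (LINT s|expd. \<bar>g (x - \<delta> * s)\<bar>)"
      unfolding exp_avg_def by (rule integral_abs_bound)
    also have "\<dots> \<le> (LINT s|expd. C * exp (- (b * \<bar>x\<bar>)) * exp (s / 2))"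
    proof (rule integral_mono_AE)
      show "integrable expd (\<lambda>s. \<bar>g (x - \<delta> * s)\<bar>)"
        by (intro integrable_abs integrable_expd_bounded [OF *(4) M])
      show "integrable expd (\<lambda>s. C * exp (- (b * \<bar>x\<bar>)) * exp (s / 2))"
        by (intro integrable_mult_right integrable_expd_exp_half)
      show "AE s in expd. \<bar>g (x - \<delta> * s)\<bar> \<le> C * exp (- (b * \<bar>x\<bar>)) * exp (s / 2)"
        using AE_expd_nonneg
      proof eventually_elim
        case (elim s)
        have "\<bar>x\<bar> \<le> \<bar>x - \<delta> * s\<bar> + \<bar>\<delta>\<bar> * s"
          using elim abs_triangle_ineq [of "x - \<delta> * s" "\<delta> * s"] by (simp add: abs_mult)
        then have "b * \<bar>x\<bar> \<le> b * (\<bar>x - \<delta> * s\<bar> + \<bar>\<delta>\<bar> * s)"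
          using b by (intro mult_left_mono) auto
        also have "\<dots> = b * \<bar>x - \<delta> * s\<bar> + b * \<bar>\<delta>\<bar> * s" by (simp add: algebra_simps)
        also have "\<dots> \<le> a * \<bar>x - \<delta> * s\<bar> + 1/2 * s"
          using b elim by (intro add_mono mult_right_mono) auto
        finally have "exp (- (a * \<bar>x - \<delta> * s\<bar>)) \<le> exp (- (b * \<bar>x\<bar>) + s / 2)"
          by simp
        then have "C * exp (- (a * \<bar>x - \<delta> * s\<bar>)) \<le> C * exp (- (b * \<bar>x\<bar>) + s / 2)"
          using * by (intro mult_left_mono) auto
        with *(3) [of "x - \<delta> * s"] show ?case unfolding exp_add by simp
      qed
    qed
    also have "\<dots> = (C * (LINT s|expd. exp (s / 2))) * exp (- (b * \<bar>x\<bar>))"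
      by simp
    finally show "\<bar>exp_avg \<delta> g x\<bar> \<le> (C * (LINT s|expd. exp (s / 2))) * exp (- (b * \<bar>x\<bar>))" .
  qed
qed

text \<open>Splitting the exponential variable at \<tau> and using that it has no memory. This is
  the integrated form of the differential equation \<open>F + \<delta> F' = \<phi>\<close> for the
  average \<open>F\<close>, obtained for \<phi> merely continuous and bounded.\<close>

lemma exp_avg_memoryless:
  assumes cont: "continuous_on UNIV \<phi>" and M: "\<And>x. \<bar>\<phi> x\<bar> \<le> M" and "\<tau> \<ge> 0"
  shows "exp_avg \<delta> \<phi> x = (LINT s:{0..\<tau>}|lborel. exp (- s) * \<phi> (x - \<delta> * s))
     + exp (- \<tau>) * exp_avg \<delta> \<phi> (x - \<delta> * \<tau>)"
proof -
  define \<psi> where "\<psi> s = exponential_density 1 s * \<phi> (x - \<delta> * s)" for s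
  have meas: "(\<lambda>s. \<phi> (y - \<delta> * s)) \<in> borel_measurable borel" for y
    by (intro borel_measurable_continuous_onI continuous_on_compose2 [OF cont] continuous_intros) auto
  have dens: "exp_avg \<delta> \<phi> y = (LINT s|lborel. exponential_density 1 s * \<phi> (y - \<delta> * s))" for y
    unfolding exp_avg_def using meas [of y] by (subst integral_density) (auto simp: exponential_density_nonneg)
  have int: "integrable lborel \<psi>"
    using integrable_expd_bounded [OF cont M, of x \<delta>] meas [of x] unfolding \<psi>_def
    by (subst (asm) integrable_density) (auto simp: exponential_density_nonneg)
  have "exp_avg \<delta> \<phi> x = (LINT s|lborel. indicator {0..\<tau>} s *\<^sub>R \<psi> s + indicator {\<tau><..} s *\<^sub>R \<psi> s)"
    unfolding dens using \<open>\<tau> \<ge> 0\<close>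
    by (intro Bochner_Integration.integral_cong) (auto simp: indicator_def \<psi>_def exponential_density_def)
  also have "\<dots> = (LINT s|lborel. indicator {0..\<tau>} s *\<^sub>R \<psi> s) + (LINT s|lborel. indicator {\<tau><..} s *\<^sub>R \<psi> s)"
    by (intro Bochner_Integration.integral_add integrable_mult_indicator int) auto
  also have "(LINT s|lborel. indicator {0..\<tau>} s *\<^sub>R \<psi> s) = (LINT s:{0..\<tau>}|lborel. exp (- s) * \<phi> (x - \<delta> * s))"
    unfolding set_lebesgue_integral_def
    by (intro Bochner_Integration.integral_cong) (auto simp: indicator_def \<psi>_def exponential_density_def)
  also have "(LINT s|lborel. indicator {\<tau><..} s *\<^sub>R \<psi> s)
      = (LINT s|lborel. indicator {\<tau><..} (\<tau> + 1 * s) *\<^sub>R \<psi> (\<tau> + 1 * s))"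
    using lborel_integral_real_affine [of 1 "\<lambda>s. indicator {\<tau><..} s *\<^sub>R \<psi> s" \<tau>] by simp
  also have "\<dots> = (LINT s|lborel. exp (- \<tau>) * (exponential_density 1 s * \<phi> (x - \<delta> * \<tau> - \<delta> * s)))"
  proof (rule integral_cong_AE)
    show "AE s in lborel. indicator {\<tau><..} (\<tau> + 1 * s) *\<^sub>R \<psi> (\<tau> + 1 * s)
        = exp (- \<tau>) * (exponential_density 1 s * \<phi> (x - \<delta> * \<tau> - \<delta> * s))"
      using AE_lborel_singleton [of 0]
    proof eventually_elim
      case (elim s)
      then show ?case using \<open>\<tau> \<ge> 0\<close>
        by (auto simp: indicator_def \<psi>_def exponential_density_def mult_exp_exp algebra_simps)
    qed
    show "(\<lambda>s. exp (- \<tau>) * (exponential_density 1 s * \<phi> (x - \<delta> * \<tau> - \<delta> * s))) \<in> borel_measurable lborel"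
      using meas by measurable
    have "\<psi> \<in> borel_measurable borel" using int by auto
    then show "(\<lambda>s. indicator {\<tau><..} (\<tau> + 1 * s) *\<^sub>R \<psi> (\<tau> + 1 * s)) \<in> borel_measurable lborel"
      by measurable
  qed
  also have "\<dots> = exp (- \<tau>) * exp_avg \<delta> \<phi> (x - \<delta> * \<tau>)"
    unfolding dens by (rule integral_mult_right_zero)
  finally show ?thesis .
qed

text \<open>Two zeros of the average make the boundary terms in \<open>exp_avg_memoryless\<close>
  vanish, so the antiderivative of \<open>exp (- s) * \<phi> (x - \<delta> * s)\<close> is 0 at both
  ends of \<open>[0, \<tau>]\<close>; Rolle applies to it.\<close>

lemma exp_avg_Rolle_aux:
  assumes cont: "continuous_on UNIV \<phi>" and M: "\<And>x. \<bar>\<phi> x\<bar> \<le> M" and "\<tau> > 0"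
    and "exp_avg \<delta> \<phi> x = 0" "exp_avg \<delta> \<phi> (x - \<delta> * \<tau>) = 0"
  shows "\<exists>s. 0 < s \<and> s < \<tau> \<and> \<phi> (x - \<delta> * s) = 0"
proof -
  let ?\<psi> = "\<lambda>s. exp (- s) * \<phi> (x - \<delta> * s)"
  have cont\<psi>: "continuous_on A ?\<psi>" for A
    by (intro continuous_intros continuous_on_compose2 [OF cont]) auto
  have "set_integrable lborel {0..\<tau>} ?\<psi>"
    unfolding set_integrable_def by (rule borel_integrable_compact) (use cont\<psi> in auto)
  then have "integral {0..\<tau>} ?\<psi> = (LINT s:{0..\<tau>}|lborel. ?\<psi> s)"
    by (rule set_borel_integral_eq_integral(2) [symmetric])
  also have "\<dots> = 0"
    using exp_avg_memoryless [OF cont M, where \<tau> = \<tau> and \<delta> = \<delta> and x = x] assms by simp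
  finally have zero: "integral {0..\<tau>} ?\<psi> = 0" .
  have deriv: "((\<lambda>u. integral {0..u} ?\<psi>) has_real_derivative ?\<psi> t) (at t within {0..\<tau>})" if "t \<in> {0..\<tau>}" for t
    by (rule integral_has_real_derivative [OF cont\<psi> that])
  have "\<exists>z. 0 < z \<and> z < \<tau> \<and> (\<lambda>v. ?\<psi> z * v) = (\<lambda>v. 0)"
  proof (rule Rolle_deriv)
    show "continuous_on {0..\<tau>} (\<lambda>u. integral {0..u} ?\<psi>)"
      using deriv by (meson DERIV_continuous continuous_on_eq_continuous_within)
    fix t assume "0 < t" "t < \<tau>"
    then have "((\<lambda>u. integral {0..u} ?\<psi>) has_real_derivative ?\<psi> t) (at t)"
      using deriv [of t] at_within_interior [of t "{0..\<tau>}"] by simp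
    then show "((\<lambda>u. integral {0..u} ?\<psi>) has_derivative (\<lambda>v. ?\<psi> t * v)) (at t)"
      by (simp add: has_field_derivative_def)
  qed (use \<open>\<tau> > 0\<close> zero in auto)
  then obtain z where z: "0 < z" "z < \<tau>" "(\<lambda>v. ?\<psi> z * v) = (\<lambda>v. 0)" by blast
  from fun_cong [OF z(3), of 1] z(1,2) show ?thesis by auto
qed

text \<open>The average at a point sees \<phi> to its left when \<delta> > 0 and to its right when
  \<delta> < 0, so the base point is \<open>v\<close> or \<open>u\<close> accordingly.\<close>

lemma exp_avg_Rolle:
  assumes cont: "continuous_on UNIV \<phi>" and M: "\<And>x. \<bar>\<phi> x\<bar> \<le> M" and "\<delta> \<noteq> 0" and "u < v"
    and "exp_avg \<delta> \<phi> u = 0" "exp_avg \<delta> \<phi> v = 0"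
  shows "\<exists>w. u < w \<and> w < v \<and> \<phi> w = 0"
proof (cases "\<delta> > 0")
  case True
  then have "\<exists>s. 0 < s \<and> s < (v - u) / \<delta> \<and> \<phi> (v - \<delta> * s) = 0"
    using assms by (intro exp_avg_Rolle_aux [OF cont M]) auto
  then obtain s where "0 < s" "s < (v - u) / \<delta>" "\<phi> (v - \<delta> * s) = 0" by blast
  with True show ?thesis by (intro exI [of _ "v - \<delta> * s"]) (auto simp: field_simps)
next
  case False
  with \<open>\<delta> \<noteq> 0\<close> have "\<delta> < 0" by simp
  then have "\<exists>s. 0 < s \<and> s < (u - v) / \<delta> \<and> \<phi> (u - \<delta> * s) = 0"
    using assms by (intro exp_avg_Rolle_aux [OF cont M]) (auto simp: divide_neg_neg)
  then obtain s where s: "0 < s" "s < (u - v) / \<delta>" "\<phi> (u - \<delta> * s) = 0" by blast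
  have "\<delta> * s < 0" using s \<open>\<delta> < 0\<close> by (simp add: mult_neg_pos)
  moreover have "\<delta> * s > u - v" using s(2) \<open>\<delta> < 0\<close> by (simp add: field_simps)
  ultimately show ?thesis using s by (intro exI [of _ "u - \<delta> * s"]) auto
qed

lemma exp_avg_0: "exp_avg 0 \<phi> = \<phi>"
  using expd.prob_space by (intro ext) (simp add: exp_avg_def)

text \<open>Averaging is a convolution and commutes with translations, hence with shift sums; the
  uniform bound on the absolute sums justifies Fubini.\<close>

lemma fiber_exp_avg:
  assumes g: "exp_decay g" and L: "L > 0" and c: "\<And>j. \<bar>c j :: real\<bar> \<le> M"
  shows "fiber L (exp_avg \<delta> g) c t = exp_avg \<delta> (fiber L g c) t"
proof -
  have cont: "continuous_on UNIV g" using g by (simp add: exp_decay_def)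
  obtain K where K: "\<And>(c :: int \<Rightarrow> real) M t. (\<And>j. norm (c j) \<le> M) \<Longrightarrow>
      (\<integral>\<^sup>+j. ennreal (norm (g (t + of_int j * L) *\<^sub>R c j)) \<partial>int_count) \<le> ennreal (K * M)"
    using nn_integral_fiber_bounded [OF g L, where 'a = real] by metis
  have meas: "(\<lambda>s. g (t - \<delta> * s + of_int j * L) *\<^sub>R c j) \<in> borel_measurable expd" for j
  proof -
    have "(\<lambda>s. g (t - \<delta> * s + of_int j * L) *\<^sub>R c j) \<in> borel_measurable borel"
      by (intro borel_measurable_continuous_onI continuous_intros continuous_on_compose2 [OF cont]) auto
    then show ?thesis by simp
  qed
  have "(\<integral>\<^sup>+j. (\<integral>\<^sup>+s. ennreal (norm (g (t - \<delta> * s + of_int j * L) *\<^sub>R c j)) \<partial>expd) \<partial>int_count)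
     = (\<integral>\<^sup>+s. (\<integral>\<^sup>+j. ennreal (norm (g (t - \<delta> * s + of_int j * L) *\<^sub>R c j)) \<partial>int_count) \<partial>expd)"
  proof (rule nn_integral_int_swap [OF expd.sigma_finite_measure_axioms])
    show "(\<lambda>s. ennreal (norm (g (t - \<delta> * s + of_int j * L) *\<^sub>R c j))) \<in> borel_measurable expd" for j
      by (rule measurable_compose [OF meas [of j]]) measurable
  qed
  also have "\<dots> \<le> (\<integral>\<^sup>+s. ennreal (K * M) \<partial>expd)"
    using c by (intro nn_integral_mono K) auto
  also have "\<dots> < \<infinity>"
    using expd.emeasure_space_1 by (simp add: ennreal_mult_less_top)
  finally have fin: "(\<integral>\<^sup>+j. (\<integral>\<^sup>+s. ennreal (norm (g (t - \<delta> * s + of_int j * L) *\<^sub>R c j)) \<partial>expd) \<partial>int_count) < \<infinity>" .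
  have "fiber L (exp_avg \<delta> g) c t = (LINT j|int_count. LINT s|expd. g (t - \<delta> * s + of_int j * L) *\<^sub>R c j)"
    unfolding fiber_def exp_avg_def
    by (intro Bochner_Integration.integral_cong) (auto simp: algebra_simps)
  also have "\<dots> = (LINT s|expd. LINT j|int_count. g (t - \<delta> * s + of_int j * L) *\<^sub>R c j)"
    by (rule int_sum_integral_swap(1) [OF expd.sigma_finite_measure_axioms meas fin])
  finally show ?thesis
    by (simp add: exp_avg_def fiber_def)
qed

text \<open>The parameters are read from index 1 onwards, matching the product over
  \<open>j=1..n\<close> in \<open>tp_gaussian_type\<close>.\<close>

primrec exp_avgs :: "(nat \<Rightarrow> real) \<Rightarrow> (real \<Rightarrow> real) \<Rightarrow> nat \<Rightarrow> real \<Rightarrow> real" where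
  "exp_avgs \<delta> g 0 = g"
| "exp_avgs \<delta> g (Suc n) = exp_avg (\<delta> (Suc n)) (exp_avgs \<delta> g n)"

lemma exp_decay_exp_avgs: "exp_decay g \<Longrightarrow> exp_decay (exp_avgs \<delta> g n)"
  by (induction n) (auto intro: exp_decay_exp_avg)

text \<open>By Rolle, passing from \<open>exp_avg \<delta> g\<close> to \<open>g\<close> keeps one zero per sampling interval.\<close>

lemma fiber_zeros_imp_zero_coeff:
  assumes a: "a > 0" and "A \<noteq> 0" and \<alpha>: "0 < \<alpha>" "\<alpha> < L"
    and c: "\<And>j. \<bar>c j :: real\<bar> \<le> M"
    and "strict_mono y" "\<And>k::int. \<bar>y k - \<alpha> * of_int k\<bar> \<le> D"
    and "\<And>k. fiber L (exp_avgs \<delta> (\<lambda>x. A * exp (- (a * x\<^sup>2))) n) c (y k) = 0"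
  shows "c p = 0"
  using assms(6-)
proof (induction n arbitrary: y D)
  case 0
  have "inj y" using 0(1) by (rule strict_mono_imp_inj_on)
  have "A * fiber L (\<lambda>x. exp (- (a * x\<^sup>2))) c (y k) = 0" for k
  proof -
    have "fiber L (\<lambda>x. A * exp (- (a * x\<^sup>2))) c (y k) = A * fiber L (\<lambda>x. exp (- (a * x\<^sup>2))) c (y k)"
      unfolding fiber_def by (simp add: mult.assoc)
    then show ?thesis using 0(3) [of k] by simp
  qed
  then have zero: "fiber L (\<lambda>x. exp (- (a * x\<^sup>2))) c (y k) = 0" for k
    using \<open>A \<noteq> 0\<close> by simp
  have "L > 0" using \<alpha> by simp
  show ?case
    by (rule gaussian_sum_unique [OF a \<open>L > 0\<close> c \<alpha> \<open>inj y\<close> 0(2) zero])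
next
  case (Suc n)
  let ?g = "exp_avgs \<delta> (\<lambda>x. A * exp (- (a * x\<^sup>2))) n"
  have L: "L > 0" using \<alpha> by simp
  have g: "exp_decay ?g" by (intro exp_decay_exp_avgs exp_decay_gaussian a)
  let ?\<phi> = "fiber L ?g c"
  obtain K where K: "\<And>(c :: int \<Rightarrow> real) M t. (\<And>j. norm (c j) \<le> M) \<Longrightarrow> norm (fiber L ?g c t) \<le> K * M"
    using fiber_bounded_exp [OF g L, where 'a = real] by metis
  have bd: "\<bar>?\<phi> x\<bar> \<le> K * M" for x
    using K [of c M x] c by simp
  have cont: "continuous_on UNIV ?\<phi>"
    using g L c by (intro continuous_on_fiber [where M = M]) auto
  have zero: "exp_avg (\<delta> (Suc n)) ?\<phi> (y k) = 0" for k
    using Suc.prems(3) [of k] fiber_exp_avg [OF g L c] by simp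
  show ?case
  proof (cases "\<delta> (Suc n) = 0")
    case True
    with zero have "?\<phi> (y k) = 0" for k by (simp add: exp_avg_0)
    then show ?thesis using Suc.IH Suc.prems by blast
  next
    case False
    have "\<exists>w. y k < w \<and> w < y (k + 1) \<and> ?\<phi> w = 0" for k
      using Suc.prems(1) zero by (intro exp_avg_Rolle [OF cont bd False]) (auto simp: strict_mono_less)
    then obtain w where w: "\<And>k. y k < w k" "\<And>k. w k < y (k + 1)" "\<And>k. ?\<phi> (w k) = 0"
      by metis
    have "strict_mono w"
    proof (rule strict_monoI)
      fix k l :: int assume "k < l"
      then have "y (k + 1) \<le> y l" using Suc.prems(1) by (simp add: strict_mono_less_eq)
      then show "w k < w l" using w(2) [of k] w(1) [of l] by linarith
    qed
    \<comment> \<open>The new zero lies between the nodes of indices \<open>k\<close> and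
      \<open>k + 1\<close>, so each average undone adds one sampling step \<alpha> to the admissible
      deviation.\<close>
    moreover have "\<bar>w k - \<alpha> * of_int k\<bar> \<le> D + \<alpha>" for k
      using w(1) [of k] w(2) [of k] Suc.prems(2) [of k] Suc.prems(2) [of "k + 1"] \<alpha>
      by (simp add: abs_le_iff algebra_simps)
    ultimately show ?thesis using Suc.IH w(3) by blast
  qed
qed

section \<open>From uniqueness to stability\<close>

lemma fiber_scale: "fiber L g (\<lambda>j. r * c j) t = (r :: real) * fiber L g c t"
  unfolding fiber_def by (simp add: mult.left_commute)

context
  fixes g :: "real \<Rightarrow> real" and L \<alpha> :: real
  assumes g: "exp_decay g" and L: "L > 0" and \<alpha>: "\<alpha> > 0"
    and unique: "\<forall>(c :: int \<Rightarrow> real) M x p. (\<forall>j. \<bar>c j\<bar> \<le> M) \<longrightarrow>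
      (\<forall>k. fiber L g c (x + \<alpha> * of_int k) = 0) \<longrightarrow> c p = 0"
begin

text \<open>Otherwise a sequence of counterexamples has, by compactness of a box in the product
  topology, an entrywise limit whose samples all vanish; the condition at index 0 survives the limit
  and contradicts uniqueness. The ratio 2 between the bounds leaves room for a supremum that is not
  attained.\<close>

lemma fiber_linf_stable:
  obtains \<delta> :: real where "\<delta> > 0"
    "\<And>(c :: int \<Rightarrow> real) x. (\<And>j. \<bar>c j\<bar> \<le> 2) \<Longrightarrow> \<bar>c 0\<bar> \<ge> 1 \<Longrightarrow> \<exists>k. \<bar>fiber L g c (x + \<alpha> * of_int k)\<bar> \<ge> \<delta>"
proof (rule ccontr)
  assume "\<not> thesis"
  then have "\<exists>(c :: int \<Rightarrow> real) x. (\<forall>j. \<bar>c j\<bar> \<le> 2) \<and> \<bar>c 0\<bar> \<ge> 1 \<and> (\<forall>k. \<bar>fiber L g c (x + \<alpha> * of_int k)\<bar> < 1 / real (Suc n))" for n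
    using that [of "1 / real (Suc n)"] by (force simp: not_le)
  then obtain c :: "nat \<Rightarrow> int \<Rightarrow> real" and x where c: "\<And>n j. \<bar>c n j\<bar> \<le> 2" "\<And>n. \<bar>c n 0\<bar> \<ge> 1"
    and small: "\<And>n k. \<bar>fiber L g (c n) (x n + \<alpha> * of_int k)\<bar> < 1 / real (Suc n)"
    by metis
  \<comment> \<open>Translating the sampling lattice by its own elements only renumbers the samples,
    so the base points may be taken in a compact interval.\<close>
  define x' where "x' n = x n - \<alpha> * of_int \<lfloor>x n / \<alpha>\<rfloor>" for n
  have x': "x' n \<in> {0..\<alpha>}" for n
    using \<alpha> floor_divide_lower [of \<alpha> "x n"] floor_divide_upper [of \<alpha> "x n"]
    by (auto simp: x'_def algebra_simps)
  have small': "\<bar>fiber L g (c n) (x' n + \<alpha> * of_int k)\<bar> < 1 / real (Suc n)" for n k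
    using small [of n "k - \<lfloor>x n / \<alpha>\<rfloor>"] by (simp add: x'_def algebra_simps)
  define K :: "(int \<Rightarrow> real) set" where "K = (\<Pi>\<^sub>E i\<in>UNIV. {-2..2})"
  have "compactin (product_topology (\<lambda>i. euclidean) UNIV) K"
    unfolding K_def compactin_PiE by auto
  then have "compact K"
    by (simp add: euclidean_product_topology)
  then have "compact ({0..\<alpha>} \<times> K)"
    by (intro compact_Times) auto
  then have "seq_compact ({0..\<alpha>} \<times> K)"
    by (rule compact_imp_seq_compact)
  moreover have "\<forall>n. (x' n, c n) \<in> {0..\<alpha>} \<times> K"
    using x' c(1) by (auto simp: K_def PiE_UNIV_domain abs_le_iff minus_le_iff)
  ultimately obtain l r where l: "strict_mono r" "((\<lambda>n. (x' n, c n)) \<circ> r) \<longlonglongrightarrow> l"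
    by (meson seq_compactE)
  obtain y d where yd: "l = (y, d)" by (cases l)
  have y: "(\<lambda>n. x' (r n)) \<longlonglongrightarrow> y"
    using tendsto_fst [OF l(2)] by (simp add: yd comp_def)
  have "(\<lambda>n. c (r n)) \<longlonglongrightarrow> d"
    using tendsto_snd [OF l(2)] by (simp add: yd comp_def)
  then have d: "(\<lambda>n. c (r n) j) \<longlonglongrightarrow> d j" for j
    by (rule continuous_on_tendsto_compose [OF continuous_on_product_coordinates]) auto
  have "\<bar>d j\<bar> \<le> 2" for j
    by (rule Lim_bounded [OF tendsto_rabs [OF d]]) (use c in auto)
  moreover have "fiber L g d (y + \<alpha> * of_int k) = 0" for k
  proof -
    have "(\<lambda>n. fiber L g (c (r n)) (x' (r n) + \<alpha> * of_int k)) \<longlonglongrightarrow> fiber L g d (y + \<alpha> * of_int k)"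
      using c by (intro tendsto_fiber [where M = 2, OF g L] d tendsto_intros y) auto
    moreover have "(\<lambda>n. fiber L g (c (r n)) (x' (r n) + \<alpha> * of_int k)) \<longlonglongrightarrow> 0"
    proof (rule Lim_null_comparison)
      show "\<forall>\<^sub>F n in sequentially. norm (fiber L g (c (r n)) (x' (r n) + \<alpha> * of_int k)) \<le> 1 / real (Suc n)"
      proof (intro always_eventually allI)
        fix n
        have "1 / real (Suc (r n)) \<le> 1 / real (Suc n)"
          using seq_suble [OF l(1), of n] by (simp add: field_simps)
        with small' [of "r n" k] show "norm (fiber L g (c (r n)) (x' (r n) + \<alpha> * of_int k)) \<le> 1 / real (Suc n)"
          by simp
      qed
      show "(\<lambda>n. 1 / real (Suc n)) \<longlonglongrightarrow> 0" by (rule LIMSEQ_Suc [OF lim_1_over_n])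
    qed
    ultimately show ?thesis by (rule LIMSEQ_unique)
  qed
  ultimately have "d 0 = 0" using unique by blast
  moreover have "1 \<le> \<bar>d 0\<bar>"
    by (rule Lim_bounded2 [OF tendsto_rabs [OF d]]) (use c in auto)
  ultimately show False by simp
qed

text \<open>Localisation: the exponential weight \<open>exp (- \<epsilon> |j L - m L|)\<close> commutes with sampling up to an error
  of order \<open>\<epsilon>\<close>, so the uniform lower bound also holds after weighting; summing the weighted
  bounds over \<open>m\<close> turns the supremum bound into a square sum bound.\<close>

lemma fiber_l2_stable:
  obtains A where "A > 0"
    "\<And>(c :: int \<Rightarrow> real) M x. (\<And>j. \<bar>c j\<bar> \<le> M) \<Longrightarrow>
      (\<integral>\<^sup>+j. ennreal ((c j)\<^sup>2) \<partial>int_count)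
        \<le> ennreal A * (\<integral>\<^sup>+k. ennreal ((fiber L g c (x + \<alpha> * of_int k))\<^sup>2) \<partial>int_count)"
proof -
  obtain \<delta> :: real where \<delta>: "\<delta> > 0"
    "\<And>(c :: int \<Rightarrow> real) x. (\<And>j. \<bar>c j\<bar> \<le> 2) \<Longrightarrow> \<bar>c 0\<bar> \<ge> 1 \<Longrightarrow> \<exists>k. \<bar>fiber L g c (x + \<alpha> * of_int k)\<bar> \<ge> \<delta>"
    using fiber_linf_stable by metis
  obtain C a where *: "a > 0" "C > 0" "\<And>x. \<bar>g x\<bar> \<le> C * exp (- (a * \<bar>x\<bar>))" "continuous_on UNIV g"
    using exp_decayE [OF g] by metis
  obtain K where K: "K > 0" "\<And>t. (LINT j|int_count. exp (- (a / 2 * \<bar>t + of_int j * L\<bar>))) \<le> K"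
    using integral_exp_abs_int_bound [OF _ L, of "a / 2"] *(1) by (metis half_gt_zero)
  \<comment> \<open>The first bound leaves half of the decay rate of \<open>g\<close> in the
    commutator kernel; the second makes the total commutator error at most
    \<open>\<delta> * D / 2\<close>, half of the lower bound for the samples of the weighted
    sequence.\<close>
  define \<epsilon> where "\<epsilon> = min (a / 4) (\<delta> * a / (16 * C * K))"
  have \<epsilon>: "\<epsilon> > 0" "\<epsilon> \<le> a / 4" "\<epsilon> * (16 * C * K) \<le> \<delta> * a"
  proof -
    show "\<epsilon> > 0" "\<epsilon> \<le> a / 4" using * \<delta> K by (auto simp: \<epsilon>_def)
    have "\<epsilon> \<le> \<delta> * a / (16 * C * K)" by (simp add: \<epsilon>_def)
    then show "\<epsilon> * (16 * C * K) \<le> \<delta> * a" using * K by (simp add: field_simps)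
  qed
  obtain K2 where K2: "K2 > 0" "\<And>t. (\<integral>\<^sup>+j. ennreal (exp (- (2 * \<epsilon> * \<bar>t + of_int j * L\<bar>))) \<partial>int_count) \<le> ennreal K2"
    using integral_exp_abs_int_bound [OF _ L, of "2 * \<epsilon>"] \<epsilon>(1) by (metis mult_pos_pos zero_less_numeral)
  \<comment> \<open>Uses \<open>exp y - 1 \<le> y * exp y\<close> to extract the factor
    \<open>\<epsilon>\<close>. Of the decay rate \<open>a\<close>, one quarter pays for the factor
    \<open>|u|\<close> and one quarter for the exponential, leaving \<open>a / 2\<close>.\<close>
  have kernel: "(exp (\<epsilon> * \<bar>u\<bar>) - 1) * \<bar>g u\<bar> \<le> 4 * \<epsilon> * C / a * exp (- (a / 2 * \<bar>u\<bar>))" for u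
  proof -
    have 1: "exp (\<epsilon> * \<bar>u\<bar>) - 1 \<le> \<epsilon> * \<bar>u\<bar> * exp (\<epsilon> * \<bar>u\<bar>)"
    proof -
      have "(1 - \<epsilon> * \<bar>u\<bar>) * exp (\<epsilon> * \<bar>u\<bar>) \<le> exp (- (\<epsilon> * \<bar>u\<bar>)) * exp (\<epsilon> * \<bar>u\<bar>)"
        using exp_ge_add_one_self [of "- (\<epsilon> * \<bar>u\<bar>)"] by (intro mult_right_mono) auto
      also have "\<dots> = 1" by (simp add: mult_exp_exp)
      finally show ?thesis by (simp add: algebra_simps)
    qed
    have 2: "\<bar>u\<bar> \<le> 4 / a * exp (a / 4 * \<bar>u\<bar>)"
      using exp_ge_add_one_self [of "a / 4 * \<bar>u\<bar>"] * by (simp add: field_simps)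
    have 3: "exp (\<epsilon> * \<bar>u\<bar>) \<le> exp (a / 4 * \<bar>u\<bar>)"
      using mult_right_mono [OF \<epsilon>(2), of "\<bar>u\<bar>"] by simp
    have "exp (\<epsilon> * \<bar>u\<bar>) - 1 \<le> \<epsilon> * (4 / a * exp (a / 4 * \<bar>u\<bar>)) * exp (a / 4 * \<bar>u\<bar>)"
      using 1 by (rule order_trans) (intro mult_mono mult_left_mono 2 3, use \<epsilon> * in auto)
    then have "(exp (\<epsilon> * \<bar>u\<bar>) - 1) * \<bar>g u\<bar>
        \<le> (\<epsilon> * (4 / a * exp (a / 4 * \<bar>u\<bar>)) * exp (a / 4 * \<bar>u\<bar>)) * (C * exp (- (a * \<bar>u\<bar>)))"
      using \<epsilon> * by (intro mult_mono) auto
    also have "\<dots> = 4 * \<epsilon> * C / a * (exp (a / 4 * \<bar>u\<bar>) * exp (a / 4 * \<bar>u\<bar>) * exp (- (a * \<bar>u\<bar>)))"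
      by (simp add: field_simps)
    also have "exp (a / 4 * \<bar>u\<bar>) * exp (a / 4 * \<bar>u\<bar>) * exp (- (a * \<bar>u\<bar>)) = exp (- (a / 2 * \<bar>u\<bar>))"
      unfolding mult_exp_exp by (simp add: field_simps)
    finally show ?thesis .
  qed
  show ?thesis
  proof (rule that [of "16 / \<delta>\<^sup>2 * K2"])
    show "16 / \<delta>\<^sup>2 * K2 > 0" using \<delta> K2 by simp
    fix c :: "int \<Rightarrow> real" and M x
    assume c: "\<And>j. \<bar>c j\<bar> \<le> M"
    let ?F = "\<lambda>k. fiber L g c (x + \<alpha> * of_int k)"
    \<comment> \<open>One sample, discounted by the distance between its point and the shift
      \<open>m\<close>, controls \<open>c m\<close>. The weighted sequence \<open>d\<close> may be
      near its supremum at another index \<open>j0\<close>, but \<open>d m = c m\<close> is at most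
      twice \<open>|d j0|\<close>, so a bound in terms of \<open>|d j0|\<close> suffices.\<close>
    have localized: "\<exists>k. \<bar>c m\<bar> \<le> 4 / \<delta> * (exp (- (\<epsilon> * \<bar>x + \<alpha> * of_int k + of_int m * L\<bar>)) * \<bar>?F k\<bar>)" for m
    proof (cases "c m = 0")
      case True
      then show ?thesis using \<delta> by auto
    next
      case False
      define \<phi> where "\<phi> j = exp (- (\<epsilon> * \<bar>of_int j * L - of_int m * L\<bar>))" for j :: int
      define d where "d j = \<phi> j * c j" for j
      have \<phi>: "\<phi> j > 0" "\<phi> j \<le> 1" for j using \<epsilon> by (auto simp: \<phi>_def)
      have dM: "\<bar>d j\<bar> \<le> M" for j
      proof -
        have "\<bar>d j\<bar> \<le> 1 * \<bar>c j\<bar>"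
          unfolding d_def abs_mult using \<phi> [of j] by (intro mult_right_mono) auto
        then show ?thesis using c [of j] by simp
      qed
      have dm: "d m = c m" by (simp add: d_def \<phi>_def)
      have bdd: "bdd_above (range (\<lambda>j. \<bar>d j\<bar>))" using dM by (auto simp: bdd_above_def)
      define S where "S = (SUP j. \<bar>d j\<bar>)"
      have S: "\<bar>d j\<bar> \<le> S" for j unfolding S_def by (rule cSUP_upper [OF _ bdd]) simp
      have "S > 0" using S [of m] False dm by simp
      have "\<exists>j0. S / 2 < \<bar>d j0\<bar>"
      proof (rule ccontr)
        assume "\<not> ?thesis"
        then have le: "\<bar>d j\<bar> \<le> S / 2" for j by (simp add: not_less)
        have "(SUP j. \<bar>d j\<bar>) \<le> S / 2" by (intro cSUP_least le) simp
        then have "S \<le> S / 2" by (simp only: S_def [symmetric])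
        with \<open>S > 0\<close> show False by simp
      qed
      then obtain j0 where j0: "S / 2 < \<bar>d j0\<bar>" by blast
      define D where "D = \<bar>d j0\<bar>"
      have D: "D > 0" "\<And>j. \<bar>d j\<bar> \<le> 2 * D" using j0 \<open>S > 0\<close> S order_trans
        by (auto simp: D_def intro: order_trans [OF S])
      \<comment> \<open>The near-maximal entry is normalised and moved to index 0; by
        \<open>fiber_shift\<close> the base point has to be displaced by \<open>j0 * L\<close> to
        compensate.\<close>
      have "\<exists>k. \<delta> \<le> \<bar>fiber L g (\<lambda>j. 1 / D * d (j + j0)) (x + of_int j0 * L + \<alpha> * of_int k)\<bar>"
        by (rule \<delta>(2)) (use D in \<open>auto simp: D_def abs_mult field_simps\<close>)
      then obtain k where k: "\<delta> \<le> \<bar>fiber L g (\<lambda>j. 1 / D * d (j + j0)) (x + of_int j0 * L + \<alpha> * of_int k)\<bar>"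
        by blast
      also have "fiber L g (\<lambda>j. 1 / D * d (j + j0)) (x + of_int j0 * L + \<alpha> * of_int k)
          = 1 / D * fiber L g d (x + \<alpha> * of_int k)"
        unfolding fiber_scale fiber_shift by (simp add: algebra_simps)
      finally have low: "\<delta> * D \<le> \<bar>fiber L g d (x + \<alpha> * of_int k)\<bar>"
        using D by (simp add: abs_mult field_simps)
      define \<psi> where "\<psi> = exp (- (\<epsilon> * \<bar>x + \<alpha> * of_int k + of_int m * L\<bar>))"
      define t where "t = x + \<alpha> * of_int k"
      \<comment> \<open>Commutator estimate: the weight \<open>\<psi>\<close> at the sampling point
        and the weight \<open>\<phi> j\<close> at the shift differ by a factor \<open>exp v\<close>
        with \<open>|v| \<le> \<epsilon> * |t + j L|\<close>, a quantity that the decay of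
        \<open>g\<close> controls term by term.\<close>
      have "\<bar>\<psi> * fiber L g c t - fiber L g d t\<bar> \<le> (LINT j|int_count. 2 * D * (4 * \<epsilon> * C / a) * exp (- (a / 2 * \<bar>t + of_int j * L\<bar>)))"
      proof -
        have ic: "integrable int_count (\<lambda>j. g (t + of_int j * L) *\<^sub>R c j)"
          using c by (intro integrable_fiber [OF g L, where M = M]) auto
        have id: "integrable int_count (\<lambda>j. g (t + of_int j * L) *\<^sub>R d j)"
          using dM by (intro integrable_fiber [OF g L, where M = M]) auto
        have "\<psi> * fiber L g c t - fiber L g d t
            = (LINT j|int_count. \<psi> * (g (t + of_int j * L) *\<^sub>R c j) - g (t + of_int j * L) *\<^sub>R d j)"
          unfolding fiber_def integral_mult_right_zero [symmetric]
          by (intro Bochner_Integration.integral_diff [symmetric] integrable_mult_right ic id)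
        also have "\<bar>\<dots>\<bar> \<le> (LINT j|int_count. \<bar>\<psi> * (g (t + of_int j * L) *\<^sub>R c j) - g (t + of_int j * L) *\<^sub>R d j\<bar>)"
          by (rule integral_abs_bound)
        also have "\<dots> \<le> (LINT j|int_count. 2 * D * (4 * \<epsilon> * C / a) * exp (- (a / 2 * \<bar>t + of_int j * L\<bar>)))"
        proof (rule integral_mono)
          show "integrable int_count (\<lambda>j. \<bar>\<psi> * (g (t + of_int j * L) *\<^sub>R c j) - g (t + of_int j * L) *\<^sub>R d j\<bar>)"
            by (intro integrable_abs Bochner_Integration.integrable_diff integrable_mult_right ic id)
          show "integrable int_count (\<lambda>j. 2 * D * (4 * \<epsilon> * C / a) * exp (- (a / 2 * \<bar>t + of_int j * L\<bar>)))"
            using * L by (intro integrable_mult_right integrable_exp_abs_shift) auto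
          fix j :: int
          define u where "u = t + of_int j * L"
          define v where "v = \<epsilon> * \<bar>of_int j * L - of_int m * L\<bar> - \<epsilon> * \<bar>t + of_int m * L\<bar>"
          have "\<psi> = \<phi> j * exp v"
            unfolding \<psi>_def \<phi>_def v_def t_def mult_exp_exp by (simp add: algebra_simps)
          then have "\<psi> * (g u *\<^sub>R c j) - g u *\<^sub>R d j = (exp v - 1) * g u * d j"
            by (simp add: d_def algebra_simps)
          moreover have "\<bar>exp v - 1\<bar> \<le> exp (\<epsilon> * \<bar>u\<bar>) - 1"
          proof -
            have "\<bar>\<bar>of_int j * L - of_int m * L\<bar> - \<bar>t + of_int m * L\<bar>\<bar> \<le> \<bar>u\<bar>"
              unfolding u_def by linarith
            then have "\<epsilon> * \<bar>\<bar>of_int j * L - of_int m * L\<bar> - \<bar>t + of_int m * L\<bar>\<bar> \<le> \<epsilon> * \<bar>u\<bar>"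
              using \<epsilon> by (intro mult_left_mono) auto
            then have v: "\<bar>v\<bar> \<le> \<epsilon> * \<bar>u\<bar>"
              using \<epsilon> by (simp add: v_def right_diff_distrib [symmetric] abs_mult)
            have "1 - exp v \<le> exp (- v) - 1"
            proof -
              have "0 \<le> (exp (v / 2) - exp (- (v / 2)))\<^sup>2" by simp
              also have "\<dots> = exp v + exp (- v) - 2"
                by (simp add: power2_diff exp_double [symmetric] mult_exp_exp)
              finally show ?thesis by simp
            qed
            moreover have "exp v \<le> exp (\<epsilon> * \<bar>u\<bar>)" "exp (- v) \<le> exp (\<epsilon> * \<bar>u\<bar>)"
              using v by (auto simp: abs_le_iff)
            ultimately show ?thesis unfolding abs_le_iff by linarith
          qed
          ultimately have "\<bar>\<psi> * (g u *\<^sub>R c j) - g u *\<^sub>R d j\<bar> \<le> (exp (\<epsilon> * \<bar>u\<bar>) - 1) * \<bar>g u\<bar> * (2 * D)"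
            using D(2) [of j] \<epsilon> by (simp add: abs_mult mult_mono)
          also have "\<dots> \<le> (4 * \<epsilon> * C / a * exp (- (a / 2 * \<bar>u\<bar>))) * (2 * D)"
            using D by (intro mult_right_mono kernel) auto
          finally show "\<bar>\<psi> * (g (t + of_int j * L) *\<^sub>R c j) - g (t + of_int j * L) *\<^sub>R d j\<bar>
              \<le> 2 * D * (4 * \<epsilon> * C / a) * exp (- (a / 2 * \<bar>t + of_int j * L\<bar>))"
            by (simp add: u_def mult_ac)
        qed
        finally show ?thesis .
      qed
      also have "\<dots> = 2 * D * (4 * \<epsilon> * C / a) * (LINT j|int_count. exp (- (a / 2 * \<bar>t + of_int j * L\<bar>)))"
        by (rule integral_mult_right_zero)
      also have "\<dots> \<le> 2 * D * (4 * \<epsilon> * C / a) * K"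
        using D \<epsilon> * by (intro mult_left_mono K) auto
      also have "\<dots> = D * (\<epsilon> * (16 * C * K)) / (2 * a)"
        using * by (simp add: field_simps)
      also have "\<dots> \<le> D * (\<delta> * a) / (2 * a)"
        using D \<epsilon> * by (intro divide_right_mono mult_left_mono) auto
      also have "\<dots> = \<delta> * D / 2" using * by simp
      finally have "\<delta> * D / 2 \<le> \<bar>\<psi> * fiber L g c t\<bar>"
        using low unfolding t_def by linarith
      moreover have "\<delta> * \<bar>c m\<bar> \<le> \<delta> * (2 * D)"
        using D(2) [of m] dm \<delta>(1) by (intro mult_left_mono) auto
      moreover have "\<bar>\<psi> * fiber L g c t\<bar> = \<psi> * \<bar>fiber L g c t\<bar>"
        by (simp add: abs_mult \<psi>_def)
      ultimately have "\<delta> * \<bar>c m\<bar> \<le> 4 * (\<psi> * \<bar>fiber L g c t\<bar>)"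
        by linarith
      then have "\<bar>c m\<bar> \<le> 4 / \<delta> * (\<psi> * \<bar>fiber L g c t\<bar>)"
        using pos_le_divide_eq [OF \<delta>(1)] by (simp add: mult.commute)
      then show ?thesis unfolding \<psi>_def t_def by blast
    qed
    define w where "w m k = ennreal (exp (- (2 * \<epsilon> * \<bar>x + \<alpha> * of_int k + of_int m * L\<bar>)))" for m k :: int
    \<comment> \<open>The single good sample is replaced by the weighted sum over all samples. This
      removes the dependence on the chosen \<open>k\<close>, and the weights can then be summed over
      \<open>m\<close> with a bound uniform in \<open>k\<close>.\<close>
    have "ennreal ((c m)\<^sup>2) \<le> (\<integral>\<^sup>+k. ennreal (16 / \<delta>\<^sup>2) * (w m k * ennreal ((?F k)\<^sup>2)) \<partial>int_count)" for m
    proof -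
      obtain k where "\<bar>c m\<bar> \<le> 4 / \<delta> * (exp (- (\<epsilon> * \<bar>x + \<alpha> * of_int k + of_int m * L\<bar>)) * \<bar>?F k\<bar>)"
        using localized by blast
      then have "\<bar>c m\<bar>\<^sup>2 \<le> (4 / \<delta> * (exp (- (\<epsilon> * \<bar>x + \<alpha> * of_int k + of_int m * L\<bar>)) * \<bar>?F k\<bar>))\<^sup>2"
        by (rule power_mono) simp
      also have "\<dots> = 16 / \<delta>\<^sup>2 * (exp (- (2 * \<epsilon> * \<bar>x + \<alpha> * of_int k + of_int m * L\<bar>)) * (?F k)\<^sup>2)"
        by (simp add: power_mult_distrib power_divide exp_double [symmetric] mult.assoc)
      finally have "ennreal ((c m)\<^sup>2) \<le> ennreal (16 / \<delta>\<^sup>2) * (w m k * ennreal ((?F k)\<^sup>2))"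
        unfolding w_def by (simp add: ennreal_mult [symmetric] ennreal_leI)
      also have "\<dots> \<le> (\<integral>\<^sup>+k. ennreal (16 / \<delta>\<^sup>2) * (w m k * ennreal ((?F k)\<^sup>2)) \<partial>int_count)"
        by (rule nn_integral_ge_point) simp
      finally show ?thesis .
    qed
    then have "(\<integral>\<^sup>+m. ennreal ((c m)\<^sup>2) \<partial>int_count)
        \<le> (\<integral>\<^sup>+m. (\<integral>\<^sup>+k. ennreal (16 / \<delta>\<^sup>2) * (w m k * ennreal ((?F k)\<^sup>2)) \<partial>int_count) \<partial>int_count)"
      by (intro nn_integral_mono)
    also have "\<dots> = (\<integral>\<^sup>+k. (\<integral>\<^sup>+m. ennreal (16 / \<delta>\<^sup>2) * (w m k * ennreal ((?F k)\<^sup>2)) \<partial>int_count) \<partial>int_count)"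
      by (rule nn_integral_count_space_nn_integral) auto
    also have "\<dots> = (\<integral>\<^sup>+k. ennreal (16 / \<delta>\<^sup>2) * ((\<integral>\<^sup>+m. w m k \<partial>int_count) * ennreal ((?F k)\<^sup>2)) \<partial>int_count)"
      by (simp add: nn_integral_cmult nn_integral_multc)
    also have "\<dots> \<le> (\<integral>\<^sup>+k. ennreal (16 / \<delta>\<^sup>2) * (ennreal K2 * ennreal ((?F k)\<^sup>2)) \<partial>int_count)"
      unfolding w_def by (intro nn_integral_mono mult_left_mono mult_right_mono K2) auto
    also have "\<dots> = ennreal (16 / \<delta>\<^sup>2 * K2) * (\<integral>\<^sup>+k. ennreal ((?F k)\<^sup>2) \<partial>int_count)"
      using K2 by (subst ennreal_mult) (simp_all add: nn_integral_cmult mult.assoc)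
    finally show "(\<integral>\<^sup>+j. ennreal ((c j)\<^sup>2) \<partial>int_count)
        \<le> ennreal (16 / \<delta>\<^sup>2 * K2) * (\<integral>\<^sup>+k. ennreal ((?F k)\<^sup>2) \<partial>int_count)" .
  qed
qed

end

section \<open>Fourier series on a period\<close>

definition four_exp :: "real \<Rightarrow> int \<Rightarrow> real \<Rightarrow> complex" where
  "four_exp L l x = exp (2 * of_real pi * \<i> * of_int l * of_real x / of_real L)"

text \<open>Half-open, so that its translates by multiples of \<open>L\<close> tile the line without
  overlap.\<close>

abbreviation per :: "real \<Rightarrow> real measure" where
  "per L \<equiv> restrict_space lborel {0..<L}"

lemma norm_four_exp [simp]: "norm (four_exp L l x) = 1"
  unfolding four_exp_def by (subst norm_exp_eq_Re) (simp add: Re_divide_of_real)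

lemma cnj_four_exp: "cnj (four_exp L l x) = four_exp L (- l) x"
  unfolding four_exp_def by (simp add: exp_cnj)

lemma four_exp_mult: "four_exp L l x * four_exp L m x = four_exp L (l + m) x"
  unfolding four_exp_def mult_exp_exp by (simp add: algebra_simps add_divide_distrib)

lemma continuous_on_four_exp: "continuous_on A (four_exp L l)"
proof -
  have "continuous_on A (\<lambda>x. exp (2 * of_real pi * \<i> * of_int l * of_real x * inverse (of_real L :: complex)))"
    by (intro continuous_intros)
  then show ?thesis by (simp add: four_exp_def [abs_def] divide_inverse)
qed

lemma measurable_four_exp [measurable]: "four_exp L l \<in> borel_measurable borel"
  by (rule borel_measurable_continuous_onI [OF continuous_on_four_exp])

lemma finite_measure_per: "finite_measure (per L)"
proof (rule finite_measureI)
  show "emeasure (per L) (space (per L)) \<noteq> \<infinity>"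
    by (cases "0 \<le> L") (simp_all add: emeasure_restrict_space space_restrict_space)
qed

lemma integral_four_exp:
  assumes "L > 0"
  shows "(LINT x|per L. four_exp L l x) = (if l = 0 then of_real L else 0)"
  using integral_exp_period [OF assms, of l] by (simp add: integral_restrict_space four_exp_def)

section \<open>Trigonometric polynomials and uniform approximation on the circle\<close>

inductive trig_poly :: "real \<Rightarrow> (real \<Rightarrow> complex) \<Rightarrow> bool" for L where
  single: "trig_poly L (\<lambda>x. c * four_exp L l x)"
| add: "trig_poly L p \<Longrightarrow> trig_poly L q \<Longrightarrow> trig_poly L (\<lambda>x. p x + q x)"

lemma trig_poly_mult_term:
  assumes "trig_poly L p"
  shows "trig_poly L (\<lambda>x. p x * (c * four_exp L l x))"
  using assms
proof induction
  case (single d m)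
  have "(\<lambda>x. d * four_exp L m x * (c * four_exp L l x)) = (\<lambda>x. (d * c) * four_exp L (m + l) x)"
    by (simp add: four_exp_mult [symmetric] mult_ac)
  then show ?case by (simp only: trig_poly.single)
next
  case (add p q)
  from add.IH show ?case unfolding distrib_right by (rule trig_poly.add)
qed

lemma trig_poly_mult:
  assumes "trig_poly L p" "trig_poly L q"
  shows "trig_poly L (\<lambda>x. p x * q x)"
  using assms(2)
proof induction
  case (single c l)
  then show ?case by (rule trig_poly_mult_term [OF assms(1)])
next
  case (add p q)
  from add.IH show ?case unfolding distrib_left by (rule trig_poly.add)
qed

lemma trig_poly_const: "trig_poly L (\<lambda>x. c)"
  using trig_poly.single [of L c 0] by (simp add: four_exp_def)

lemma trig_poly_finite_sum:
  assumes "trig_poly L p"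
  shows "\<exists>A c. finite A \<and> p = (\<lambda>x. \<Sum>l\<in>A. c l * four_exp L l x)"
  using assms
proof induction
  case (single c l)
  show ?case by (intro exI [of _ "{l}"] exI [of _ "\<lambda>_. c"]) simp
next
  case (add p q)
  then obtain A c B d where A: "finite A" "p = (\<lambda>x. \<Sum>l\<in>A. c l * four_exp L l x)"
    and B: "finite B" "q = (\<lambda>x. \<Sum>l\<in>B. d l * four_exp L l x)" by blast
  let ?e = "\<lambda>l. (if l \<in> A then c l else 0) + (if l \<in> B then d l else 0)"
  have "(\<Sum>l\<in>A. c l * four_exp L l x) = (\<Sum>l\<in>A \<union> B. (if l \<in> A then c l else 0) * four_exp L l x)" for x
    using A B by (intro sum.mono_neutral_cong_left) auto
  moreover have "(\<Sum>l\<in>B. d l * four_exp L l x) = (\<Sum>l\<in>A \<union> B. (if l \<in> B then d l else 0) * four_exp L l x)" for x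
    using A B by (intro sum.mono_neutral_cong_left) auto
  ultimately have "(\<lambda>x. p x + q x) = (\<lambda>x. \<Sum>l\<in>A \<union> B. ?e l * four_exp L l x)"
    unfolding A(2) B(2) by (simp add: sum.distrib [symmetric] distrib_right)
  then show ?case using A B by (intro exI [of _ "A \<union> B"] exI [of _ ?e]) simp
qed

text \<open>Brings the Stone-Weierstrass theorem on the circle back to the line. A real linear form
  on the plane is a combination of the coordinates, and on the circle these are combinations of the
  characters of index 1 and -1.\<close>

lemma trig_poly_real_polynomial:
  assumes "real_polynomial_function q"
  shows "trig_poly L (\<lambda>x. of_real (q (four_exp L 1 x)))"
  using assms
proof induction
  case (linear f)
  interpret f: bounded_linear f by fact
  have "of_real (f (four_exp L 1 x))
     = complex_of_real (f 1) / 2 * four_exp L 1 x + of_real (f 1) / 2 * four_exp L (- 1) x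
      + (of_real (f \<i>) / (2 * \<i>) * four_exp L 1 x + - of_real (f \<i>) / (2 * \<i>) * four_exp L (- 1) x)" for x
  proof -
    let ?z = "four_exp L 1 x"
    have "f ?z = f (Re ?z *\<^sub>R 1 + Im ?z *\<^sub>R \<i>)"
      by (metis complex_eq mult.commute mult.right_neutral scaleR_conv_of_real)
    also have "\<dots> = Re ?z * f 1 + Im ?z * f \<i>"
      by (simp only: f.add f.scaleR real_scaleR_def)
    finally have "complex_of_real (f ?z) = of_real (Re ?z) * of_real (f 1) + of_real (Im ?z) * of_real (f \<i>)"
      by simp
    moreover have "of_real (Re ?z) = (?z + cnj ?z) / 2" "of_real (Im ?z) = (?z - cnj ?z) / (2 * \<i>)"
      by (auto simp: complex_eq_iff)
    ultimately show ?thesis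
      by (simp add: cnj_four_exp field_simps)
  qed
  then show ?case by (simp only:) (intro trig_poly.intros)
next
  case (const c)
  then show ?case by (rule trig_poly_const)
next
  case (add f g)
  from add.IH show ?case unfolding of_real_add by (rule trig_poly.add)
next
  case (mult f g)
  from mult.IH show ?case unfolding of_real_mult by (rule trig_poly_mult)
qed

text \<open>The cutoff factor vanishes at the end points of the period, so that the function extends
  continuously to the circle.\<close>

lemma trig_poly_approx_cutoff:
  fixes u :: "real \<Rightarrow> complex"
  assumes "L > 0" and u: "continuous_on UNIV u" and R: "\<And>x. norm (u x) \<le> R" and "n \<ge> 0" and "\<epsilon> > 0"
  obtains p where "trig_poly L p"
    "\<And>x. x \<in> {0..<L} \<Longrightarrow> norm (min 1 (n * norm (four_exp L 1 x - 1)) *\<^sub>R u x - p x) < \<epsilon>"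
proof -
  \<comment> \<open>On the circle \<open>Arg2pi\<close> is discontinuous only at 1, where the cutoff
    forces \<open>V\<close> to tend to 0 because \<open>u\<close> is bounded.\<close>
  define V where "V z = min 1 (n * norm (z - 1)) *\<^sub>R u (L * Arg2pi z / (2 * pi))" for z
  have "continuous_on (sphere 0 1) V"
    unfolding continuous_on_eq_continuous_within
  proof
    fix z :: complex assume z: "z \<in> sphere 0 1"
    show "continuous (at z within sphere 0 1) V"
    proof (cases "z = 1")
      case False
      have "z \<notin> \<real>\<^sub>\<ge>\<^sub>0"
        using z False by (auto simp: nonneg_Reals_def)
      then have "isCont (\<lambda>z. L * Arg2pi z / (2 * pi)) z"
        using continuous_at_Arg2pi [of z] by (intro continuous_intros) auto
      moreover have "isCont u x" for x
        using u by (simp add: continuous_on_eq_continuous_at)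
      ultimately have "isCont (\<lambda>z. u (L * Arg2pi z / (2 * pi))) z"
        by (rule isCont_o2)
      then have "isCont V z"
        unfolding V_def by (intro continuous_intros)
      then show ?thesis by (rule continuous_at_imp_continuous_within)
    next
      case True
      have "(V \<longlongrightarrow> 0) (at 1)"
      proof (rule Lim_null_comparison)
        show "\<forall>\<^sub>F z in at 1. norm (V z) \<le> n * norm (z - 1) * R"
        proof (intro always_eventually allI)
          fix z
          have "norm (V z) = min 1 (n * norm (z - 1)) * norm (u (L * Arg2pi z / (2 * pi)))"
            using \<open>n \<ge> 0\<close> by (simp add: V_def)
          also have "\<dots> \<le> n * norm (z - 1) * R"
            using \<open>n \<ge> 0\<close> by (intro mult_mono R) auto
          finally show "norm (V z) \<le> n * norm (z - 1) * R" .
        qed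
        have "((\<lambda>z. n * norm (z - 1 :: complex) * R) \<longlongrightarrow> n * norm (1 - 1 :: complex) * R) (at 1)"
          by (intro tendsto_intros)
        then show "((\<lambda>z. n * norm (z - 1 :: complex) * R) \<longlongrightarrow> 0) (at 1)" by simp
      qed
      moreover have "V 1 = 0" by (simp add: V_def)
      ultimately have "isCont V 1" by (simp add: isCont_def)
      then show ?thesis using True by (auto intro: continuous_at_imp_continuous_within)
    qed
  qed
  then obtain q where q: "polynomial_function q" "\<And>z. z \<in> sphere 0 1 \<Longrightarrow> norm (V z - q z) < \<epsilon>"
    using Stone_Weierstrass_polynomial_function [of "sphere 0 1" V \<epsilon>] \<open>\<epsilon> > 0\<close> by auto
  let ?p = "\<lambda>x. of_real (Re (q (four_exp L 1 x))) + \<i> * of_real (Im (q (four_exp L 1 x)))"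
  have "real_polynomial_function (\<lambda>z. Re (q z))" "real_polynomial_function (\<lambda>z. Im (q z))"
    using q(1) bounded_linear_Re bounded_linear_Im unfolding polynomial_function_def comp_def by auto
  then have "trig_poly L ?p"
    by (intro trig_poly.add trig_poly_mult [OF trig_poly_const] trig_poly_real_polynomial)
  moreover have "norm (min 1 (n * norm (four_exp L 1 x - 1)) *\<^sub>R u x - ?p x) < \<epsilon>" if x: "x \<in> {0..<L}" for x
  proof -
    have "Arg2pi (four_exp L 1 x) = 2 * pi * x / L"
      using x \<open>L > 0\<close> by (intro Arg2pi_unique [of 1]) (auto simp: four_exp_def field_simps)
    then have "V (four_exp L 1 x) = min 1 (n * norm (four_exp L 1 x - 1)) *\<^sub>R u x"
      using \<open>L > 0\<close> by (simp add: V_def)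
    moreover have "?p x = q (four_exp L 1 x)"
      by (metis complex_eq)
    ultimately show ?thesis using q(2) [of "four_exp L 1 x"] by simp
  qed
  ultimately show thesis by (rule that)
qed

section \<open>Density of trigonometric polynomials in the square mean\<close>

definition cclamp :: "real \<Rightarrow> complex \<Rightarrow> complex" where
  "cclamp R z = Complex (max (- R) (min R (Re z))) (max (- R) (min R (Im z)))"

lemma cclamp_bounds:
  assumes "R \<ge> 0"
  shows "norm (cclamp R z) \<le> 2 * R" "norm (cclamp R z) \<le> norm z"
proof -
  have "norm (cclamp R z) \<le> \<bar>Re (cclamp R z)\<bar> + \<bar>Im (cclamp R z)\<bar>" by (rule cmod_le)
  also have "\<dots> \<le> R + R" using assms by (intro add_mono) (auto simp: cclamp_def)
  finally show "norm (cclamp R z) \<le> 2 * R" by simp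
  have "(max (- R) (min R t))\<^sup>2 \<le> t\<^sup>2" for t
    using assms by (intro abs_le_square_iff [THEN iffD1]) auto
  then show "norm (cclamp R z) \<le> norm z"
    unfolding norm_complex_def by (intro real_sqrt_le_mono add_mono) (auto simp: cclamp_def)
qed

lemma continuous_on_cclamp: "continuous_on A (cclamp R)"
  unfolding cclamp_def by (intro continuous_on_Complex continuous_intros)

lemma cclamp_eq: "norm z \<le> R \<Longrightarrow> cclamp R z = z"
  using abs_Re_le_cmod [of z] abs_Im_le_cmod [of z] by (auto simp: cclamp_def complex_eq_iff)

lemma norm_add3_sq: "(norm (a + b + c))\<^sup>2 \<le> 3 * ((norm a)\<^sup>2 + (norm b)\<^sup>2 + (norm (c::complex))\<^sup>2)"
proof -
  have "norm (a + b + c) \<le> norm a + norm b + norm c"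
    using norm_triangle_ineq [of "a + b" c] norm_triangle_ineq [of a b] by linarith
  then have "(norm (a + b + c))\<^sup>2 \<le> (norm a + norm b + norm c)\<^sup>2" by (rule power_mono) simp
  also have "\<dots> \<le> 3 * ((norm a)\<^sup>2 + (norm b)\<^sup>2 + (norm c)\<^sup>2)"
    using sum_squares_ge_zero [of "norm a - norm b" "norm b - norm c"] zero_le_power2 [of "norm a - norm c"]
    by (simp add: power2_eq_square algebra_simps)
  finally show ?thesis .
qed

text \<open>Three approximations: truncation of the values, an a.e. limit of continuous functions
  multiplied by the cutoff at the end point of the period, and a uniformly close trigonometric
  polynomial. Truncation supplies the constant majorant that dominated convergence needs in the
  second one.\<close>

lemma trig_poly_dense:
  fixes h :: "real \<Rightarrow> complex"
  assumes "L > 0" and [measurable]: "h \<in> borel_measurable borel"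
    and int: "integrable (per L) (\<lambda>x. (norm (h x))\<^sup>2)" and "\<epsilon> > 0"
  shows "\<exists>p. trig_poly L p \<and> (LINT x|per L. (norm (h x - p x))\<^sup>2) < \<epsilon>"
proof -
  interpret P: finite_measure "per L" by (rule finite_measure_per)
  have m1: "f \<in> borel_measurable (per L)" if "f \<in> borel_measurable borel" for f :: "real \<Rightarrow> 'b::topological_space"
    using that by (intro measurable_restrict_space1) simp
  have [measurable]: "cclamp R \<in> borel_measurable borel" for R
    by (rule borel_measurable_continuous_onI [OF continuous_on_cclamp])
  have "(\<lambda>n. LINT x|per L. (norm (h x - cclamp (real n) (h x)))\<^sup>2) \<longlonglongrightarrow> (LINT x|per L. 0)"
  proof (rule integral_dominated_convergence [where w = "\<lambda>x. 4 * (norm (h x))\<^sup>2"])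
    show "integrable (per L) (\<lambda>x. 4 * (norm (h x))\<^sup>2)" using int by simp
    show "AE x in per L. (\<lambda>n. (norm (h x - cclamp (real n) (h x)))\<^sup>2) \<longlonglongrightarrow> 0"
    proof (intro AE_I2 tendsto_eventually)
      fix x
      show "\<forall>\<^sub>F n in sequentially. (norm (h x - cclamp (real n) (h x)))\<^sup>2 = 0"
        using eventually_ge_at_top [of "nat \<lceil>norm (h x)\<rceil>"]
        by eventually_elim (simp add: cclamp_eq real_nat_ceiling_ge nat_ceiling_le_eq)
    qed
    show "AE x in per L. norm ((norm (h x - cclamp (real n) (h x)))\<^sup>2) \<le> 4 * (norm (h x))\<^sup>2" for n
    proof (intro AE_I2)
      fix x
      have "norm (h x - cclamp (real n) (h x)) \<le> 2 * norm (h x)"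
        using norm_triangle_ineq4 [of "h x" "cclamp (real n) (h x)"] cclamp_bounds(2) [of "real n" "h x"] by simp
      then have "(norm (h x - cclamp (real n) (h x)))\<^sup>2 \<le> (2 * norm (h x))\<^sup>2" by (rule power_mono) simp
      then show "norm ((norm (h x - cclamp (real n) (h x)))\<^sup>2) \<le> 4 * (norm (h x))\<^sup>2"
        by (simp add: power_mult_distrib)
    qed
  qed (auto intro!: m1)
  then have "(\<lambda>n. LINT x|per L. (norm (h x - cclamp (real n) (h x)))\<^sup>2) \<longlonglongrightarrow> 0" by simp
  \<comment> \<open>Each of the three mean square errors gets \<open>\<epsilon> / 9\<close>, since
    \<open>norm_add3_sq\<close> costs a factor 3.\<close>
  then have "\<forall>\<^sub>F n in sequentially. (LINT x|per L. (norm (h x - cclamp (real n) (h x)))\<^sup>2) < \<epsilon> / 9"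
    by (rule order_tendstoD(2)) (use \<open>\<epsilon> > 0\<close> in simp)
  then obtain m where "(LINT x|per L. (norm (h x - cclamp (real m) (h x)))\<^sup>2) < \<epsilon> / 9"
    by (auto simp: eventually_sequentially)
  then obtain R where R: "R \<ge> 0" "(LINT x|per L. (norm (h x - cclamp R (h x)))\<^sup>2) < \<epsilon> / 9"
    using of_nat_0_le_iff by blast
  have "h measurable_on UNIV"
    by (rule lebesgue_measurable_imp_measurable_on) (auto intro: measurable_completion)
  then obtain N G where N: "negligible N" and G: "\<And>n. continuous_on UNIV (G n)"
    and lim: "\<And>x. x \<notin> N \<Longrightarrow> (\<lambda>n. G n x) \<longlonglongrightarrow> h x"
    by (auto simp: measurable_on_def)
  \<comment> \<open>Cutoff and approximation share the index \<open>n\<close>: at every point of the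
    period other than 0 the cutoff is eventually 1, so it does not affect the a.e. limit.\<close>
  define k where "k n x = min 1 (real n * norm (four_exp L 1 x - 1)) *\<^sub>R cclamp R (G n x)" for n x
  have contG: "continuous_on UNIV (\<lambda>x. cclamp R (G n x))" for n
    by (rule continuous_on_compose2 [OF continuous_on_cclamp G]) auto
  have [measurable]: "k n \<in> borel_measurable borel" for n
    unfolding k_def
    by (intro borel_measurable_continuous_onI continuous_intros contG continuous_on_four_exp)
  have "AE x in lebesgue. x \<notin> N"
    using N by (intro AE_not_in) (simp add: negligible_iff_null_sets)
  then have "AE x in lborel. x \<notin> N"
    by (simp add: AE_completion_iff)
  then have AEN: "AE x in lborel. x \<notin> N \<and> x \<noteq> 0"
    using AE_lborel_singleton [of 0] by auto
  have k_bound: "norm (k n x) \<le> 2 * R" for n x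
  proof -
    have "norm (k n x) = min 1 (real n * norm (four_exp L 1 x - 1)) * norm (cclamp R (G n x))"
      by (simp add: k_def)
    also have "\<dots> \<le> 1 * (2 * R)"
      using R by (intro mult_mono cclamp_bounds) auto
    finally show ?thesis by simp
  qed
  have "(\<lambda>n. LINT x|per L. (norm (cclamp R (h x) - k n x))\<^sup>2) \<longlonglongrightarrow> (LINT x|per L. 0)"
  proof (rule integral_dominated_convergence [where w = "\<lambda>x. (4 * R)\<^sup>2"])
    show "AE x in per L. (\<lambda>n. (norm (cclamp R (h x) - k n x))\<^sup>2) \<longlonglongrightarrow> 0"
    proof (subst AE_restrict_space_iff, simp, use AEN in eventually_elim, rule impI)
      fix x assume x: "x \<in> {0..<L}" and xN: "x \<notin> N \<and> x \<noteq> 0"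
      have "norm (four_exp L 1 x - 1) > 0"
      proof -
        have "four_exp L 1 x \<noteq> 1"
        proof
          assume "four_exp L 1 x = 1"
          then obtain i :: int where i: "2 * pi * x / L = of_int (2 * i) * pi"
            by (auto simp: four_exp_def exp_eq_1)
          then have "x = of_int i * L" using \<open>L > 0\<close> by (simp add: field_simps)
          with x xN \<open>L > 0\<close> have "0 < i" "i < 1" by (auto simp: zero_le_mult_iff)
          then show False by simp
        qed
        then show ?thesis by simp
      qed
      then obtain n0 where n0: "real n0 * norm (four_exp L 1 x - 1) > 1"
        using ex_less_of_nat_mult by blast
      have "\<forall>\<^sub>F n in sequentially. k n x = cclamp R (G n x)"
        using eventually_ge_at_top [of n0]
      proof eventually_elim
        case (elim n)
        then have "real n0 * norm (four_exp L 1 x - 1) \<le> real n * norm (four_exp L 1 x - 1)"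
          by (intro mult_right_mono) auto
        with n0 show ?case by (simp add: k_def)
      qed
      moreover have "(\<lambda>n. cclamp R (G n x)) \<longlonglongrightarrow> cclamp R (h x)"
        using xN by (intro continuous_on_tendsto_compose [OF continuous_on_cclamp [of UNIV]] lim) auto
      ultimately have kl: "(\<lambda>n. k n x) \<longlonglongrightarrow> cclamp R (h x)"
        by (simp add: tendsto_cong)
      have "(\<lambda>n. (norm (cclamp R (h x) - k n x))\<^sup>2) \<longlonglongrightarrow> (norm (cclamp R (h x) - cclamp R (h x)))\<^sup>2"
        by (intro tendsto_intros kl)
      then show "(\<lambda>n. (norm (cclamp R (h x) - k n x))\<^sup>2) \<longlonglongrightarrow> 0" by simp
    qed
    show "AE x in per L. norm ((norm (cclamp R (h x) - k n x))\<^sup>2) \<le> (4 * R)\<^sup>2" for n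
    proof (intro AE_I2)
      fix x
      have "norm (cclamp R (h x) - k n x) \<le> 4 * R"
        using norm_triangle_ineq4 [of "cclamp R (h x)" "k n x"] cclamp_bounds(1) [OF R(1), of "h x"] k_bound [of n x]
        by simp
      then have "(norm (cclamp R (h x) - k n x))\<^sup>2 \<le> (4 * R)\<^sup>2" by (rule power_mono) simp
      then show "norm ((norm (cclamp R (h x) - k n x))\<^sup>2) \<le> (4 * R)\<^sup>2" by simp
    qed
  qed (auto intro!: m1)
  then have "(\<lambda>n. LINT x|per L. (norm (cclamp R (h x) - k n x))\<^sup>2) \<longlonglongrightarrow> 0" by simp
  then have "\<forall>\<^sub>F n in sequentially. (LINT x|per L. (norm (cclamp R (h x) - k n x))\<^sup>2) < \<epsilon> / 9"
    by (rule order_tendstoD(2)) (use \<open>\<epsilon> > 0\<close> in simp)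
  then obtain n where n: "(LINT x|per L. (norm (cclamp R (h x) - k n x))\<^sup>2) < \<epsilon> / 9"
    by (auto simp: eventually_sequentially)
  \<comment> \<open>Chosen so that a uniform error \<open>\<eta>\<close> has mean square
    \<open>\<eta>\<^sup>2 * L = \<epsilon> / 9\<close> over the period.\<close>
  define \<eta> where "\<eta> = sqrt (\<epsilon> / (9 * L))"
  have "\<eta> > 0" using \<open>\<epsilon> > 0\<close> \<open>L > 0\<close> by (simp add: \<eta>_def)
  have "norm (cclamp R (G n x)) \<le> 2 * R" for x using R by (intro cclamp_bounds)
  then obtain p where p: "trig_poly L p" "\<And>x. x \<in> {0..<L} \<Longrightarrow> norm (k n x - p x) < \<eta>"
    unfolding k_def
    using trig_poly_approx_cutoff [OF \<open>L > 0\<close> contG, of n "2 * R" "real n" \<eta>] \<open>\<eta> > 0\<close> by (metis of_nat_0_le_iff)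
  have [measurable]: "p \<in> borel_measurable borel"
  proof -
    obtain A c where p_eq: "p = (\<lambda>x. \<Sum>l\<in>A. c l * four_exp L l x)"
      using trig_poly_finite_sum [OF p(1)] by blast
    show ?thesis unfolding p_eq by measurable
  qed
  have i1: "integrable (per L) (\<lambda>x. (norm (h x - cclamp R (h x)))\<^sup>2)"
  proof (rule Bochner_Integration.integrable_bound)
    show "integrable (per L) (\<lambda>x. 4 * (norm (h x))\<^sup>2)" using int by simp
    show "AE x in per L. norm ((norm (h x - cclamp R (h x)))\<^sup>2) \<le> norm (4 * (norm (h x))\<^sup>2)"
    proof (intro AE_I2)
      fix x
      have "norm (h x - cclamp R (h x)) \<le> 2 * norm (h x)"
        using norm_triangle_ineq4 [of "h x" "cclamp R (h x)"] cclamp_bounds(2) [OF R(1), of "h x"] by simp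
      then have "(norm (h x - cclamp R (h x)))\<^sup>2 \<le> (2 * norm (h x))\<^sup>2" by (rule power_mono) simp
      then show "norm ((norm (h x - cclamp R (h x)))\<^sup>2) \<le> norm (4 * (norm (h x))\<^sup>2)"
        by (simp add: power_mult_distrib)
    qed
  qed (auto intro!: m1)
  have i2: "integrable (per L) (\<lambda>x. (norm (cclamp R (h x) - k n x))\<^sup>2)"
  proof (rule P.integrable_const_bound [where B = "(4 * R)\<^sup>2"])
    show "AE x in per L. norm ((norm (cclamp R (h x) - k n x))\<^sup>2) \<le> (4 * R)\<^sup>2"
    proof (intro AE_I2)
      fix x
      have "norm (cclamp R (h x) - k n x) \<le> 4 * R"
        using norm_triangle_ineq4 [of "cclamp R (h x)" "k n x"] cclamp_bounds(1) [OF R(1), of "h x"] k_bound [of n x]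
        by simp
      then have "(norm (cclamp R (h x) - k n x))\<^sup>2 \<le> (4 * R)\<^sup>2" by (rule power_mono) simp
      then show "norm ((norm (cclamp R (h x) - k n x))\<^sup>2) \<le> (4 * R)\<^sup>2" by simp
    qed
  qed (auto intro!: m1)
  have i3: "integrable (per L) (\<lambda>x. (norm (k n x - p x))\<^sup>2)"
    using p(2) by (intro P.integrable_const_bound [where B = "\<eta>\<^sup>2"] AE_I2 m1)
      (auto simp: space_restrict_space power_mono less_imp_le)
  have "(LINT x|per L. (norm (h x - p x))\<^sup>2)
     \<le> (LINT x|per L. 3 * ((norm (h x - cclamp R (h x)))\<^sup>2 + (norm (cclamp R (h x) - k n x))\<^sup>2 + (norm (k n x - p x))\<^sup>2))"
  proof (rule integral_mono')
    show "integrable (per L) (\<lambda>x. 3 * ((norm (h x - cclamp R (h x)))\<^sup>2 + (norm (cclamp R (h x) - k n x))\<^sup>2 + (norm (k n x - p x))\<^sup>2))"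
      by (intro integrable_mult_right Bochner_Integration.integrable_add i1 i2 i3)
    fix x
    show "(norm (h x - p x))\<^sup>2 \<le> 3 * ((norm (h x - cclamp R (h x)))\<^sup>2 + (norm (cclamp R (h x) - k n x))\<^sup>2 + (norm (k n x - p x))\<^sup>2)"
      using norm_add3_sq [of "h x - cclamp R (h x)" "cclamp R (h x) - k n x" "k n x - p x"] by simp
  qed simp
  also have "\<dots> = 3 * ((LINT x|per L. (norm (h x - cclamp R (h x)))\<^sup>2) + (LINT x|per L. (norm (cclamp R (h x) - k n x))\<^sup>2)
      + (LINT x|per L. (norm (k n x - p x))\<^sup>2))"
    using i1 i2 i3 by simp
  also have "(LINT x|per L. (norm (k n x - p x))\<^sup>2) \<le> (LINT x|per L. \<eta>\<^sup>2)"
    using p(2) i3 by (intro integral_mono) (auto simp: space_restrict_space power_mono less_imp_le)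
  also have "(LINT x|per L. \<eta>\<^sup>2) = \<epsilon> / 9"
    using \<open>L > 0\<close> \<open>\<epsilon> > 0\<close> by (simp add: \<eta>_def measure_restrict_space space_restrict_space)
  finally have "(LINT x|per L. (norm (h x - p x))\<^sup>2) < \<epsilon>" using R(2) n by simp
  with p(1) show ?thesis by blast
qed

section \<open>Bessel's inequality and Parseval's identity\<close>

lemma nn_integral_int_sum_bound:
  assumes "\<And>A. finite A \<Longrightarrow> (\<Sum>j\<in>A. f j) \<le> B"
  shows "(\<integral>\<^sup>+j. f j \<partial>int_count) \<le> B"
proof -
  have fin: "(\<integral>\<^sup>+j. f j * indicator {- int n..int n} j \<partial>int_count) = (\<Sum>j\<in>{- int n..int n}. f j)" for n
    by (subst nn_integral_count_space_indicator [symmetric]) (simp_all add: nn_integral_count_space_finite)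
  have "(\<integral>\<^sup>+j. f j \<partial>int_count) = (\<integral>\<^sup>+j. (SUP n. f j * indicator {- int n..int n} j) \<partial>int_count)"
  proof (rule nn_integral_cong)
    fix j :: int
    show "f j = (SUP n. f j * indicator {- int n..int n} j)"
    proof (rule antisym)
      have "j \<in> {- int (nat \<bar>j\<bar>)..int (nat \<bar>j\<bar>)}" by auto
      then have "f j = f j * indicator {- int (nat \<bar>j\<bar>)..int (nat \<bar>j\<bar>)} j"
        by (simp del: atLeastAtMost_iff)
      also have "\<dots> \<le> (SUP n. f j * indicator {- int n..int n} j)"
        by (rule SUP_upper) simp
      finally show "f j \<le> (SUP n. f j * indicator {- int n..int n} j)" .
      show "(SUP n. f j * indicator {- int n..int n} j) \<le> f j"
        by (rule SUP_least) (simp add: indicator_def)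
    qed
  qed
  also have "\<dots> = (SUP n. \<integral>\<^sup>+j. f j * indicator {- int n..int n} j \<partial>int_count)"
    by (rule nn_integral_monotone_convergence_SUP)
      (auto simp: incseq_def le_fun_def indicator_def intro!: mult_left_mono)
  also have "\<dots> \<le> B"
    unfolding fin using assms by (intro SUP_least) auto
  finally show ?thesis .
qed

lemma sum_le_nn_integral_int:
  assumes "finite A"
  shows "(\<Sum>j\<in>A. f j) \<le> (\<integral>\<^sup>+j. f j \<partial>int_count)"
proof -
  have "(\<Sum>j\<in>A. f j) = (\<integral>\<^sup>+j. f j * indicator A j \<partial>int_count)"
    using assms by (subst nn_integral_count_space_indicator [symmetric]) (simp_all add: nn_integral_count_space_finite)
  also have "\<dots> \<le> (\<integral>\<^sup>+j. f j \<partial>int_count)"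
    by (intro nn_integral_mono) (simp add: indicator_def)
  finally show ?thesis .
qed

lemma integrable_of_square_per:
  assumes [measurable]: "h \<in> borel_measurable borel"
    and int: "integrable (per L) (\<lambda>x. (norm (h x :: complex))\<^sup>2)"
  shows "integrable (per L) h"
proof (rule Bochner_Integration.integrable_bound)
  interpret P: finite_measure "per L" by (rule finite_measure_per)
  show "integrable (per L) (\<lambda>x. 1 + (norm (h x))\<^sup>2)"
    by (intro Bochner_Integration.integrable_add int) auto
  show "AE x in per L. norm (h x) \<le> norm (1 + (norm (h x))\<^sup>2)"
  proof (intro AE_I2)
    fix x
    have "0 \<le> (norm (h x) - 1)\<^sup>2" by simp
    then have "2 * norm (h x) \<le> 1 + (norm (h x))\<^sup>2" by (simp add: power2_diff)
    moreover have "norm (h x) \<ge> 0" by simp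
    ultimately have "norm (h x) \<le> 1 + (norm (h x))\<^sup>2" by linarith
    then show "norm (h x) \<le> norm (1 + (norm (h x))\<^sup>2)" by simp
  qed
  show "h \<in> borel_measurable (per L)"
    by (intro measurable_restrict_space1) simp
qed

context
  fixes L :: real and h :: "real \<Rightarrow> complex"
  assumes L: "L > 0" and h [measurable]: "h \<in> borel_measurable borel"
    and int: "integrable (per L) (\<lambda>x. (norm (h x))\<^sup>2)"
begin

definition four_coeff :: "int \<Rightarrow> complex" where
  "four_coeff l = (LINT x|per L. h x * cnj (four_exp L l x))"

lemma integrable_four_coeff: "integrable (per L) (\<lambda>x. h x * cnj (four_exp L l x))"
proof (rule Bochner_Integration.integrable_bound [OF integrable_of_square_per [OF h int]])
  have "(\<lambda>x. h x * cnj (four_exp L l x)) \<in> borel_measurable borel"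
    unfolding cnj_four_exp by measurable
  then show "(\<lambda>x. h x * cnj (four_exp L l x)) \<in> borel_measurable (per L)"
    by (intro measurable_restrict_space1) simp
qed (simp add: norm_mult)

text \<open>Completing the square in the coefficients; the factor \<open>L\<close> is the squared
  norm of the unnormalised characters. With \<open>p l = four_coeff l / L\<close> the last sum
  vanishes and Bessel's inequality follows; dropping that sum bounds the Bessel defect by any
  approximation error.\<close>

lemma best_approx:
  assumes A: "finite A"
  shows "L * (LINT x|per L. (norm (h x - (\<Sum>l\<in>A. p l * four_exp L l x)))\<^sup>2)
    = L * (LINT x|per L. (norm (h x))\<^sup>2) - (\<Sum>l\<in>A. (norm (four_coeff l))\<^sup>2)
      + (\<Sum>l\<in>A. (norm (four_coeff l - of_real L * p l))\<^sup>2)"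
proof -
  let ?p = "\<lambda>x. \<Sum>l\<in>A. p l * four_exp L l x"
  interpret P: finite_measure "per L" by (rule finite_measure_per)
  have int_hh: "integrable (per L) (\<lambda>x. h x * cnj (h x))"
    using int by (simp only: complex_norm_square [symmetric] complex_of_real_integrable_eq)
  have int_e: "integrable (per L) (four_exp L l)" for l
    by (rule P.integrable_const_bound [where B = 1]) (auto intro: measurable_restrict_space1)
  have expand: "of_real ((norm (h x - ?p x))\<^sup>2) = h x * cnj (h x)
      - (\<Sum>l\<in>A. cnj (p l) * (h x * cnj (four_exp L l x)))
      - (\<Sum>l\<in>A. p l * cnj (h x * cnj (four_exp L l x)))
      + (\<Sum>l\<in>A. \<Sum>m\<in>A. (p l * cnj (p m)) * four_exp L (l - m) x)" for x
  proof -
    have "of_real ((norm (h x - ?p x))\<^sup>2) = (h x - ?p x) * cnj (h x - ?p x)"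
      by (rule complex_norm_square)
    also have "\<dots> = h x * cnj (h x) - h x * cnj (?p x) - ?p x * cnj (h x) + ?p x * cnj (?p x)"
      by (simp add: algebra_simps)
    also have "h x * cnj (?p x) = (\<Sum>l\<in>A. cnj (p l) * (h x * cnj (four_exp L l x)))"
      by (simp add: cnj_sum sum_distrib_left mult_ac)
    also have "?p x * cnj (h x) = (\<Sum>l\<in>A. p l * cnj (h x * cnj (four_exp L l x)))"
      by (simp add: sum_distrib_left mult_ac)
    also have "?p x * cnj (?p x) = (\<Sum>l\<in>A. \<Sum>m\<in>A. (p l * cnj (p m)) * four_exp L (l - m) x)"
    proof -
      have "p l * four_exp L l x * cnj (p m * four_exp L m x) = (p l * cnj (p m)) * four_exp L (l - m) x" for l m
        using four_exp_mult [of L l x "- m"] by (simp add: cnj_four_exp mult_ac)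
      then show ?thesis by (simp only: cnj_sum sum_product)
    qed
    finally show ?thesis .
  qed
  have "complex_of_real (LINT x|per L. (norm (h x - ?p x))\<^sup>2) = (LINT x|per L. of_real ((norm (h x - ?p x))\<^sup>2))"
    by (rule integral_complex_of_real [symmetric])
  also have "\<dots> = (LINT x|per L. h x * cnj (h x))
      - (\<Sum>l\<in>A. cnj (p l) * four_coeff l)
      - (\<Sum>l\<in>A. p l * cnj (four_coeff l))
      + (\<Sum>l\<in>A. \<Sum>m\<in>A. (p l * cnj (p m)) * (if l - m = 0 then of_real L else 0))"
    unfolding expand four_coeff_def integral_four_exp [OF L, symmetric] Bochner_Integration.integral_cnj [symmetric]
      integral_mult_right_zero [symmetric]
    by (subst Bochner_Integration.integral_add Bochner_Integration.integral_diff Bochner_Integration.integral_sum;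
        (intro Bochner_Integration.integrable_add Bochner_Integration.integrable_diff Bochner_Integration.integrable_sum
          integrable_mult_right integrable_cnj int_hh integrable_four_coeff int_e)?)+
      (simp only: integral_mult_right_zero Bochner_Integration.integral_cnj)
  also have "(LINT x|per L. h x * cnj (h x)) = of_real (LINT x|per L. (norm (h x))\<^sup>2)"
    by (simp only: complex_norm_square [symmetric] integral_complex_of_real)
  also have "(\<Sum>l\<in>A. \<Sum>m\<in>A. (p l * cnj (p m)) * (if l - m = 0 then of_real L else 0)) = (\<Sum>l\<in>A. p l * cnj (p l) * of_real L)"
  proof (rule sum.cong [OF refl])
    fix l assume "l \<in> A"
    have "(\<Sum>m\<in>A. (p l * cnj (p m)) * (if l - m = 0 then of_real L else 0)) = (\<Sum>m\<in>A. if l = m then p l * cnj (p m) * of_real L else 0)"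
      by (intro sum.cong) auto
    then show "(\<Sum>m\<in>A. (p l * cnj (p m)) * (if l - m = 0 then of_real L else 0)) = p l * cnj (p l) * of_real L"
      using A \<open>l \<in> A\<close> by simp
  qed
  finally have "complex_of_real (L * (LINT x|per L. (norm (h x - ?p x))\<^sup>2))
     = of_real L * (of_real (LINT x|per L. (norm (h x))\<^sup>2) - (\<Sum>l\<in>A. cnj (p l) * four_coeff l)
      - (\<Sum>l\<in>A. p l * cnj (four_coeff l)) + (\<Sum>l\<in>A. p l * cnj (p l) * of_real L))"
    by simp
  also have "\<dots> = of_real (L * (LINT x|per L. (norm (h x))\<^sup>2))
     + (\<Sum>l\<in>A. - (of_real L * (cnj (p l) * four_coeff l)) - of_real L * (p l * cnj (four_coeff l)) + of_real L * (p l * cnj (p l) * of_real L))"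
    by (simp add: sum.distrib sum_subtractf sum_negf sum_distrib_left algebra_simps)
  also have "(\<Sum>l\<in>A. - (of_real L * (cnj (p l) * four_coeff l)) - of_real L * (p l * cnj (four_coeff l)) + of_real L * (p l * cnj (p l) * of_real L))
     = (\<Sum>l\<in>A. of_real (- (norm (four_coeff l))\<^sup>2 + (norm (four_coeff l - of_real L * p l))\<^sup>2))"
    unfolding of_real_add of_real_minus complex_norm_square by (intro sum.cong) (auto simp: algebra_simps)
  also have "of_real (L * (LINT x|per L. (norm (h x))\<^sup>2)) + \<dots>
     = complex_of_real (L * (LINT x|per L. (norm (h x))\<^sup>2) - (\<Sum>l\<in>A. (norm (four_coeff l))\<^sup>2)
      + (\<Sum>l\<in>A. (norm (four_coeff l - of_real L * p l))\<^sup>2))"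
    by (simp add: sum.distrib sum_negf sum_subtractf)
  finally show ?thesis by (simp only: of_real_eq_iff)
qed

text \<open>Bessel's inequality holds for every finite index set. Conversely, a dense trigonometric
  polynomial makes the defect arbitrarily small by \<open>best_approx\<close>.\<close>

lemma parseval_aux:
  "(\<integral>\<^sup>+l. ennreal ((norm (four_coeff l))\<^sup>2) \<partial>int_count) = ennreal (L * (LINT x|per L. (norm (h x))\<^sup>2))"
proof (rule antisym)
  show "(\<integral>\<^sup>+l. ennreal ((norm (four_coeff l))\<^sup>2) \<partial>int_count) \<le> ennreal (L * (LINT x|per L. (norm (h x))\<^sup>2))"
  proof (rule nn_integral_int_sum_bound)
    fix A :: "int set" assume A: "finite A"
    have "0 \<le> L * (LINT x|per L. (norm (h x - (\<Sum>l\<in>A. four_coeff l / of_real L * four_exp L l x)))\<^sup>2)"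
      using L by (intro mult_nonneg_nonneg integral_nonneg_AE) auto
    also have "\<dots> = L * (LINT x|per L. (norm (h x))\<^sup>2) - (\<Sum>l\<in>A. (norm (four_coeff l))\<^sup>2)"
      using best_approx [OF A, of "\<lambda>l. four_coeff l / of_real L"] L by simp
    finally show "(\<Sum>l\<in>A. ennreal ((norm (four_coeff l))\<^sup>2)) \<le> ennreal (L * (LINT x|per L. (norm (h x))\<^sup>2))"
      by (subst sum_ennreal) (auto intro: ennreal_leI)
  qed
  show "ennreal (L * (LINT x|per L. (norm (h x))\<^sup>2)) \<le> (\<integral>\<^sup>+l. ennreal ((norm (four_coeff l))\<^sup>2) \<partial>int_count)"
  proof (rule ennreal_le_epsilon)
    fix e :: real assume "e > 0"
    then obtain q where q: "trig_poly L q" "(LINT x|per L. (norm (h x - q x))\<^sup>2) < e / L"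
      using trig_poly_dense [OF L h int, of "e / L"] L by auto
    obtain A p where A: "finite A" "q = (\<lambda>x. \<Sum>l\<in>A. p l * four_exp L l x)"
      using trig_poly_finite_sum [OF q(1)] by blast
    have "L * (LINT x|per L. (norm (h x))\<^sup>2) - (\<Sum>l\<in>A. (norm (four_coeff l))\<^sup>2) \<le> L * (LINT x|per L. (norm (h x - q x))\<^sup>2)"
      unfolding A(2) best_approx [OF A(1)] by (simp add: sum_nonneg)
    also have "\<dots> \<le> e"
      using q(2) L by (simp add: field_simps)
    finally have "ennreal (L * (LINT x|per L. (norm (h x))\<^sup>2)) \<le> ennreal ((\<Sum>l\<in>A. (norm (four_coeff l))\<^sup>2) + e)"
      by (intro ennreal_leI) simp
    also have "\<dots> = (\<Sum>l\<in>A. ennreal ((norm (four_coeff l))\<^sup>2)) + ennreal e"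
      using \<open>e > 0\<close> by (subst ennreal_plus) (auto simp: sum_nonneg sum_ennreal)
    also have "\<dots> \<le> (\<integral>\<^sup>+l. ennreal ((norm (four_coeff l))\<^sup>2) \<partial>int_count) + ennreal e"
      by (intro add_right_mono sum_le_nn_integral_int A)
    finally show "ennreal (L * (LINT x|per L. (norm (h x))\<^sup>2))
        \<le> (\<integral>\<^sup>+l. ennreal ((norm (four_coeff l))\<^sup>2) \<partial>int_count) + ennreal e" .
  qed
qed

end

lemma parseval_per:
  assumes "L > 0" and [measurable]: "h \<in> borel_measurable borel"
    and fin: "(\<integral>\<^sup>+x. ennreal ((norm (h x :: complex))\<^sup>2) \<partial>per L) < \<infinity>"
  shows "(\<integral>\<^sup>+l. ennreal ((norm (LINT x|per L. h x * cnj (four_exp L l x)))\<^sup>2) \<partial>int_count)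
    = ennreal L * (\<integral>\<^sup>+x. ennreal ((norm (h x))\<^sup>2) \<partial>per L)"
proof -
  have m: "(\<lambda>x. (norm (h x))\<^sup>2) \<in> borel_measurable (per L)"
    by (intro measurable_restrict_space1) simp
  have int: "integrable (per L) (\<lambda>x. (norm (h x))\<^sup>2)"
    by (rule integrableI_nonneg [OF m _ fin]) simp
  show ?thesis
    using parseval_aux [OF assms(1,2) int] assms(1) nn_integral_eq_integral [OF int]
    by (simp add: four_coeff_def [OF assms(1,2) int] ennreal_mult)
qed

section \<open>Fiberization of the Gabor system\<close>

lemma measurable_int_count_pair:
  assumes "\<And>j. f j \<in> measurable N K"
  shows "(\<lambda>(x, j). f j x) \<in> measurable (N \<Otimes>\<^sub>M int_count) K"
proof -
  have "(\<lambda>(j, x). f j x) \<in> measurable (int_count \<Otimes>\<^sub>M N) K"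
    using assms by (intro measurable_pair_measure_countable1) auto
  from measurable_compose [OF measurable_pair_swap' this] show ?thesis
    by (simp add: case_prod_unfold)
qed

lemma measurable_integral_int_count:
  fixes f :: "int \<Rightarrow> 'b \<Rightarrow> 'a::{banach, second_countable_topology}"
  assumes "\<And>j. f j \<in> borel_measurable N"
  shows "(\<lambda>x. LINT j|int_count. f j x) \<in> borel_measurable N"
proof -
  interpret C: sigma_finite_measure int_count by (rule sigma_finite_int_count)
  show ?thesis
    using measurable_int_count_pair [OF assms] by (rule C.borel_measurable_lebesgue_integral)
qed

lemma measurable_nn_integral_int_count:
  assumes "\<And>j. f j \<in> borel_measurable N"
  shows "(\<lambda>x. \<integral>\<^sup>+j. f j x \<partial>int_count) \<in> borel_measurable N"
proof -
  interpret C: sigma_finite_measure int_count by (rule sigma_finite_int_count)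
  show ?thesis
    using measurable_int_count_pair [OF assms] by (rule C.borel_measurable_nn_integral)
qed

lemma period_translate_iff:
  assumes "(L::real) > 0"
  shows "x - of_int j * L \<in> {0..<L} \<longleftrightarrow> j = \<lfloor>x / L\<rfloor>"
  using assms by (auto simp: eq_commute [of j] floor_eq_iff le_divide_eq divide_less_eq algebra_simps)

lemma nn_integral_translate:
  fixes t :: real
  assumes [measurable]: "u \<in> borel_measurable borel"
  shows "(\<integral>\<^sup>+x. u (x + t) \<partial>lborel) = (\<integral>\<^sup>+x. u x \<partial>lborel)"
  using nn_integral_real_affine [of u 1 t] by (simp add: add.commute)

text \<open>Each real number lies in exactly one translate of the period, so after Tonelli and a
  translation the indicators sum to 1. The complex version below repeats this with Fubini.\<close>

lemma nn_integral_unfold_period: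
  assumes L: "(L::real) > 0" and [measurable]: "u \<in> borel_measurable borel"
  shows "(\<integral>\<^sup>+x. (\<integral>\<^sup>+j. u (x + of_int j * L) \<partial>int_count) \<partial>per L) = (\<integral>\<^sup>+x. u x \<partial>lborel)"
proof -
  have "(\<integral>\<^sup>+x. (\<integral>\<^sup>+j. u (x + of_int j * L) \<partial>int_count) \<partial>per L)
     = (\<integral>\<^sup>+x. (\<integral>\<^sup>+j. u (x + of_int j * L) \<partial>int_count) * indicator {0..<L} x \<partial>lborel)"
    by (subst nn_integral_restrict_space) auto
  also have "\<dots> = (\<integral>\<^sup>+x. (\<integral>\<^sup>+j. u (x + of_int j * L) * indicator {0..<L} x \<partial>int_count) \<partial>lborel)"
    by (intro nn_integral_cong nn_integral_multc [symmetric]) auto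
  also have "\<dots> = (\<integral>\<^sup>+j. (\<integral>\<^sup>+x. u (x + of_int j * L) * indicator {0..<L} x \<partial>lborel) \<partial>int_count)"
    by (rule nn_integral_int_swap [OF lborel.sigma_finite_measure_axioms, symmetric]) measurable
  also have "\<dots> = (\<integral>\<^sup>+j. (\<integral>\<^sup>+x. u x * indicator {0..<L} (x - of_int j * L) \<partial>lborel) \<partial>int_count)"
  proof (rule nn_integral_cong)
    fix j
    show "(\<integral>\<^sup>+x. u (x + of_int j * L) * indicator {0..<L} x \<partial>lborel)
        = (\<integral>\<^sup>+x. u x * indicator {0..<L} (x - of_int j * L) \<partial>lborel)"
      using nn_integral_translate [of "\<lambda>x. u x * indicator {0..<L} (x - of_int j * L)" "of_int j * L"] by simp
  qed
  also have "\<dots> = (\<integral>\<^sup>+x. (\<integral>\<^sup>+j. u x * indicator {0..<L} (x - of_int j * L) \<partial>int_count) \<partial>lborel)"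
    by (rule nn_integral_int_swap [OF lborel.sigma_finite_measure_axioms]) measurable
  also have "\<dots> = (\<integral>\<^sup>+x. u x \<partial>lborel)"
  proof (rule nn_integral_cong)
    fix x
    have "(\<integral>\<^sup>+j. u x * indicator {0..<L} (x - of_int j * L) \<partial>int_count)
        = (\<integral>\<^sup>+j. u x * indicator {\<lfloor>x / L\<rfloor>} j \<partial>int_count)"
      using period_translate_iff [OF L, of x] by (intro nn_integral_cong) (simp add: indicator_def)
    then show "(\<integral>\<^sup>+j. u x * indicator {0..<L} (x - of_int j * L) \<partial>int_count) = u x"
      by (simp add: nn_integral_cmult_indicator)
  qed
  finally show ?thesis .
qed

lemma integral_unfold_period:
  fixes u :: "real \<Rightarrow> complex"
  assumes L: "L > 0" and int: "integrable lborel u"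
  shows "(LINT x|per L. LINT j|int_count. u (x + of_int j * L)) = (LINT x|lborel. u x)"
proof -
  have [measurable]: "u \<in> borel_measurable borel" using int by auto
  define f where "f j x = indicator {0..<L} x *\<^sub>R u (x + of_int j * L)" for j x
  define f' where "f' j x = indicator {0..<L} (x - of_int j * L) *\<^sub>R u x" for j x
  have tr: "(\<integral>\<^sup>+x. ennreal (norm (f j x)) \<partial>lborel) = (\<integral>\<^sup>+x. ennreal (norm (f' j x)) \<partial>lborel)" for j
    using nn_integral_translate [of "\<lambda>x. ennreal (norm (f' j x))" "of_int j * L"]
    by (simp add: f_def f'_def)
  have "(\<integral>\<^sup>+j. (\<integral>\<^sup>+x. ennreal (norm (f j x)) \<partial>lborel) \<partial>int_count)
     = (\<integral>\<^sup>+x. (\<integral>\<^sup>+j. ennreal (norm (f j x)) \<partial>int_count) \<partial>lborel)"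
    unfolding f_def by (rule nn_integral_int_swap [OF lborel.sigma_finite_measure_axioms]) measurable
  also have "\<dots> = (\<integral>\<^sup>+x. (\<integral>\<^sup>+j. ennreal (norm (u (x + of_int j * L))) \<partial>int_count) * indicator {0..<L} x \<partial>lborel)"
    by (intro nn_integral_cong) (auto simp: f_def indicator_def)
  also have "\<dots> = (\<integral>\<^sup>+x. (\<integral>\<^sup>+j. ennreal (norm (u (x + of_int j * L))) \<partial>int_count) \<partial>per L)"
    by (subst nn_integral_restrict_space) auto
  also have "\<dots> = (\<integral>\<^sup>+x. ennreal (norm (u x)) \<partial>lborel)"
    by (rule nn_integral_unfold_period [OF L, of "\<lambda>x. ennreal (norm (u x))"]) measurable
  also have "\<dots> < \<infinity>" using int by (simp add: integrable_iff_bounded)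
  finally have fin: "(\<integral>\<^sup>+j. (\<integral>\<^sup>+x. ennreal (norm (f j x)) \<partial>lborel) \<partial>int_count) < \<infinity>" .
  have mf: "f j \<in> borel_measurable lborel" "f' j \<in> borel_measurable lborel" for j
    unfolding f_def f'_def by measurable
  have "(LINT x|per L. LINT j|int_count. u (x + of_int j * L)) = (LINT x|lborel. LINT j|int_count. f j x)"
    unfolding f_def by (subst integral_restrict_space) auto
  also have "\<dots> = (LINT j|int_count. LINT x|lborel. f j x)"
    by (rule int_sum_integral_swap(1) [OF lborel.sigma_finite_measure_axioms mf(1) fin, symmetric])
  also have "\<dots> = (LINT j|int_count. LINT x|lborel. f' j x)"
  proof (rule Bochner_Integration.integral_cong [OF refl])
    fix j
    show "(LINT x|lborel. f j x) = (LINT x|lborel. f' j x)"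
      using lborel_integral_real_affine [of 1 "f' j" "of_int j * L"]
      by (simp add: f_def f'_def add.commute)
  qed
  also have "\<dots> = (LINT x|lborel. LINT j|int_count. f' j x)"
    by (rule int_sum_integral_swap(1) [OF lborel.sigma_finite_measure_axioms mf(2)]) (use fin tr in simp)
  also have "\<dots> = (LINT x|lborel. u x)"
  proof (rule Bochner_Integration.integral_cong [OF refl])
    fix x
    have "(LINT j|int_count. f' j x) = (LINT j|int_count. indicator {\<lfloor>x / L\<rfloor>} j *\<^sub>R u x)"
      using period_translate_iff [OF L, of x] by (simp add: f'_def indicator_def)
    also have "\<dots> = u x" using integral_int_indicator [of "{\<lfloor>x / L\<rfloor>}" "\<lambda>_. u x"] by simp
    finally show "(LINT j|int_count. f' j x) = u x" .
  qed
  finally show ?thesis .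
qed

text \<open>Folding the line onto one period turns the integral of the majorant into that of a
  uniformly bounded sum over a set of finite measure.\<close>

lemma exp_decay_integrable:
  assumes "exp_decay g"
  shows "integrable lborel g"
proof (rule integrableI_bounded)
  obtain C a where *: "a > 0" "C > 0" "\<And>x. \<bar>g x\<bar> \<le> C * exp (- (a * \<bar>x\<bar>))" "continuous_on UNIV g"
    using exp_decayE [OF assms] by metis
  show "g \<in> borel_measurable lborel"
    using borel_measurable_continuous_onI [OF *(4)] by simp
  obtain K where K: "\<And>t. (\<integral>\<^sup>+j. ennreal (exp (- (a * \<bar>t + of_int j * 1\<bar>))) \<partial>int_count) \<le> ennreal K"
    using nn_integral_exp_abs_int_bound [OF *(1), of 1] by auto
  have "(\<integral>\<^sup>+x. ennreal (norm (g x)) \<partial>lborel) \<le> (\<integral>\<^sup>+x. ennreal C * ennreal (exp (- (a * \<bar>x\<bar>))) \<partial>lborel)"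
    using * by (intro nn_integral_mono) (simp add: ennreal_mult [symmetric] ennreal_leI)
  also have "\<dots> = ennreal C * (\<integral>\<^sup>+x. ennreal (exp (- (a * \<bar>x\<bar>))) \<partial>lborel)"
    by (rule nn_integral_cmult) simp
  also have "(\<integral>\<^sup>+x. ennreal (exp (- (a * \<bar>x\<bar>))) \<partial>lborel)
      = (\<integral>\<^sup>+x. (\<integral>\<^sup>+j. ennreal (exp (- (a * \<bar>x + of_int j * 1\<bar>))) \<partial>int_count) \<partial>per 1)"
    by (rule nn_integral_unfold_period [of 1 "\<lambda>x. ennreal (exp (- (a * \<bar>x\<bar>)))", symmetric]) simp_all
  also have "ennreal C * \<dots> \<le> ennreal C * (\<integral>\<^sup>+x. ennreal K \<partial>per 1)"
    by (intro mult_left_mono nn_integral_mono K) simp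
  also have "\<dots> < \<infinity>"
    by (simp add: emeasure_restrict_space space_restrict_space ennreal_mult_less_top)
  finally show "(\<integral>\<^sup>+x. ennreal (norm (g x)) \<partial>lborel) < \<infinity>" .
qed

lemma exp_decay_square:
  assumes "exp_decay g"
  shows "exp_decay (\<lambda>x. (g x)\<^sup>2)"
proof -
  obtain C a where *: "a > 0" "C > 0" "\<And>x. \<bar>g x\<bar> \<le> C * exp (- (a * \<bar>x\<bar>))" "continuous_on UNIV g"
    using exp_decayE [OF assms] by metis
  obtain M where M: "\<And>x. \<bar>g x\<bar> \<le> M" using exp_decay_bounded [OF assms] by metis
  have "\<bar>(g x)\<^sup>2\<bar> \<le> (M * C) * exp (- (a * \<bar>x\<bar>))" for x
  proof -
    have "\<bar>(g x)\<^sup>2\<bar> = \<bar>g x\<bar> * \<bar>g x\<bar>" by (simp add: power2_eq_square abs_mult)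
    also have "\<dots> \<le> M * (C * exp (- (a * \<bar>x\<bar>)))"
      using M [of x] by (intro mult_mono M *(3)) auto
    finally show ?thesis by (simp add: mult_ac)
  qed
  moreover have "continuous_on UNIV (\<lambda>x. (g x)\<^sup>2)" by (intro continuous_intros *(4))
  ultimately show ?thesis using *(1) unfolding exp_decay_def by blast
qed

context
  fixes g :: "real \<Rightarrow> real" and L \<alpha> :: real and f :: "real \<Rightarrow> complex"
  assumes g: "exp_decay g" and L: "L > 0" and \<alpha>: "\<alpha> > 0"
    and f [measurable]: "f \<in> borel_measurable borel"
    and fin: "(\<integral>\<^sup>+x. ennreal ((norm (f x))\<^sup>2) \<partial>lborel) < \<infinity>"
begin

text \<open>For fixed \<open>k\<close>, periodizing the integrand exhibits the inner products as the
  Fourier coefficients, indexed by \<open>l\<close>, of the function \<open>F k\<close> on one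
  period. Parseval eliminates \<open>l\<close>, and Tonelli moves the sum over \<open>k\<close>
  inside the integral.\<close>

lemma gabor_fiber_identity:
  "(\<integral>\<^sup>+k. (\<integral>\<^sup>+l. ennreal ((norm (LINT t|lborel. f t * of_real (g (t - of_int k * \<alpha>)) * cnj (four_exp L l t)))\<^sup>2) \<partial>int_count) \<partial>int_count)
   = ennreal L * (\<integral>\<^sup>+x. (\<integral>\<^sup>+k. ennreal ((norm (fiber L g (\<lambda>j. f (x + of_int j * L)) (x - of_int k * \<alpha>)))\<^sup>2) \<partial>int_count) \<partial>per L)"
proof -
  have g_cont: "continuous_on UNIV g" using g by (simp add: exp_decay_def)
  have [measurable]: "g \<in> borel_measurable borel"
    by (rule borel_measurable_continuous_onI [OF g_cont])
  define F where "F k x = fiber L g (\<lambda>j. f (x + of_int j * L)) (x - of_int k * \<alpha>)" for k :: int and x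
  have [measurable]: "F k \<in> borel_measurable borel" for k
    unfolding F_def fiber_def by (rule measurable_integral_int_count) measurable
  obtain B where B: "B > 0" "\<And>(c :: int \<Rightarrow> complex) x.
    (\<integral>\<^sup>+k. ennreal ((norm (fiber L g c (x - of_int k * \<alpha>)))\<^sup>2) \<partial>int_count)
      \<le> ennreal B * (\<integral>\<^sup>+j. ennreal ((norm (c j))\<^sup>2) \<partial>int_count)"
    using nn_integral_fiber_le [OF g L \<alpha>, where 'a = complex] by metis
  \<comment> \<open>Square integrability of \<open>F k\<close>, as Parseval requires, comes from
    keeping a single sample in the Schur bound and unfolding the period.\<close>
  have Ffin: "(\<integral>\<^sup>+x. ennreal ((norm (F k x))\<^sup>2) \<partial>per L) < \<infinity>" for k
  proof -
    have "(\<integral>\<^sup>+x. ennreal ((norm (F k x))\<^sup>2) \<partial>per L)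
        \<le> (\<integral>\<^sup>+x. ennreal B * (\<integral>\<^sup>+j. ennreal ((norm (f (x + of_int j * L)))\<^sup>2) \<partial>int_count) \<partial>per L)"
    proof (rule nn_integral_mono)
      fix x
      have "ennreal ((norm (F k x))\<^sup>2) \<le> (\<integral>\<^sup>+k. ennreal ((norm (F k x))\<^sup>2) \<partial>int_count)"
        by (rule nn_integral_ge_point) simp
      also have "\<dots> \<le> ennreal B * (\<integral>\<^sup>+j. ennreal ((norm (f (x + of_int j * L)))\<^sup>2) \<partial>int_count)"
        unfolding F_def by (rule B)
      finally show "ennreal ((norm (F k x))\<^sup>2) \<le> ennreal B * (\<integral>\<^sup>+j. ennreal ((norm (f (x + of_int j * L)))\<^sup>2) \<partial>int_count)" .
    qed
    also have "\<dots> = ennreal B * (\<integral>\<^sup>+x. (\<integral>\<^sup>+j. ennreal ((norm (f (x + of_int j * L)))\<^sup>2) \<partial>int_count) \<partial>per L)"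
      by (rule nn_integral_cmult) (intro measurable_restrict_space1 measurable_nn_integral_int_count, measurable)
    also have "\<dots> = ennreal B * (\<integral>\<^sup>+x. ennreal ((norm (f x))\<^sup>2) \<partial>lborel)"
      by (subst nn_integral_unfold_period [OF L, of "\<lambda>x. ennreal ((norm (f x))\<^sup>2)"]) auto
    also have "\<dots> < \<infinity>"
      using fin by (simp add: ennreal_mult_less_top)
    finally show ?thesis .
  qed
  have coeff: "(LINT t|lborel. f t * of_real (g (t - of_int k * \<alpha>)) * cnj (four_exp L l t))
     = (LINT x|per L. F k x * cnj (four_exp L l x))" for k l
  proof -
    let ?u = "\<lambda>t. f t * of_real (g (t - of_int k * \<alpha>)) * cnj (four_exp L l t)"
    have int: "integrable lborel ?u"
    proof (rule Bochner_Integration.integrable_bound)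
      have "integrable lborel (\<lambda>t. (g (- of_int k * \<alpha> + 1 * t))\<^sup>2)"
        using exp_decay_integrable [OF exp_decay_square [OF g]] by (intro lborel_integrable_real_affine [where f = "\<lambda>x. (g x)\<^sup>2"]) auto
      moreover have "integrable lborel (\<lambda>t. (norm (f t))\<^sup>2)"
        by (rule integrableI_nonneg) (use fin in auto)
      ultimately show "integrable lborel (\<lambda>t. (norm (f t))\<^sup>2 + (g (t - of_int k * \<alpha>))\<^sup>2)"
        by (intro Bochner_Integration.integrable_add) simp_all
      show "?u \<in> borel_measurable lborel"
        unfolding cnj_four_exp by measurable
      show "AE t in lborel. norm (?u t) \<le> norm ((norm (f t))\<^sup>2 + (g (t - of_int k * \<alpha>))\<^sup>2)"
      proof (intro AE_I2)
        fix t
        have "0 \<le> (norm (f t) - \<bar>g (t - of_int k * \<alpha>)\<bar>)\<^sup>2" by simp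
        then have "2 * (norm (f t) * \<bar>g (t - of_int k * \<alpha>)\<bar>) \<le> (norm (f t))\<^sup>2 + (g (t - of_int k * \<alpha>))\<^sup>2"
          by (simp add: power2_diff)
        moreover have "norm (f t) * \<bar>g (t - of_int k * \<alpha>)\<bar> \<ge> 0" by simp
        ultimately have "norm (f t) * \<bar>g (t - of_int k * \<alpha>)\<bar> \<le> (norm (f t))\<^sup>2 + (g (t - of_int k * \<alpha>))\<^sup>2"
          by linarith
        then show "norm (?u t) \<le> norm ((norm (f t))\<^sup>2 + (g (t - of_int k * \<alpha>))\<^sup>2)"
          by (simp add: norm_mult)
      qed
    qed
    \<comment> \<open>The modulations are periodic with period \<open>L\<close>, so they factor out
      of the periodization and leave a shift sum of \<open>g\<close>.\<close>
    have per: "four_exp L l (x + of_int j * L) = four_exp L l x" for x j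
    proof -
      have "four_exp L l (x + of_int j * L) = four_exp L l x * exp (2 * of_real pi * \<i> * of_int (l * j))"
        unfolding four_exp_def mult_exp_exp using L by (simp add: field_simps)
      also have "exp (2 * of_real pi * \<i> * of_int (l * j)) = 1"
        using exp_integer_2pi [of "of_int (l * j)"] by (simp add: mult_ac)
      finally show ?thesis by simp
    qed
    have "(LINT t|lborel. ?u t) = (LINT x|per L. LINT j|int_count. ?u (x + of_int j * L))"
      by (rule integral_unfold_period [OF L int, symmetric])
    also have "\<dots> = (LINT x|per L. F k x * cnj (four_exp L l x))"
    proof (rule Bochner_Integration.integral_cong [OF refl])
      fix x
      have "?u (x + of_int j * L) = g (x - of_int k * \<alpha> + of_int j * L) *\<^sub>R f (x + of_int j * L) * cnj (four_exp L l x)" for j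
        unfolding per scaleR_conv_of_real by (simp add: algebra_simps)
      then show "(LINT j|int_count. ?u (x + of_int j * L)) = F k x * cnj (four_exp L l x)"
        unfolding F_def fiber_def by (simp only: integral_mult_left_zero)
    qed
    finally show ?thesis .
  qed
  have "(\<integral>\<^sup>+k. (\<integral>\<^sup>+l. ennreal ((norm (LINT t|lborel. f t * of_real (g (t - of_int k * \<alpha>)) * cnj (four_exp L l t)))\<^sup>2) \<partial>int_count) \<partial>int_count)
     = (\<integral>\<^sup>+k. ennreal L * (\<integral>\<^sup>+x. ennreal ((norm (F k x))\<^sup>2) \<partial>per L) \<partial>int_count)"
    unfolding coeff by (intro nn_integral_cong parseval_per L Ffin) measurable
  also have "\<dots> = ennreal L * (\<integral>\<^sup>+k. (\<integral>\<^sup>+x. ennreal ((norm (F k x))\<^sup>2) \<partial>per L) \<partial>int_count)"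
    by (rule nn_integral_cmult) simp
  also have "(\<integral>\<^sup>+k. (\<integral>\<^sup>+x. ennreal ((norm (F k x))\<^sup>2) \<partial>per L) \<partial>int_count)
     = (\<integral>\<^sup>+x. (\<integral>\<^sup>+k. ennreal ((norm (F k x))\<^sup>2) \<partial>int_count) \<partial>per L)"
  proof (rule nn_integral_int_swap)
    show "sigma_finite_measure (per L)"
      using finite_measure_per [of L] by (simp add: finite_measure_def)
    show "(\<lambda>x. ennreal ((norm (F k x))\<^sup>2)) \<in> borel_measurable (per L)" for k
      by (intro measurable_restrict_space1) simp
  qed
  finally show ?thesis unfolding F_def .
qed

end

section \<open>Necessity of oversampling\<close>

lemma underdetermined_system:
  fixes A :: "'i \<Rightarrow> 'j \<Rightarrow> real"
  assumes "finite I" "finite J" "card I < card J"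
  shows "\<exists>c. (\<exists>j. c j \<noteq> 0) \<and> (\<forall>j. j \<notin> J \<longrightarrow> c j = 0) \<and> (\<forall>i\<in>I. (\<Sum>j\<in>J. A i j * c j) = 0)"
  using assms
proof (induction I arbitrary: J A rule: finite_induct)
  case empty
  then obtain p where "p \<in> J" by (metis card.empty equals0I less_irrefl)
  then show ?case by (intro exI [of _ "\<lambda>j. if j = p then 1 else 0"]) auto
next
  case (insert i I)
  show ?case
  proof (cases "\<forall>j\<in>J. A i j = 0")
    case True
    have "card I < card J" using insert by simp
    then obtain c where "(\<exists>j. c j \<noteq> 0)" "(\<forall>j. j \<notin> J \<longrightarrow> c j = 0)" "(\<forall>i\<in>I. (\<Sum>j\<in>J. A i j * c j) = 0)"
      using insert.IH [OF insert.prems(1), of A] by blast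
    with True show ?thesis by (intro exI [of _ c]) auto
  next
    case False
    then obtain p where p: "p \<in> J" "A i p \<noteq> 0" by blast
    define J' where "J' = J - {p}"
    have J': "finite J'" "J = insert p J'" "p \<notin> J'" using p insert.prems by (auto simp: J'_def)
    have "card I < card J'" using insert.prems insert.hyps J' by simp
    then obtain c where c: "\<exists>j. c j \<noteq> 0" "\<And>j. j \<notin> J' \<Longrightarrow> c j = 0"
      "\<And>i'. i' \<in> I \<Longrightarrow> (\<Sum>j\<in>J'. (A i' j - A i' p * A i j / A i p) * c j) = 0"
      using insert.IH [OF J'(1), of "\<lambda>i' j. A i' j - A i' p * A i j / A i p"] by blast
    \<comment> \<open>One step of Gaussian elimination with pivot \<open>A i p\<close>: the unknown
      \<open>p\<close> is solved from equation \<open>i\<close>, and the reduced matrix given to the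
      induction hypothesis makes the other equations hold.\<close>
    define t where "t = - (\<Sum>j\<in>J'. A i j * c j) / A i p"
    define d where "d = c(p := t)"
    have sum_d: "(\<Sum>j\<in>J. A i' j * d j) = A i' p * t + (\<Sum>j\<in>J'. A i' j * c j)" for i'
      using J' by (auto simp: d_def intro!: sum.cong)
    show ?thesis
    proof (intro exI [of _ d] conjI allI impI ballI)
      obtain j where "c j \<noteq> 0" using c(1) by blast
      then have "j \<in> J'" using c(2) by blast
      then have "d j \<noteq> 0" using \<open>c j \<noteq> 0\<close> J' by (auto simp: d_def)
      then show "\<exists>j. d j \<noteq> 0" by blast
      show "d j = 0" if "j \<notin> J" for j using that c(2) J' by (auto simp: d_def)
      fix i' assume "i' \<in> insert i I"
      then show "(\<Sum>j\<in>J. A i' j * d j) = 0"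
      proof
        assume "i' = i"
        then show ?thesis using p by (simp add: sum_d t_def)
      next
        assume "i' \<in> I"
        have "A i' p * t = - (\<Sum>j\<in>J'. A i' p * A i j / A i p * c j)"
          by (simp add: t_def sum_distrib_left sum_divide_distrib mult_ac)
        moreover have "(\<Sum>j\<in>J'. (A i' j - A i' p * A i j / A i p) * c j)
          = (\<Sum>j\<in>J'. A i' j * c j) - (\<Sum>j\<in>J'. A i' p * A i j / A i p * c j)"
          by (simp add: sum_subtractf left_diff_distrib)
        ultimately show ?thesis using c(3) [OF \<open>i' \<in> I\<close>] by (simp add: sum_d)
      qed
    qed
  qed
qed

lemma fiber_finite_support:
  assumes "finite J" "\<And>j. j \<notin> J \<Longrightarrow> c j = 0"
  shows "fiber L g c t = (\<Sum>j\<in>J. g (t + of_int j * L) * (c j :: real))"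
proof -
  have "fiber L g c t = (LINT j|int_count. indicator J j *\<^sub>R (g (t + of_int j * L) *\<^sub>R c j))"
    unfolding fiber_def using assms(2) by (intro Bochner_Integration.integral_cong) (auto simp: indicator_def)
  then show ?thesis using integral_int_indicator [OF assms(1), of "\<lambda>j. g (t + of_int j * L) *\<^sub>R c j"] by simp
qed

lemma exp_decay_shift_scale:
  assumes "exp_decay g"
  shows "exp_decay (\<lambda>x. g (x + s) * r)"
proof -
  obtain C a where *: "a > 0" "C > 0" "\<And>x. \<bar>g x\<bar> \<le> C * exp (- (a * \<bar>x\<bar>))" "continuous_on UNIV g"
    using exp_decayE [OF assms] by metis
  have "\<bar>g (x + s) * r\<bar> \<le> (C * exp (a * \<bar>s\<bar>) * \<bar>r\<bar>) * exp (- (a * \<bar>x\<bar>))" for x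
  proof -
    have "a * \<bar>x\<bar> \<le> a * (\<bar>x + s\<bar> + \<bar>s\<bar>)" using * by (intro mult_left_mono) auto
    then have "exp (- (a * \<bar>x + s\<bar>)) \<le> exp (a * \<bar>s\<bar>) * exp (- (a * \<bar>x\<bar>))"
      unfolding mult_exp_exp by (simp add: algebra_simps)
    then have "C * exp (- (a * \<bar>x + s\<bar>)) \<le> C * (exp (a * \<bar>s\<bar>) * exp (- (a * \<bar>x\<bar>)))"
      using * by (intro mult_left_mono) auto
    with *(3) [of "x + s"] have "\<bar>g (x + s)\<bar> \<le> C * (exp (a * \<bar>s\<bar>) * exp (- (a * \<bar>x\<bar>)))" by linarith
    then have "\<bar>g (x + s)\<bar> * \<bar>r\<bar> \<le> C * (exp (a * \<bar>s\<bar>) * exp (- (a * \<bar>x\<bar>))) * \<bar>r\<bar>"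
      by (intro mult_right_mono) auto
    then show ?thesis by (simp add: abs_mult mult_ac)
  qed
  moreover have "continuous_on UNIV (\<lambda>x. g (x + s) * r)"
    by (intro continuous_intros continuous_on_compose2 [OF *(4)]) auto
  ultimately show ?thesis using *(1) unfolding exp_decay_def by blast
qed

lemma exp_decay_add:
  assumes "exp_decay g" "exp_decay h"
  shows "exp_decay (\<lambda>x. g x + h x)"
proof -
  obtain C a where *: "a > 0" "C > 0" "\<And>x. \<bar>g x\<bar> \<le> C * exp (- (a * \<bar>x\<bar>))" "continuous_on UNIV g"
    using exp_decayE [OF assms(1)] by metis
  obtain D b where **: "b > 0" "D > 0" "\<And>x. \<bar>h x\<bar> \<le> D * exp (- (b * \<bar>x\<bar>))" "continuous_on UNIV h"
    using exp_decayE [OF assms(2)] by metis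
  have "\<bar>g x + h x\<bar> \<le> (C + D) * exp (- (min a b * \<bar>x\<bar>))" for x
  proof -
    have "C * exp (- (a * \<bar>x\<bar>)) \<le> C * exp (- (min a b * \<bar>x\<bar>))"
      using * by (intro mult_left_mono) (auto intro: mult_right_mono)
    moreover have "D * exp (- (b * \<bar>x\<bar>)) \<le> D * exp (- (min a b * \<bar>x\<bar>))"
      using ** by (intro mult_left_mono) (auto intro: mult_right_mono)
    ultimately show ?thesis using *(3) [of x] **(3) [of x] unfolding distrib_right by linarith
  qed
  moreover have "continuous_on UNIV (\<lambda>x. g x + h x)" by (intro continuous_intros * **)
  moreover have "min a b > 0" using * ** by simp
  ultimately show ?thesis unfolding exp_decay_def by blast
qed

lemma exp_decay_zero: "exp_decay (\<lambda>_. 0)"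
  unfolding exp_decay_def by (intro conjI exI [of _ 0] exI [of _ 1]) auto

lemma exp_decay_sum:
  assumes "\<And>j. j \<in> J \<Longrightarrow> exp_decay (h j)"
  shows "exp_decay (\<lambda>x. \<Sum>j\<in>J. h j x)"
  using assms
proof (induction J rule: infinite_finite_induct)
  case (insert j J)
  then show ?case by (auto intro: exp_decay_add)
qed (auto intro: exp_decay_zero)

text \<open>Finite support makes the shift sum itself decay, so its square can serve as the
  generator of a second shift sum along the sampling lattice.\<close>

lemma exp_decay_fiber_finite_support:
  assumes "exp_decay g" "finite J" "\<And>j. j \<notin> J \<Longrightarrow> c j = 0"
  shows "exp_decay (fiber L g (c :: int \<Rightarrow> real))"
proof -
  have "fiber L g c = (\<lambda>x. \<Sum>j\<in>J. g (x + of_int j * L) * c j)"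
    by (rule ext) (rule fiber_finite_support [OF assms(2,3)])
  moreover have "exp_decay (\<lambda>x. \<Sum>j\<in>J. g (x + of_int j * L) * c j)"
    by (rule exp_decay_sum) (rule exp_decay_shift_scale [OF assms(1)])
  ultimately show ?thesis by simp
qed

context
  fixes g :: "real \<Rightarrow> real" and L \<alpha> A :: real
  assumes g: "exp_decay g" and L: "L > 0" and \<alpha>: "\<alpha> > 0" and A: "A > 0"
    and lower: "\<And>f. f \<in> borel_measurable borel \<Longrightarrow> (\<integral>\<^sup>+x. ennreal ((norm (f x))\<^sup>2) \<partial>lborel) < \<infinity> \<Longrightarrow>
      ennreal A * (\<integral>\<^sup>+x. ennreal ((norm (f x))\<^sup>2) \<partial>lborel)
      \<le> (\<integral>\<^sup>+k. (\<integral>\<^sup>+l. ennreal ((norm (LINT t|lborel. f t * of_real (g (t - of_int k * \<alpha>)) * cnj (four_exp L l t)))\<^sup>2) \<partial>int_count) \<partial>int_count)"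
begin

text \<open>Testing the lower bound on functions supported near \<open>x0 + L \<int>\<close>.\<close>

lemma fiber_lower_bound:
  assumes x0: "x0 \<in> {0..<L}" and J: "finite J" "\<And>j. j \<notin> J \<Longrightarrow> c j = 0"
  shows "A * (\<Sum>j\<in>J. (c j)\<^sup>2) \<le> L * (LINT k|int_count. (fiber L g c (x0 - of_int k * \<alpha>))\<^sup>2)"
proof (rule ccontr)
  let ?F = "fiber L g c"
  have F: "exp_decay (\<lambda>x. (?F x)\<^sup>2)"
    by (intro exp_decay_square exp_decay_fiber_finite_support [OF g J])
  \<comment> \<open>The sample energy as a function of the base point is a shift sum with spacing
    \<alpha> and all coefficients 1; its continuity is thus an instance of
    \<open>continuous_on_fiber\<close>.\<close>
  define \<Phi> where "\<Phi> x = fiber \<alpha> (\<lambda>x. (?F x)\<^sup>2) (\<lambda>_. 1::real) x" for x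
  have \<Phi>_eq: "\<Phi> x = (LINT k|int_count. (?F (x - of_int k * \<alpha>))\<^sup>2)" for x
    using integral_bij_count_space [OF bij_int_uminus, of "\<lambda>k. (?F (x + of_int k * \<alpha>))\<^sup>2"]
    by (simp add: \<Phi>_def fiber_def)
  have int\<Phi>: "integrable int_count (\<lambda>k. (?F (x - of_int k * \<alpha>))\<^sup>2)" for x
  proof -
    have "integrable int_count (\<lambda>k. (?F (x + of_int k * \<alpha>))\<^sup>2)"
      using integrable_fiber [OF F \<alpha>, of "\<lambda>_. 1::real" 1 x] by simp
    then show ?thesis
      using integrable_bij_count_space [OF bij_int_uminus, of "\<lambda>k. (?F (x + of_int k * \<alpha>))\<^sup>2"] by simp
  qed
  have nn\<Phi>: "(\<integral>\<^sup>+k. ennreal ((?F (x - of_int k * \<alpha>))\<^sup>2) \<partial>int_count) = ennreal (\<Phi> x)" for x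
    unfolding \<Phi>_eq by (intro nn_integral_eq_integral int\<Phi>) auto
  have cont: "continuous_on UNIV \<Phi>"
    unfolding \<Phi>_def [abs_def] by (rule continuous_on_fiber [OF F \<alpha>, where M = 1]) simp
  define N where "N = (\<Sum>j\<in>J. (c j)\<^sup>2)"
  assume "\<not> ?thesis"
  then have lt: "\<Phi> x0 < A * N / L" using L by (simp add: \<Phi>_eq N_def field_simps)
  have "open {x. \<Phi> x < A * N / L}"
    by (intro open_Collect_less cont continuous_intros)
  then obtain e where e: "e > 0" "\<And>x. \<bar>x - x0\<bar> < e \<Longrightarrow> \<Phi> x < A * N / L"
    using lt unfolding open_dist by (auto simp: dist_real_def)
  \<comment> \<open>The interval must stay in the neighbourhood where the violation persists and
    inside the period, so that its translates by multiples of \<open>L\<close> are disjoint.\<close>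
  define \<eta> where "\<eta> = min (e / 2) (L - x0)"
  have \<eta>: "\<eta> > 0" "\<eta> < e" "x0 + \<eta> \<le> L" using e x0 by (auto simp: \<eta>_def min_def)
  let ?I = "{x0..<x0 + \<eta>}"
  \<comment> \<open>A uniform strict gap, by compactness, so that strictness is preserved under
    integration over the interval.\<close>
  have "\<exists>q < A * N / L. \<forall>x\<in>{x0..x0 + \<eta>}. \<Phi> x \<le> q"
  proof -
    have "\<exists>x\<in>{x0..x0 + \<eta>}. \<forall>y\<in>{x0..x0 + \<eta>}. \<Phi> y \<le> \<Phi> x"
      using \<eta> by (intro continuous_attains_sup continuous_on_subset [OF cont]) auto
    then obtain x where "x \<in> {x0..x0 + \<eta>}" "\<forall>y\<in>{x0..x0 + \<eta>}. \<Phi> y \<le> \<Phi> x" by blast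
    moreover have "\<Phi> x < A * N / L" using calculation(1) \<eta> by (intro e) auto
    ultimately show ?thesis by blast
  qed
  then obtain q where q: "q < A * N / L" "\<And>x. x \<in> {x0..x0 + \<eta>} \<Longrightarrow> \<Phi> x \<le> q" by blast
  have \<Phi>_nonneg: "\<Phi> x \<ge> 0" for x unfolding \<Phi>_eq by (intro integral_nonneg_AE) auto
  have "q \<ge> 0" using q(2) [of x0] \<Phi>_nonneg [of x0] \<eta> by simp
  \<comment> \<open>Height \<open>c j\<close> on the \<open>j\<close>-th translate of the small
    interval: the coefficient sequence attached to a point of the period is \<open>c\<close> inside
    the interval and 0 outside.\<close>
  define f :: "real \<Rightarrow> complex" where "f x = (\<Sum>j\<in>J. of_real (c j * indicator ?I (x - of_int j * L)))" for x
  have [measurable]: "f \<in> borel_measurable borel" unfolding f_def by measurable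
  have f: "f (x + of_int j * L) = of_real (c j * indicator ?I x)" if "x \<in> {0..<L}" for x j
  proof -
    have "c i * indicator ?I (x + of_int j * L - of_int i * L) = (if i = j then c j * indicator ?I x else 0)" for i
    proof (cases "i = j")
      case False
      have "x + of_int j * L - of_int i * L \<notin> {0..<L}"
      proof -
        have "x + of_int j * L - of_int i * L \<in> {0..<L} \<longleftrightarrow> i = \<lfloor>(x + of_int j * L) / L\<rfloor>"
          by (rule period_translate_iff [OF L])
        moreover have "j = \<lfloor>(x + of_int j * L) / L\<rfloor>"
          using period_translate_iff [OF L, of "x + of_int j * L" j] that by simp
        ultimately show ?thesis using False by simp
      qed
      then have "x + of_int j * L - of_int i * L \<notin> ?I" using x0 \<eta> by auto
      then show ?thesis using False by simp
    qed simp
    then have "f (x + of_int j * L) = (\<Sum>i\<in>J. of_real (if i = j then c j * indicator ?I x else 0))"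
      unfolding f_def by presburger
    also have "\<dots> = of_real (\<Sum>i\<in>J. if i = j then c j * indicator ?I x else 0)"
      by (simp only: of_real_sum)
    also have "(\<Sum>i\<in>J. if i = j then c j * indicator ?I x else 0) = c j * indicator ?I x"
      using J by (cases "j \<in> J") simp_all
    finally show ?thesis .
  qed
  have sub: "?I \<subseteq> {0..<L}" using x0 \<eta> by auto
  have nnI: "(\<integral>\<^sup>+x. u x * indicator ?I x \<partial>per L) = (\<integral>\<^sup>+x. u x * indicator ?I x \<partial>lborel)" for u
    using sub by (subst nn_integral_restrict_space) (auto intro!: nn_integral_cong simp: indicator_def)
  have N_sum: "(\<integral>\<^sup>+j. ennreal ((c j)\<^sup>2) \<partial>int_count) = ennreal N"
  proof -
    have "(\<integral>\<^sup>+j. ennreal ((c j)\<^sup>2) \<partial>int_count) = (\<integral>\<^sup>+j. ennreal ((c j)\<^sup>2) * indicator J j \<partial>int_count)"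
      using J(2) by (intro nn_integral_cong) (auto simp: indicator_def)
    also have "\<dots> = (\<Sum>j\<in>J. ennreal ((c j)\<^sup>2))"
      using J(1) by (subst nn_integral_count_space_indicator [symmetric]) (simp_all add: nn_integral_count_space_finite)
    also have "\<dots> = ennreal N" by (simp add: N_def sum_ennreal)
    finally show ?thesis .
  qed
  have norm_f: "(\<integral>\<^sup>+x. ennreal ((norm (f x))\<^sup>2) \<partial>lborel) = ennreal (N * \<eta>)"
  proof -
    have "(\<integral>\<^sup>+x. ennreal ((norm (f x))\<^sup>2) \<partial>lborel)
      = (\<integral>\<^sup>+x. (\<integral>\<^sup>+j. ennreal ((norm (f (x + of_int j * L)))\<^sup>2) \<partial>int_count) \<partial>per L)"
      by (rule nn_integral_unfold_period [OF L, of "\<lambda>x. ennreal ((norm (f x))\<^sup>2)", symmetric]) measurable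
    also have "\<dots> = (\<integral>\<^sup>+x. ennreal N * indicator ?I x \<partial>per L)"
    proof (rule nn_integral_cong)
      fix x assume "x \<in> space (per L)"
      then have x: "x \<in> {0..<L}" by (simp add: space_restrict_space)
      have "(\<integral>\<^sup>+j. ennreal ((norm (f (x + of_int j * L)))\<^sup>2) \<partial>int_count) = (\<integral>\<^sup>+j. ennreal ((c j)\<^sup>2) * indicator ?I x \<partial>int_count)"
        unfolding f [OF x] by (intro nn_integral_cong) (simp add: indicator_def)
      also have "\<dots> = ennreal N * indicator ?I x"
        by (simp add: nn_integral_multc N_sum)
      finally show "(\<integral>\<^sup>+j. ennreal ((norm (f (x + of_int j * L)))\<^sup>2) \<partial>int_count) = ennreal N * indicator ?I x" .
    qed
    also have "\<dots> = ennreal N * ennreal \<eta>"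
      unfolding nnI using \<eta> by (simp add: nn_integral_cmult_indicator)
    also have "\<dots> = ennreal (N * \<eta>)"
      using \<eta> by (simp add: ennreal_mult N_def sum_nonneg)
    finally show ?thesis .
  qed
  have "ennreal A * (\<integral>\<^sup>+x. ennreal ((norm (f x))\<^sup>2) \<partial>lborel)
    \<le> ennreal L * (\<integral>\<^sup>+x. (\<integral>\<^sup>+k. ennreal ((norm (fiber L g (\<lambda>j. f (x + of_int j * L)) (x - of_int k * \<alpha>)))\<^sup>2) \<partial>int_count) \<partial>per L)"
    using lower [of f] gabor_fiber_identity [OF g L \<alpha>, of f] norm_f by simp
  also have "\<dots> = ennreal L * (\<integral>\<^sup>+x. ennreal (\<Phi> x) * indicator ?I x \<partial>per L)"
  proof (rule arg_cong [where f = "\<lambda>x. ennreal L * x"], rule nn_integral_cong)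
    fix x assume "x \<in> space (per L)"
    then have x: "x \<in> {0..<L}" by (simp add: space_restrict_space)
    have "norm (fiber L g (\<lambda>j. f (x + of_int j * L)) t) = indicator ?I x * \<bar>?F t\<bar>" for t
    proof -
      have "fiber L g (\<lambda>j. f (x + of_int j * L)) t = (LINT j|int_count. of_real (indicator ?I x * (g (t + of_int j * L) * c j)))"
        unfolding f [OF x] fiber_def by (intro Bochner_Integration.integral_cong) (auto simp: scaleR_conv_of_real)
      also have "\<dots> = of_real (indicator ?I x * ?F t)"
        unfolding fiber_def by (simp only: integral_complex_of_real integral_mult_right_zero real_scaleR_def)
      finally show ?thesis by (simp add: norm_mult abs_mult)
    qed
    then have "(\<integral>\<^sup>+k. ennreal ((norm (fiber L g (\<lambda>j. f (x + of_int j * L)) (x - of_int k * \<alpha>)))\<^sup>2) \<partial>int_count)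
       = (\<integral>\<^sup>+k. ennreal ((?F (x - of_int k * \<alpha>))\<^sup>2) * indicator ?I x \<partial>int_count)"
      by (intro nn_integral_cong) (simp add: indicator_def)
    then show "(\<integral>\<^sup>+k. ennreal ((norm (fiber L g (\<lambda>j. f (x + of_int j * L)) (x - of_int k * \<alpha>)))\<^sup>2) \<partial>int_count)
      = ennreal (\<Phi> x) * indicator ?I x"
      by (simp add: nn_integral_multc nn\<Phi>)
  qed
  also have "\<dots> \<le> ennreal L * (\<integral>\<^sup>+x. ennreal q * indicator ?I x \<partial>lborel)"
    unfolding nnI using q(2) by (intro mult_left_mono nn_integral_mono) (auto simp: indicator_def intro: ennreal_leI)
  also have "\<dots> = ennreal (L * (q * \<eta>))"
    using \<eta> \<open>q \<ge> 0\<close> L by (simp add: nn_integral_cmult_indicator ennreal_mult)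
  finally have "ennreal (A * (N * \<eta>)) \<le> ennreal (L * (q * \<eta>))"
    using A by (simp add: norm_f ennreal_mult')
  then have "A * (N * \<eta>) \<le> L * (q * \<eta>)"
    using L \<eta> \<open>q \<ge> 0\<close> by (simp add: ennreal_le_iff)
  then have "A * N \<le> L * q" using \<eta> by (simp add: mult.assoc [symmetric])
  with q(1) L show False by (simp add: field_simps)
qed

end

section \<open>Excluding sparse and critical sampling\<close>

context
  fixes g :: "real \<Rightarrow> real" and L \<alpha> A :: real
  assumes g: "exp_decay g" and L: "L > 0" and \<alpha>: "\<alpha> > 0" and A: "A > 0"
    and lower: "\<And>f. f \<in> borel_measurable borel \<Longrightarrow> (\<integral>\<^sup>+x. ennreal ((norm (f x))\<^sup>2) \<partial>lborel) < \<infinity> \<Longrightarrow>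
      ennreal A * (\<integral>\<^sup>+x. ennreal ((norm (f x))\<^sup>2) \<partial>lborel)
      \<le> (\<integral>\<^sup>+k. (\<integral>\<^sup>+l. ennreal ((norm (LINT t|lborel. f t * of_real (g (t - of_int k * \<alpha>)) * cnj (four_exp L l t)))\<^sup>2) \<partial>int_count) \<partial>int_count)"
begin

lemma fiber_lower_bound':
  assumes "x0 \<in> {0..<L}" "finite J" "\<And>j. j \<notin> J \<Longrightarrow> c j = 0" "b \<ge> 0"
    and b: "(\<integral>\<^sup>+k. ennreal ((fiber L g c (x0 - of_int k * \<alpha>))\<^sup>2) \<partial>int_count) \<le> ennreal b"
  shows "A * (\<Sum>j\<in>J. (c j)\<^sup>2) \<le> L * b"
proof -
  have "(LINT k|int_count. (fiber L g c (x0 - of_int k * \<alpha>))\<^sup>2)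
      = enn2real (\<integral>\<^sup>+k. ennreal ((fiber L g c (x0 - of_int k * \<alpha>))\<^sup>2) \<partial>int_count)"
    by (rule integral_eq_nn_integral) auto
  also have "\<dots> \<le> b" using assms(4) b by (rule enn2real_leI)
  finally have "L * (LINT k|int_count. (fiber L g c (x0 - of_int k * \<alpha>))\<^sup>2) \<le> L * b"
    using L by (intro mult_left_mono) auto
  with fiber_lower_bound [OF g L \<alpha> A lower assms(1,2,3)] show ?thesis by (rule order_trans)
qed

text \<open>If the samples are sparser than the shifts, some nonzero coefficients on a long interval annihilate
  all samples in a slightly longer interval.\<close>

lemma not_oversparse: "\<not> L < \<alpha>"
proof
  assume "L < \<alpha>"
  obtain C a where *: "a > 0" "C > 0" "\<And>x. \<bar>g x\<bar> \<le> C * exp (- (a * \<bar>x\<bar>))" "continuous_on UNIV g"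
    using exp_decayE [OF g] by metis
  \<comment> \<open>The decay of \<open>g\<close> is split in two: one half provides a small factor
    for distant samples, the other half stays in \<open>h\<close>, for which the Schur bound is
    applied.\<close>
  define h where "h x = exp (- (a / 2 * \<bar>x\<bar>))" for x :: real
  have h: "exp_decay h"
    unfolding exp_decay_def h_def using * by (intro conjI exI [of _ 1] exI [of _ "a / 2"] continuous_intros) auto
  obtain B where B: "B > 0" "\<And>(c :: int \<Rightarrow> real) x.
    (\<integral>\<^sup>+k. ennreal ((norm (fiber L h c (x - of_int k * \<alpha>)))\<^sup>2) \<partial>int_count)
      \<le> ennreal B * (\<integral>\<^sup>+j. ennreal ((norm (c j))\<^sup>2) \<partial>int_count)"
    using nn_integral_fiber_le [OF h L \<alpha>, where 'a = real] by metis
  \<comment> \<open>\<open>m\<close> measures, in units of \<open>L\<close>, the distance between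
    the surviving samples and the shifts; it is fixed large enough to contradict the lower bound
    \<open>A\<close>.\<close>
  have "(\<lambda>m. L * (C\<^sup>2 * exp (- (a * L) * real m) * B)) \<longlonglongrightarrow> L * (C\<^sup>2 * 0 * B)"
    using * L by (intro tendsto_intros) real_asymp
  then have "\<forall>\<^sub>F m in sequentially. L * (C\<^sup>2 * exp (- (a * L) * real m) * B) < A"
    by (rule order_tendstoD(2)) (use A in simp)
  then obtain m where m: "L * (C\<^sup>2 * exp (- (a * L) * real m) * B) < A"
    by (auto simp: eventually_sequentially)
  \<comment> \<open>Samples with \<open>|k| \<ge> R\<close> and shifts with
    \<open>|j| \<le> R\<close> are at least \<open>R * (\<alpha> - L)\<close> apart, which this
    choice makes at least \<open>L * m\<close>. Sparseness, L < \<alpha>, is used here.\<close>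
  obtain R :: nat where R: "real R \<ge> L * real m / (\<alpha> - L)"
    using real_arch_simple by blast
  then have Rm: "(\<alpha> - L) * real R \<ge> L * real m"
    using \<open>L < \<alpha>\<close> by (simp add: field_simps)
  define J where "J = {- int R..int R}"
  obtain c where c: "\<exists>j. c j \<noteq> 0" "\<And>j. j \<notin> J \<Longrightarrow> c j = 0"
    "\<And>k. k \<in> {- int R + 1..int R - 1} \<Longrightarrow> (\<Sum>j\<in>J. g (0 - of_int k * \<alpha> + of_int j * L) * c j) = 0"
  proof -
    \<comment> \<open>The equations range over \<open>|k| < R\<close> and the unknowns over
      \<open>|j| \<le> R\<close>, so there are more unknowns than equations, also when
      \<open>R = 0\<close>.\<close>
    have "finite {- int R + 1..int R - 1}" "finite J" "card {- int R + 1..int R - 1} < card J"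
      by (simp_all add: J_def)
    from underdetermined_system [OF this, of "\<lambda>k j. g (0 - of_int k * \<alpha> + of_int j * L)"] that
    show thesis by blast
  qed
  have finJ: "finite J" by (simp add: J_def)
  have fib: "fiber L u c t = (\<Sum>j\<in>J. u (t + of_int j * L) * c j)" for u t
    by (rule fiber_finite_support [OF finJ c(2)])
  have fib': "fiber L u (\<lambda>j. \<bar>c j\<bar>) t = (\<Sum>j\<in>J. u (t + of_int j * L) * \<bar>c j\<bar>)" for u t
    by (rule fiber_finite_support [OF finJ]) (simp add: c(2))
  have bound: "\<bar>fiber L g c (0 - of_int k * \<alpha>)\<bar> \<le> C * exp (- (a / 2 * (L * real m))) * fiber L h (\<lambda>j. \<bar>c j\<bar>) (0 - of_int k * \<alpha>)" for k
  proof (cases "k \<in> {- int R + 1..int R - 1}")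
    case True
    then have "fiber L g c (0 - of_int k * \<alpha>) = 0" using c(3) by (simp add: fib)
    moreover have "fiber L h (\<lambda>j. \<bar>c j\<bar>) (0 - of_int k * \<alpha>) \<ge> 0"
      unfolding fib' by (intro sum_nonneg) (auto simp: h_def)
    ultimately show ?thesis using * by simp
  next
    case False
    then have "\<bar>k\<bar> \<ge> int R" by auto
    then have k: "\<bar>real_of_int k\<bar> \<ge> real R" by linarith
    have "\<bar>fiber L g c (0 - of_int k * \<alpha>)\<bar> \<le> (\<Sum>j\<in>J. \<bar>g (0 - of_int k * \<alpha> + of_int j * L) * c j\<bar>)"
      unfolding fib by (rule sum_abs)
    also have "\<dots> \<le> (\<Sum>j\<in>J. C * exp (- (a / 2 * (L * real m))) * (h (0 - of_int k * \<alpha> + of_int j * L) * \<bar>c j\<bar>))"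
    proof (rule sum_mono)
      fix j assume j: "j \<in> J"
      define u where "u = 0 - of_int k * \<alpha> + of_int j * L"
      have "\<bar>of_int j * L\<bar> \<le> real R * L"
        using j L unfolding J_def abs_mult by (intro mult_mono) auto
      moreover have "\<bar>of_int k * \<alpha>\<bar> \<ge> real R * \<alpha>"
        using k \<alpha> unfolding abs_mult by (intro mult_mono) auto
      ultimately have "\<bar>u\<bar> \<ge> L * real m"
        using Rm unfolding u_def by (simp add: algebra_simps)
      then have "a / 2 * (L * real m) \<le> a / 2 * \<bar>u\<bar>"
        using * by (intro mult_left_mono) auto
      then have "exp (- (a * \<bar>u\<bar>)) \<le> exp (- (a / 2 * (L * real m))) * h u"
        unfolding h_def mult_exp_exp by simp
      then have "C * exp (- (a * \<bar>u\<bar>)) \<le> C * (exp (- (a / 2 * (L * real m))) * h u)"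
        using * by (intro mult_left_mono) auto
      with *(3) [of u] have "\<bar>g u\<bar> \<le> C * (exp (- (a / 2 * (L * real m))) * h u)" by linarith
      then have "\<bar>g u\<bar> * \<bar>c j\<bar> \<le> C * (exp (- (a / 2 * (L * real m))) * h u) * \<bar>c j\<bar>"
        by (intro mult_right_mono) auto
      then show "\<bar>g (0 - of_int k * \<alpha> + of_int j * L) * c j\<bar>
        \<le> C * exp (- (a / 2 * (L * real m))) * (h (0 - of_int k * \<alpha> + of_int j * L) * \<bar>c j\<bar>)"
        unfolding u_def abs_mult by (simp only: mult.assoc)
    qed
    also have "\<dots> = C * exp (- (a / 2 * (L * real m))) * fiber L h (\<lambda>j. \<bar>c j\<bar>) (0 - of_int k * \<alpha>)"
      unfolding fib' by (rule sum_distrib_left [symmetric])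
    finally show ?thesis .
  qed
  define N where "N = (\<Sum>j\<in>J. (c j)\<^sup>2)"
  have "N > 0"
  proof -
    obtain j where "c j \<noteq> 0" using c(1) by blast
    then have "j \<in> J" using c(2) by blast
    then have "(c j)\<^sup>2 \<le> N" unfolding N_def using finJ by (intro member_le_sum) auto
    moreover have "(c j)\<^sup>2 > 0" using \<open>c j \<noteq> 0\<close> by simp
    ultimately show ?thesis by linarith
  qed
  have N_sum: "(\<integral>\<^sup>+j. ennreal ((norm \<bar>c j\<bar>)\<^sup>2) \<partial>int_count) = ennreal N"
  proof -
    have "(\<integral>\<^sup>+j. ennreal ((norm \<bar>c j\<bar>)\<^sup>2) \<partial>int_count) = (\<integral>\<^sup>+j. ennreal ((c j)\<^sup>2) * indicator J j \<partial>int_count)"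
      using c(2) by (intro nn_integral_cong) (auto simp: indicator_def)
    also have "\<dots> = (\<Sum>j\<in>J. ennreal ((c j)\<^sup>2))"
      using finJ by (subst nn_integral_count_space_indicator [symmetric]) (simp_all add: nn_integral_count_space_finite)
    also have "\<dots> = ennreal N" by (simp add: N_def sum_ennreal)
    finally show ?thesis .
  qed
  define b where "b = C\<^sup>2 * exp (- (a * L) * real m) * (B * N)"
  have "(\<integral>\<^sup>+k. ennreal ((fiber L g c (0 - of_int k * \<alpha>))\<^sup>2) \<partial>int_count)
     \<le> (\<integral>\<^sup>+k. ennreal (C\<^sup>2 * exp (- (a * L) * real m)) * ennreal ((norm (fiber L h (\<lambda>j. \<bar>c j\<bar>) (0 - of_int k * \<alpha>)))\<^sup>2) \<partial>int_count)"
  proof (rule nn_integral_mono)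
    fix k :: int
    have "\<bar>fiber L g c (0 - of_int k * \<alpha>)\<bar>\<^sup>2 \<le> (C * exp (- (a / 2 * (L * real m))) * fiber L h (\<lambda>j. \<bar>c j\<bar>) (0 - of_int k * \<alpha>))\<^sup>2"
      by (rule power_mono [OF bound]) simp
    also have "\<dots> = C\<^sup>2 * exp (- (a * L) * real m) * (norm (fiber L h (\<lambda>j. \<bar>c j\<bar>) (0 - of_int k * \<alpha>)))\<^sup>2"
      by (simp add: power_mult_distrib exp_double [symmetric])
    finally show "ennreal ((fiber L g c (0 - of_int k * \<alpha>))\<^sup>2)
      \<le> ennreal (C\<^sup>2 * exp (- (a * L) * real m)) * ennreal ((norm (fiber L h (\<lambda>j. \<bar>c j\<bar>) (0 - of_int k * \<alpha>)))\<^sup>2)"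
      by (subst ennreal_mult [symmetric]) (auto intro: ennreal_leI)
  qed
  also have "\<dots> = ennreal (C\<^sup>2 * exp (- (a * L) * real m)) * (\<integral>\<^sup>+k. ennreal ((norm (fiber L h (\<lambda>j. \<bar>c j\<bar>) (0 - of_int k * \<alpha>)))\<^sup>2) \<partial>int_count)"
    by (rule nn_integral_cmult) simp
  also have "\<dots> \<le> ennreal (C\<^sup>2 * exp (- (a * L) * real m)) * (ennreal B * ennreal N)"
    using B(2) [of "\<lambda>j. \<bar>c j\<bar>" 0] unfolding N_sum by (intro mult_left_mono) auto
  also have "\<dots> = ennreal b"
    unfolding b_def using B \<open>N > 0\<close> by (simp add: ennreal_mult)
  finally have "A * (\<Sum>j\<in>J. (c j)\<^sup>2) \<le> L * b"
    using L finJ c(2) B \<open>N > 0\<close> by (intro fiber_lower_bound' [of 0]) (auto simp: b_def)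
  then have "A * N \<le> L * (C\<^sup>2 * exp (- (a * L) * real m) * B) * N"
    by (simp add: N_def b_def mult_ac)
  then have "A \<le> L * (C\<^sup>2 * exp (- (a * L) * real m) * B)"
    using \<open>N > 0\<close> by simp
  with m show False by simp
qed

text \<open>At the critical density the alternating coefficients give an antiperiodic, hence somewhere
  vanishing, function; truncating them leaves only boundary terms.\<close>

lemma not_critical: "L \<noteq> \<alpha>"
proof
  assume "L = \<alpha>"
  obtain C a where *: "a > 0" "C > 0" "\<And>x. \<bar>g x\<bar> \<le> C * exp (- (a * \<bar>x\<bar>))" "continuous_on UNIV g"
    using exp_decayE [OF g] by metis
  obtain K where K: "K > 0" "\<And>t. (LINT j|int_count. exp (- (a / 2 * \<bar>t + of_int j * L\<bar>))) \<le> K"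
    using integral_exp_abs_int_bound [OF _ L, of "a / 2"] *(1) by (metis half_gt_zero)
  \<comment> \<open>The rate per shift step that remains after half of the decay of \<open>g\<close>
    has been reserved for summing over the shifts.\<close>
  define b where "b = a * L / 2"
  have b: "b > 0" using * L by (simp add: b_def)
  obtain K3 where K3: "K3 > 0" "\<And>t. (\<integral>\<^sup>+j. ennreal (exp (- (2 * b * \<bar>t + of_int j * 1\<bar>))) \<partial>int_count) \<le> ennreal K3"
    using integral_exp_abs_int_bound [of "2 * b" 1] b by (metis mult_pos_pos zero_less_numeral zero_less_one)
  define e :: "int \<Rightarrow> real" where "e j = (if even j then 1 else - 1)" for j
  have e_add: "e (j + k) = e k * e j" for j k by (simp add: e_def)
  have e_bd: "norm (e j) \<le> 1" for j by (simp add: e_def)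
  let ?F = "fiber L g e"
  have F_shift: "?F (t - of_int k * L) = e k * ?F t" for t k
    unfolding fiber_shift [symmetric] e_add fiber_scale by (rule refl)
  have contF: "continuous_on UNIV ?F"
    by (rule continuous_on_fiber [OF g L e_bd])
  have FL: "?F 0 = - ?F L" using F_shift [of L 1] by (simp add: e_def)
  have "\<exists>x\<in>{0..L}. ?F x = 0"
  proof (cases "?F 0 \<le> 0")
    case True
    then have "\<exists>x. 0 \<le> x \<and> x \<le> L \<and> ?F x = 0"
      using FL L continuous_on_subset [OF contF] by (intro IVT') auto
    then show ?thesis by auto
  next
    case False
    then have "\<exists>x. 0 \<le> x \<and> x \<le> L \<and> ?F x = 0"
      using FL L continuous_on_subset [OF contF] by (intro IVT2') auto
    then show ?thesis by auto
  qed
  then obtain x where "x \<in> {0..L}" "?F x = 0" by blast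
  \<comment> \<open>A zero at the right end is moved to 0 by antiperiodicity, because the period is
    half-open.\<close>
  then obtain x0 where x0: "x0 \<in> {0..<L}" "?F x0 = 0"
    using FL L by (cases "x = L") (auto intro: that [of 0] that [of x])
  have F0: "?F (x0 - of_int k * L) = 0" for k by (simp add: F_shift x0)
  define C1 where "C1 = C * exp b * K"
  have C1: "C1 > 0" using * K by (simp add: C1_def)
  \<comment> \<open>Only shifts at index distance at least \<open>n\<close> from the sample
    contribute. The factor \<open>exp b\<close> in \<open>C1\<close> pays for the offset of
    \<open>x0\<close>, which is less than one step.\<close>
  have tail: "\<bar>fiber L g d (x0 - of_int k * L)\<bar> \<le> C1 * exp (- (b * real n))"
    if d: "\<And>j. \<bar>d j\<bar> \<le> 1" "\<And>j. d j \<noteq> 0 \<Longrightarrow> \<bar>j - k\<bar> \<ge> int n" for d k n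
  proof -
    let ?t = "x0 - of_int k * L"
    have id: "integrable int_count (\<lambda>j. g (?t + of_int j * L) *\<^sub>R d j)"
      using d(1) by (intro integrable_fiber [OF g L, where M = 1]) auto
    have "\<bar>fiber L g d ?t\<bar> \<le> (LINT j|int_count. \<bar>g (?t + of_int j * L) *\<^sub>R d j\<bar>)"
      unfolding fiber_def by (rule integral_abs_bound)
    also have "\<dots> \<le> (LINT j|int_count. C * exp b * exp (- (b * real n)) * exp (- (a / 2 * \<bar>?t + of_int j * L\<bar>)))"
    proof (rule integral_mono)
      show "integrable int_count (\<lambda>j. \<bar>g (?t + of_int j * L) *\<^sub>R d j\<bar>)" by (rule integrable_abs [OF id])
      show "integrable int_count (\<lambda>j. C * exp b * exp (- (b * real n)) * exp (- (a / 2 * \<bar>?t + of_int j * L\<bar>)))"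
        using * L by (intro integrable_mult_right integrable_exp_abs_shift) auto
      fix j :: int
      define u where "u = ?t + of_int j * L"
      show "\<bar>g (?t + of_int j * L) *\<^sub>R d j\<bar> \<le> C * exp b * exp (- (b * real n)) * exp (- (a / 2 * \<bar>?t + of_int j * L\<bar>))"
      proof (cases "d j = 0")
        case True
        then show ?thesis using * by simp
      next
        case False
        then have "int n \<le> \<bar>j - k\<bar>" by (rule d(2))
        then have "real n \<le> \<bar>real_of_int (j - k)\<bar>" by linarith
        then have "real n * L \<le> \<bar>real_of_int (j - k) * L\<bar>"
          using L unfolding abs_mult by (intro mult_mono) auto
        also have "real_of_int (j - k) * L = u - x0" by (simp add: u_def algebra_simps)
        also have "\<bar>u - x0\<bar> \<le> \<bar>u\<bar> + L" using x0(1) by auto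
        finally have "a / 2 * (real n * L) \<le> a / 2 * (\<bar>u\<bar> + L)"
          using * by (intro mult_left_mono) auto
        then have "exp (- (a * \<bar>u\<bar>)) \<le> exp b * exp (- (b * real n)) * exp (- (a / 2 * \<bar>u\<bar>))"
          unfolding mult_exp_exp b_def by (simp add: algebra_simps)
        then have "C * exp (- (a * \<bar>u\<bar>)) \<le> C * (exp b * exp (- (b * real n)) * exp (- (a / 2 * \<bar>u\<bar>)))"
          using * by (intro mult_left_mono) auto
        with *(3) [of u] have "\<bar>g u\<bar> \<le> C * (exp b * exp (- (b * real n)) * exp (- (a / 2 * \<bar>u\<bar>)))" by linarith
        moreover have "\<bar>g u\<bar> * \<bar>d j\<bar> \<le> \<bar>g u\<bar> * 1" using d(1) by (intro mult_left_mono) auto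
        ultimately show ?thesis unfolding u_def by (simp add: abs_mult mult.assoc)
      qed
    qed
    also have "\<dots> = C * exp b * exp (- (b * real n)) * (LINT j|int_count. exp (- (a / 2 * \<bar>?t + of_int j * L\<bar>)))"
      by (rule integral_mult_right_zero)
    also have "\<dots> \<le> C * exp b * exp (- (b * real n)) * K"
      using * by (intro mult_left_mono K) auto
    finally show ?thesis by (simp add: C1_def mult_ac)
  qed
  \<comment> \<open>The left side is the energy of \<open>2 R + 1\<close> alternating coefficients.
    The right side is the energy near the two ends of the truncation, which does not depend on
    \<open>R\<close>.\<close>
  have main: "A * (2 * real R + 1) \<le> L * (C1\<^sup>2 * (2 * K3))" for R :: nat
  proof -
    define J where "J = {- int R..int R}"
    define c where "c j = (if j \<in> J then e j else 0)" for j
    have bound: "\<bar>fiber L g c (x0 - of_int k * L)\<bar> \<le> C1 * exp (- (b * \<bar>\<bar>real_of_int k\<bar> - real R\<bar>))" for k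
    proof (cases "\<bar>k\<bar> \<le> int R")
      case True
      \<comment> \<open>For a sample inside the block the coefficients are near, so the estimate is
        made for the complementary tail: the full sum vanishes, and the two parts are
        opposite.\<close>
      define d where "d j = (if j \<in> J then 0 else e j)" for j
      have "?F t = fiber L g c t + fiber L g d t" for t
      proof -
        have "integrable int_count (\<lambda>j. g (t + of_int j * L) *\<^sub>R c j)" "integrable int_count (\<lambda>j. g (t + of_int j * L) *\<^sub>R d j)"
          by (rule integrable_fiber [OF g L, where M = 1]; simp add: c_def d_def e_def)+
        moreover have "e j = c j + d j" for j by (simp add: c_def d_def)
        ultimately show ?thesis unfolding fiber_def by (simp add: scaleR_add_right distrib_left)
      qed
      from this [of "x0 - of_int k * L"]
      have "\<bar>fiber L g c (x0 - of_int k * L)\<bar> = \<bar>fiber L g d (x0 - of_int k * L)\<bar>"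
        by (simp add: F0)
      also have "\<dots> \<le> C1 * exp (- (b * real (nat (int R - \<bar>k\<bar>))))"
        by (rule tail) (auto simp: d_def e_def J_def split: if_splits)
      also have "real (nat (int R - \<bar>k\<bar>)) = \<bar>\<bar>real_of_int k\<bar> - real R\<bar>" using True by linarith
      finally show ?thesis .
    next
      case False
      have "\<bar>fiber L g c (x0 - of_int k * L)\<bar> \<le> C1 * exp (- (b * real (nat (\<bar>k\<bar> - int R))))"
        by (rule tail) (auto simp: c_def e_def J_def split: if_splits)
      also have "real (nat (\<bar>k\<bar> - int R)) = \<bar>\<bar>real_of_int k\<bar> - real R\<bar>" using False by linarith
      finally show ?thesis .
    qed
    have "(\<integral>\<^sup>+k. ennreal ((fiber L g c (x0 - of_int k * \<alpha>))\<^sup>2) \<partial>int_count)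
      \<le> (\<integral>\<^sup>+k. ennreal (C1\<^sup>2) * (ennreal (exp (- (2 * b * \<bar>real R + of_int k * 1\<bar>))) + ennreal (exp (- (2 * b * \<bar>- real R + of_int k * 1\<bar>)))) \<partial>int_count)"
    proof (rule nn_integral_mono)
      fix k :: int
      have "\<bar>fiber L g c (x0 - of_int k * L)\<bar>\<^sup>2 \<le> (C1 * exp (- (b * \<bar>\<bar>real_of_int k\<bar> - real R\<bar>)))\<^sup>2"
        by (rule power_mono [OF bound]) simp
      also have "\<dots> = C1\<^sup>2 * exp (- (2 * b * \<bar>\<bar>real_of_int k\<bar> - real R\<bar>))"
        by (simp add: power_mult_distrib exp_double [symmetric])
      also have "\<dots> \<le> C1\<^sup>2 * (exp (- (2 * b * \<bar>real R + of_int k * 1\<bar>)) + exp (- (2 * b * \<bar>- real R + of_int k * 1\<bar>)))"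
      proof (rule mult_left_mono)
        \<comment> \<open>The distance to the nearer end is the distance to one of the two ends;
          adding the exponentials of both gives a majorant summable by \<open>K3\<close>.\<close>
        have "\<bar>\<bar>real_of_int k\<bar> - real R\<bar> = \<bar>real R + of_int k * 1\<bar> \<or> \<bar>\<bar>real_of_int k\<bar> - real R\<bar> = \<bar>- real R + of_int k * 1\<bar>"
          by linarith
        then show "exp (- (2 * b * \<bar>\<bar>real_of_int k\<bar> - real R\<bar>)) \<le> exp (- (2 * b * \<bar>real R + of_int k * 1\<bar>)) + exp (- (2 * b * \<bar>- real R + of_int k * 1\<bar>))"
          by (elim disjE) (simp_all only: add_increasing add_increasing2 exp_ge_zero order_refl)
      qed simp
      finally show "ennreal ((fiber L g c (x0 - of_int k * \<alpha>))\<^sup>2)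
        \<le> ennreal (C1\<^sup>2) * (ennreal (exp (- (2 * b * \<bar>real R + of_int k * 1\<bar>))) + ennreal (exp (- (2 * b * \<bar>- real R + of_int k * 1\<bar>))))"
        unfolding \<open>L = \<alpha>\<close> [symmetric]
        by (subst ennreal_plus [symmetric], simp, simp, subst ennreal_mult [symmetric]) (auto intro: ennreal_leI)
    qed
    also have "\<dots> = ennreal (C1\<^sup>2) * ((\<integral>\<^sup>+k. ennreal (exp (- (2 * b * \<bar>real R + of_int k * 1\<bar>))) \<partial>int_count)
        + (\<integral>\<^sup>+k. ennreal (exp (- (2 * b * \<bar>- real R + of_int k * 1\<bar>))) \<partial>int_count))"
      by (subst nn_integral_cmult, simp, subst nn_integral_add) simp_all
    also have "\<dots> \<le> ennreal (C1\<^sup>2) * (ennreal K3 + ennreal K3)"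
      by (intro mult_left_mono add_mono K3) auto
    also have "\<dots> = ennreal (C1\<^sup>2 * (2 * K3))"
      using K3(1) by (simp add: ennreal_plus [symmetric] ennreal_mult [symmetric] del: ennreal_plus)
    finally have nb: "(\<integral>\<^sup>+k. ennreal ((fiber L g c (x0 - of_int k * \<alpha>))\<^sup>2) \<partial>int_count) \<le> ennreal (C1\<^sup>2 * (2 * K3))" .
    have "A * (\<Sum>j\<in>J. (c j)\<^sup>2) \<le> L * (C1\<^sup>2 * (2 * K3))"
      by (rule fiber_lower_bound' [OF x0(1) _ _ _ nb]) (use K3(1) in \<open>auto simp: J_def c_def\<close>)
    moreover have "(\<Sum>j\<in>J. (c j)\<^sup>2) = (\<Sum>j\<in>J. 1)"
      by (intro sum.cong) (auto simp: c_def e_def)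
    moreover have "(\<Sum>j\<in>J. 1) = 2 * real R + 1" by (simp add: J_def)
    ultimately show ?thesis by simp
  qed
  obtain R :: nat where "real R \<ge> L * (C1\<^sup>2 * (2 * K3)) / A"
    using real_arch_simple by blast
  then have "L * (C1\<^sup>2 * (2 * K3)) \<le> A * real R" using A by (simp add: field_simps)
  also have "\<dots> < A * (2 * real R + 1)" using A by (intro mult_strict_left_mono) auto
  finally show False using main [of R] by simp
qed

lemma lower_bound_imp_dense: "\<alpha> < L"
  using not_oversparse not_critical by linarith

end

section \<open>Representation of totally positive functions of Gaussian type\<close>

text \<open>The transform is taken over \<open>lborel\<close>, so that Fubini, affine substitutions
  and the theory of characteristic functions apply; the passage from \<open>lebesgue\<close> is made
  once, in \<open>tp_gaussian_type_representation\<close>.\<close>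

definition fourier_borel :: "(real \<Rightarrow> complex) \<Rightarrow> real \<Rightarrow> complex" where
  "fourier_borel f \<xi> = (LINT x|lborel. f x * exp (- (2 * complex_of_real pi * \<i> * of_real x * of_real \<xi>)))"

lemma measurable_fourier_kernel [measurable]:
  "(\<lambda>x. exp (- (2 * complex_of_real pi * \<i> * of_real x * of_real \<xi>))) \<in> borel_measurable borel"
  by (intro borel_measurable_continuous_onI continuous_intros)

lemma norm_fourier_kernel: "norm (exp (- (2 * complex_of_real pi * \<i> * of_real x * of_real \<xi>))) = 1"
  by (subst norm_exp_eq_Re) simp

lemma integrable_fourier_kernel:
  assumes "integrable lborel f"
  shows "integrable lborel (\<lambda>x. f x * exp (- (2 * complex_of_real pi * \<i> * of_real x * of_real \<xi>)))"
proof (rule Bochner_Integration.integrable_bound [OF assms])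
  have [measurable]: "f \<in> borel_measurable borel" using assms by auto
  show "(\<lambda>x. f x * exp (- (2 * complex_of_real pi * \<i> * of_real x * of_real \<xi>))) \<in> borel_measurable lborel"
    by measurable
qed (simp add: norm_mult norm_fourier_kernel)

text \<open>Rescaling by \<sigma> turns the integral into the characteristic function of the
  standard normal law at frequency \<open>- 2 * pi * \<sigma> * \<xi>\<close>.\<close>

lemma fourier_gaussian:
  assumes "\<sigma> > 0"
  shows "fourier_borel (\<lambda>x. of_real (normal_density 0 \<sigma> x)) \<xi> = of_real (exp (- (2 * pi\<^sup>2 * \<sigma>\<^sup>2) * \<xi>\<^sup>2))"
proof -
  let ?t = "- (2 * pi * \<sigma> * \<xi>)"
  have "fourier_borel (\<lambda>x. of_real (normal_density 0 \<sigma> x)) \<xi>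
     = \<sigma> *\<^sub>R (LINT x|lborel. of_real (normal_density 0 \<sigma> (0 + \<sigma> * x)) * exp (- (2 * complex_of_real pi * \<i> * of_real (0 + \<sigma> * x) * of_real \<xi>)))"
    unfolding fourier_borel_def
    using lborel_integral_real_affine [of \<sigma> "\<lambda>x. of_real (normal_density 0 \<sigma> x) * exp (- (2 * complex_of_real pi * \<i> * of_real x * of_real \<xi>))" 0] assms
    by simp
  also have "\<dots> = (LINT x|lborel. \<sigma> *\<^sub>R (of_real (normal_density 0 \<sigma> (0 + \<sigma> * x)) * exp (- (2 * complex_of_real pi * \<i> * of_real (0 + \<sigma> * x) * of_real \<xi>))))"
    by simp
  also have "\<dots> = (LINT x|lborel. std_normal_density x *\<^sub>R iexp (?t * x))"
  proof (rule Bochner_Integration.integral_cong [OF refl])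
    fix x
    have "\<sigma> * normal_density 0 \<sigma> (0 + \<sigma> * x) = std_normal_density x"
      using assms by (simp add: normal_density_def real_sqrt_mult power_mult_distrib)
    then show "\<sigma> *\<^sub>R (of_real (normal_density 0 \<sigma> (0 + \<sigma> * x)) * exp (- (2 * complex_of_real pi * \<i> * of_real (0 + \<sigma> * x) * of_real \<xi>)))
      = std_normal_density x *\<^sub>R iexp (?t * x)"
      by (simp add: scaleR_conv_of_real mult.assoc [symmetric] of_real_mult [symmetric] del: of_real_mult)
        (simp add: mult_ac)
  qed
  also have "\<dots> = char std_normal_distribution ?t"
    unfolding char_def by (subst integral_density) auto
  also have "\<dots> = of_real (exp (- (2 * pi\<^sup>2 * \<sigma>\<^sup>2) * \<xi>\<^sup>2))"
    by (simp add: char_std_normal_distribution power_mult_distrib mult_ac)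
  finally show ?thesis .
qed

text \<open>Evaluated on \<open>[0, n]\<close> by an antiderivative; the boundary term has modulus
  \<open>exp (- n)\<close> because \<open>Re k = 1\<close>.\<close>

lemma exp_law_transform:
  "(LINT s|expd. exp (- (\<i> * of_real w * of_real s))) = inverse (1 + \<i> * of_real w)"
proof -
  define k where "k = 1 + \<i> * of_real w"
  have k: "k \<noteq> 0" "Re k = 1" by (simp_all add: k_def complex_eq_iff)
  have nk: "norm (exp (- (k * of_real s))) = exp (- s)" for s :: real
    by (subst norm_exp_eq_Re) (simp add: k_def)
  have "(LINT s|expd. exp (- (\<i> * of_real w * of_real s)))
     = (LINT s|lborel. exponential_density 1 s *\<^sub>R exp (- (\<i> * of_real w * of_real s)))"
    by (subst integral_density) (auto simp: exponential_density_nonneg)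
  also have "\<dots> = (LINT s|lborel. indicator {0..} s *\<^sub>R exp (- (k * of_real s)))"
    by (intro Bochner_Integration.integral_cong [OF refl])
      (auto simp: exponential_density_def indicator_def k_def scaleR_conv_of_real exp_of_real mult_exp_exp algebra_simps
        simp flip: exp_of_real)
  finally have E: "(LINT s|expd. exp (- (\<i> * of_real w * of_real s)))
     = (LINT s|lborel. indicator {0..} s *\<^sub>R exp (- (k * of_real s)))" .
  have "(\<lambda>n. LINT s|lborel. indicator {0..real n} s *\<^sub>R exp (- (k * of_real s)))
      \<longlonglongrightarrow> (LINT s|lborel. indicator {0..} s *\<^sub>R exp (- (k * of_real s)))"
  proof (rule integral_dominated_convergence [where w = "exponential_density 1"])
    show "integrable lborel (exponential_density 1)"
      using expd.integrable_const [of "1::real"]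
      by (subst (asm) integrable_density) (auto simp: exponential_density_nonneg)
    show "AE s in lborel. (\<lambda>n. indicator {0..real n} s *\<^sub>R exp (- (k * of_real s))) \<longlonglongrightarrow> indicator {0..} s *\<^sub>R exp (- (k * of_real s))"
    proof (intro AE_I2 tendsto_eventually)
      fix s :: real
      show "\<forall>\<^sub>F n in sequentially. indicator {0..real n} s *\<^sub>R exp (- (k * of_real s)) = indicator {0..} s *\<^sub>R exp (- (k * of_real s))"
        using eventually_ge_at_top [of "nat \<lceil>s\<rceil>"]
      proof eventually_elim
        case (elim n)
        then have "s \<le> real n" by linarith
        then show ?case by (simp add: indicator_def)
      qed
    qed
    show "AE s in lborel. norm (indicator {0..real n} s *\<^sub>R exp (- (k * of_real s))) \<le> exponential_density 1 s" for n
      by (intro AE_I2) (simp add: indicator_def exponential_density_def k)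
  qed auto
  moreover have "(LINT s|lborel. indicator {0..real n} s *\<^sub>R exp (- (k * of_real s))) = (1 - exp (- (k * of_real (real n)))) / k" for n
  proof -
    have "(LINT s|lborel. indicator {0..real n} s *\<^sub>R exp (- (k * of_real s)))
       = - exp (- (k * of_real (real n))) / k - (- exp (- (k * of_real 0)) / k)"
    proof (rule integral_FTC_Icc)
      show "continuous_on {0..real n} (\<lambda>s. exp (- (k * of_real s)))" by (intro continuous_intros)
      fix s :: real
      have "((\<lambda>s. - exp (- (k * s)) / k) has_field_derivative exp (- (k * of_real s))) (at (of_real s))"
        using k by (auto intro!: derivative_eq_intros)
      then have "((\<lambda>s. - exp (- (k * of_real s)) / k) has_vector_derivative exp (- (k * of_real s))) (at s)"
        by (rule has_vector_derivative_real_field)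
      then show "((\<lambda>s. - exp (- (k * of_real s)) / k) has_vector_derivative exp (- (k * of_real s))) (at s within {0..real n})"
        by (rule has_vector_derivative_at_within)
    qed simp
    then show ?thesis by (simp add: diff_divide_distrib)
  qed
  moreover have "(\<lambda>n. (1 - exp (- (k * of_real (real n)))) / k) \<longlonglongrightarrow> (1 - 0) / k"
  proof (intro tendsto_intros k(1))
    have "(\<lambda>n. exp (- real n)) \<longlonglongrightarrow> 0" by real_asymp
    then show "(\<lambda>n. exp (- (k * of_real (real n)))) \<longlonglongrightarrow> 0"
      by (intro tendsto_norm_zero_cancel [of "\<lambda>n. exp (- (k * of_real (real n)))"]) (simp only: nk)
  qed
  ultimately have "(LINT s|lborel. indicator {0..} s *\<^sub>R exp (- (k * of_real s))) = (1 - 0) / k"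
    using LIMSEQ_unique by auto
  then show ?thesis unfolding E k_def by (simp add: divide_inverse)
qed

text \<open>The convolution theorem for the law of \<delta> times an exponential variable: Fubini,
  then a translation for each value \<open>s\<close> of the variable, whose phases integrate to
  \<open>exp_law_transform\<close>.\<close>

lemma fourier_exp_avg:
  assumes g: "exp_decay g"
  shows "fourier_borel (\<lambda>x. of_real (exp_avg \<delta> g x)) \<xi>
    = inverse (1 + 2 * complex_of_real pi * \<i> * of_real \<delta> * of_real \<xi>) * fourier_borel (\<lambda>x. of_real (g x)) \<xi>"
proof -
  let ?e = "\<lambda>x. exp (- (2 * complex_of_real pi * \<i> * of_real x * of_real \<xi>))"
  have cont: "continuous_on UNIV g" using g by (simp add: exp_decay_def)
  have [measurable]: "g \<in> borel_measurable borel" by (rule borel_measurable_continuous_onI [OF cont])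
  have intg: "integrable lborel g" by (rule exp_decay_integrable [OF g])
  interpret P: pair_sigma_finite lborel expd ..
  have meas: "(\<lambda>(x, s). complex_of_real (g (x - \<delta> * s)) * ?e x) \<in> borel_measurable (lborel \<Otimes>\<^sub>M expd)"
  proof -
    have "(\<lambda>(x, s). complex_of_real (g (x - \<delta> * s)) * ?e x) \<in> borel_measurable (lborel \<Otimes>\<^sub>M lborel)"
      by measurable
    also have "borel_measurable (lborel \<Otimes>\<^sub>M lborel) = (borel_measurable (lborel \<Otimes>\<^sub>M expd) :: (real \<times> real \<Rightarrow> complex) set)"
      by (intro measurable_cong_sets sets_pair_measure_cong) auto
    finally show ?thesis .
  qed
  have int: "integrable (lborel \<Otimes>\<^sub>M expd) (\<lambda>(x, s). complex_of_real (g (x - \<delta> * s)) * ?e x)"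
  proof (rule integrableI_bounded [OF meas])
    have mn: "(\<lambda>z. ennreal (norm (case z of (x, s) \<Rightarrow> complex_of_real (g (x - \<delta> * s)) * ?e x))) \<in> borel_measurable (lborel \<Otimes>\<^sub>M expd)"
      by (rule measurable_compose [OF meas]) measurable
    have "(\<integral>\<^sup>+z. ennreal (norm (case z of (x, s) \<Rightarrow> complex_of_real (g (x - \<delta> * s)) * ?e x)) \<partial>(lborel \<Otimes>\<^sub>M expd))
       = (\<integral>\<^sup>+s. (\<integral>\<^sup>+x. ennreal (norm (complex_of_real (g (x - \<delta> * s)) * ?e x)) \<partial>lborel) \<partial>expd)"
      using P.nn_integral_snd [OF mn] by simp
    also have "\<dots> = (\<integral>\<^sup>+s. (\<integral>\<^sup>+x. ennreal (norm (g x)) \<partial>lborel) \<partial>expd)"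
    proof (rule nn_integral_cong)
      fix s
      show "(\<integral>\<^sup>+x. ennreal (norm (complex_of_real (g (x - \<delta> * s)) * ?e x)) \<partial>lborel) = (\<integral>\<^sup>+x. ennreal (norm (g x)) \<partial>lborel)"
        using nn_integral_translate [of "\<lambda>x. ennreal (norm (g x))" "- (\<delta> * s)"]
        by (simp add: norm_mult norm_fourier_kernel)
    qed
    also have "\<dots> = (\<integral>\<^sup>+x. ennreal (norm (g x)) \<partial>lborel)"
      using expd.emeasure_space_1 by simp
    also have "\<dots> < \<infinity>" using intg by (simp add: integrable_iff_bounded)
    finally show "(\<integral>\<^sup>+z. ennreal (norm (case z of (x, s) \<Rightarrow> complex_of_real (g (x - \<delta> * s)) * ?e x)) \<partial>(lborel \<Otimes>\<^sub>M expd)) < \<infinity>" .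
  qed
  have "fourier_borel (\<lambda>x. of_real (exp_avg \<delta> g x)) \<xi> = (LINT x|lborel. LINT s|expd. complex_of_real (g (x - \<delta> * s)) * ?e x)"
    unfolding fourier_borel_def exp_avg_def by simp
  also have "\<dots> = (LINT s|expd. LINT x|lborel. complex_of_real (g (x - \<delta> * s)) * ?e x)"
    using P.Fubini_integral [OF int] by simp
  also have "\<dots> = (LINT s|expd. exp (- (\<i> * of_real (2 * pi * \<delta> * \<xi>) * of_real s)) * fourier_borel (\<lambda>x. of_real (g x)) \<xi>)"
  proof (rule Bochner_Integration.integral_cong [OF refl])
    fix s
    have "(LINT x|lborel. complex_of_real (g (x - \<delta> * s)) * ?e x)
      = (LINT x|lborel. complex_of_real (g (\<delta> * s + 1 * x - \<delta> * s)) * ?e (\<delta> * s + 1 * x))"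
      using lborel_integral_real_affine [of 1 "\<lambda>x. complex_of_real (g (x - \<delta> * s)) * ?e x" "\<delta> * s"] by simp
    also have "\<dots> = (LINT x|lborel. exp (- (\<i> * of_real (2 * pi * \<delta> * \<xi>) * of_real s)) * (complex_of_real (g x) * ?e x))"
    proof (rule Bochner_Integration.integral_cong [OF refl])
      fix x
      have "?e (\<delta> * s + 1 * x) = exp (- (\<i> * of_real (2 * pi * \<delta> * \<xi>) * of_real s)) * ?e x"
        unfolding mult_exp_exp by (simp add: algebra_simps)
      then show "complex_of_real (g (\<delta> * s + 1 * x - \<delta> * s)) * ?e (\<delta> * s + 1 * x)
        = exp (- (\<i> * of_real (2 * pi * \<delta> * \<xi>) * of_real s)) * (complex_of_real (g x) * ?e x)"
        by (simp only: add_diff_cancel_left' mult_1) (simp only: mult_ac)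
    qed
    finally show "(LINT x|lborel. complex_of_real (g (x - \<delta> * s)) * ?e x)
      = exp (- (\<i> * of_real (2 * pi * \<delta> * \<xi>) * of_real s)) * fourier_borel (\<lambda>x. of_real (g x)) \<xi>"
      unfolding fourier_borel_def by (simp only: integral_mult_right_zero)
  qed
  also have "\<dots> = inverse (1 + \<i> * of_real (2 * pi * \<delta> * \<xi>)) * fourier_borel (\<lambda>x. of_real (g x)) \<xi>"
    by (simp only: integral_mult_left_zero exp_law_transform)
  finally show ?thesis by (simp add: mult_ac)
qed

lemma fourier_exp_avgs:
  assumes "exp_decay g"
  shows "fourier_borel (\<lambda>x. of_real (exp_avgs \<delta> g n x)) \<xi>
    = (\<Prod>j=1..n. inverse (1 + 2 * complex_of_real pi * \<i> * of_real (\<delta> j) * of_real \<xi>)) * fourier_borel (\<lambda>x. of_real (g x)) \<xi>"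
  by (induction n) (simp_all add: fourier_exp_avg [OF exp_decay_exp_avgs [OF assms]] mult_ac)

text \<open>The positive and negative parts have equal transforms, hence at frequency 0 equal mass
  \<open>m\<close>. Divided by \<open>m\<close> they are densities of probability laws with the same
  characteristic function, so Levy's uniqueness theorem identifies them; mass 0 is treated
  separately.\<close>

lemma AE_zero_of_char_zero:
  fixes r :: "real \<Rightarrow> real"
  assumes int: "integrable lborel r" and zero: "\<And>t. (LINT x|lborel. r x *\<^sub>R iexp (t * x)) = 0"
  shows "AE x in lborel. r x = 0"
proof -
  have [measurable]: "r \<in> borel_measurable borel" using int by auto
  define p where "p x = max (r x) 0" for x
  define q where "q x = max (- r x) 0" for x
  have pq: "r x = p x - q x" "p x \<ge> 0" "q x \<ge> 0" for x by (auto simp: p_def q_def)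
  have [measurable]: "p \<in> borel_measurable borel" "q \<in> borel_measurable borel"
    unfolding p_def q_def by measurable
  have ip: "integrable lborel p" and iq: "integrable lborel q"
    by (rule Bochner_Integration.integrable_bound [OF int]; force simp: p_def q_def)+
  have mi: "integrable lborel (\<lambda>x. u x *\<^sub>R iexp (t * x))" if "integrable lborel u" for u :: "real \<Rightarrow> real" and t
  proof (rule Bochner_Integration.integrable_bound [OF that])
    have [measurable]: "u \<in> borel_measurable borel" using that by auto
    show "(\<lambda>x. u x *\<^sub>R iexp (t * x)) \<in> borel_measurable lborel" by measurable
  qed simp
  have eq: "(LINT x|lborel. p x *\<^sub>R iexp (t * x)) = (LINT x|lborel. q x *\<^sub>R iexp (t * x))" for t
  proof -
    have "(LINT x|lborel. r x *\<^sub>R iexp (t * x)) = (LINT x|lborel. p x *\<^sub>R iexp (t * x)) - (LINT x|lborel. q x *\<^sub>R iexp (t * x))"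
      unfolding pq(1) scaleR_diff_left by (intro Bochner_Integration.integral_diff mi ip iq)
    then show ?thesis using zero by simp
  qed
  define m where "m = (LINT x|lborel. p x)"
  have m: "m = (LINT x|lborel. q x)"
    using eq [of 0] by (simp add: m_def scaleR_conv_of_real)
  have "m \<ge> 0" unfolding m_def using pq by (intro integral_nonneg_AE) auto
  show ?thesis
  proof (cases "m = 0")
    case True
    then have "AE x in lborel. p x = 0" "AE x in lborel. q x = 0"
      using integral_nonneg_eq_0_iff_AE [OF ip] integral_nonneg_eq_0_iff_AE [OF iq] pq m m_def by auto
    then show ?thesis by eventually_elim (simp add: pq(1))
  next
    case False
    with \<open>m \<ge> 0\<close> have "m > 0" by simp
    have dist: "real_distribution (density lborel (\<lambda>x. ennreal (u x / m)))"
      if "integrable lborel u" "\<And>x. u x \<ge> 0" "(LINT x|lborel. u x) = m" for u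
    proof -
      have "emeasure (density lborel (\<lambda>x. ennreal (u x / m))) (space (density lborel (\<lambda>x. ennreal (u x / m)))) = 1"
      proof -
        have [measurable]: "u \<in> borel_measurable borel" using that by auto
        have "emeasure (density lborel (\<lambda>x. ennreal (u x / m))) UNIV = (\<integral>\<^sup>+x. ennreal (u x / m) \<partial>lborel)"
          by (subst emeasure_density) auto
        also have "\<dots> = ennreal (LINT x|lborel. u x / m)"
          using that \<open>m > 0\<close> by (intro nn_integral_eq_integral) auto
        also have "\<dots> = 1" using that \<open>m > 0\<close> by simp
        finally show ?thesis by simp
      qed
      then interpret prob_space "density lborel (\<lambda>x. ennreal (u x / m))" by (rule prob_spaceI)
      show ?thesis by unfold_locales auto
    qed
    have char: "char (density lborel (\<lambda>x. ennreal (u x / m))) t = (1 / m) *\<^sub>R (LINT x|lborel. u x *\<^sub>R iexp (t * x))"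
      if "integrable lborel u" "\<And>x. u x \<ge> 0" for u t
    proof -
      have [measurable]: "u \<in> borel_measurable borel" using that by auto
      have "char (density lborel (\<lambda>x. ennreal (u x / m))) t = (LINT x|lborel. (u x / m) *\<^sub>R iexp (t * x))"
        unfolding char_def using that \<open>m > 0\<close> by (subst integral_density) auto
      also have "\<dots> = (LINT x|lborel. (1 / m) *\<^sub>R (u x *\<^sub>R iexp (t * x)))" by simp
      finally show ?thesis by (simp only: integral_scaleR_right)
    qed
    have "density lborel (\<lambda>x. ennreal (p x / m)) = density lborel (\<lambda>x. ennreal (q x / m))"
    proof (rule Levy_uniqueness)
      show "real_distribution (density lborel (\<lambda>x. ennreal (p x / m)))"
        using ip pq m_def by (intro dist) auto
      show "real_distribution (density lborel (\<lambda>x. ennreal (q x / m)))"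
        using iq pq m by (intro dist) auto
      show "char (density lborel (\<lambda>x. ennreal (p x / m))) = char (density lborel (\<lambda>x. ennreal (q x / m)))"
        by (rule ext) (simp only: char [OF ip pq(2)] char [OF iq pq(3)] eq)
    qed
    then have "AE x in lborel. ennreal (p x / m) = ennreal (q x / m)"
      by (intro sigma_finite_measure.density_unique [OF lborel.sigma_finite_measure_axioms]) auto
    then show ?thesis
    proof eventually_elim
      case (elim x)
      then have "p x / m = q x / m" using pq(2,3) \<open>m > 0\<close> by simp
      then show ?case using \<open>m > 0\<close> by (simp add: pq(1))
    qed
  qed
qed

text \<open>The transform of the conjugate is the reflected conjugate transform and vanishes as
  well, so real and imaginary part fall under the real case.\<close>

lemma AE_zero_of_fourier_zero:
  assumes int: "integrable lborel d" and zero: "\<And>\<xi>. fourier_borel d \<xi> = 0"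
  shows "AE x in lborel. d x = 0"
proof -
  have [measurable]: "d \<in> borel_measurable borel" using int by auto
  have D: "(LINT x|lborel. d x * iexp (t * x)) = 0" for t
  proof -
    have "(LINT x|lborel. d x * iexp (t * x)) = fourier_borel d (- t / (2 * pi))"
      unfolding fourier_borel_def by (intro Bochner_Integration.integral_cong) (auto simp: mult_ac)
    then show ?thesis using zero by simp
  qed
  have i: "integrable lborel (\<lambda>x. u x * iexp (t * x))" if "integrable lborel u" for u t
  proof (rule Bochner_Integration.integrable_bound [OF that])
    have [measurable]: "u \<in> borel_measurable borel" using that by auto
    show "(\<lambda>x. u x * iexp (t * x)) \<in> borel_measurable lborel" by measurable
  qed (simp add: norm_mult)
  have C: "(LINT x|lborel. cnj (d x) * iexp (t * x)) = 0" for t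
  proof -
    have "(LINT x|lborel. cnj (d x) * iexp (t * x)) = (LINT x|lborel. cnj (d x * iexp (- t * x)))"
      by (intro Bochner_Integration.integral_cong) (auto simp: exp_cnj)
    also have "\<dots> = cnj (LINT x|lborel. d x * iexp (- t * x))"
      by (rule Bochner_Integration.integral_cnj)
    also have "\<dots> = 0" by (simp only: D complex_cnj_zero)
    finally show ?thesis .
  qed
  have "AE x in lborel. Re (d x) = 0"
  proof (rule AE_zero_of_char_zero)
    show "integrable lborel (\<lambda>x. Re (d x))" using int by simp
    fix t
    have "(LINT x|lborel. Re (d x) *\<^sub>R iexp (t * x)) = (LINT x|lborel. (1/2) * (d x * iexp (t * x) + cnj (d x) * iexp (t * x)))"
      by (intro Bochner_Integration.integral_cong) (auto simp: complex_add_cnj scaleR_conv_of_real distrib_right [symmetric])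
    also have "\<dots> = (1/2) * ((LINT x|lborel. d x * iexp (t * x)) + (LINT x|lborel. cnj (d x) * iexp (t * x)))"
      by (subst integral_mult_right_zero, subst Bochner_Integration.integral_add) (intro i int integrable_cnj refl)+
    also have "\<dots> = 0" by (simp only: D C) simp
    finally show "(LINT x|lborel. Re (d x) *\<^sub>R iexp (t * x)) = 0" .
  qed
  moreover have "AE x in lborel. Im (d x) = 0"
  proof (rule AE_zero_of_char_zero)
    show "integrable lborel (\<lambda>x. Im (d x))" using int by simp
    fix t
    have "(LINT x|lborel. Im (d x) *\<^sub>R iexp (t * x)) = (LINT x|lborel. (1/(2 * \<i>)) * (d x * iexp (t * x) - cnj (d x) * iexp (t * x)))"
    proof (rule Bochner_Integration.integral_cong [OF refl])
      fix x
      have "d x - cnj (d x) = 2 * \<i> * of_real (Im (d x))" by (simp add: complex_eq_iff)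
      then show "Im (d x) *\<^sub>R iexp (t * x) = (1/(2 * \<i>)) * (d x * iexp (t * x) - cnj (d x) * iexp (t * x))"
        unfolding left_diff_distrib [symmetric] by (simp add: scaleR_conv_of_real)
    qed
    also have "\<dots> = (1/(2 * \<i>)) * ((LINT x|lborel. d x * iexp (t * x)) - (LINT x|lborel. cnj (d x) * iexp (t * x)))"
      by (subst integral_mult_right_zero, subst Bochner_Integration.integral_diff) (intro i int integrable_cnj refl)+
    also have "\<dots> = 0" by (simp only: D C) simp
    finally show "(LINT x|lborel. Im (d x) *\<^sub>R iexp (t * x)) = 0" .
  qed
  ultimately show ?thesis
    by eventually_elim (simp add: complex_eq_iff)
qed

text \<open>The statement speaks of Lebesgue measurable functions, while Tonelli and periodization
  are carried out for Borel functions over \<open>lborel\<close>.\<close>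

lemma borel_representative:
  assumes "f \<in> borel_measurable lebesgue"
  obtains f' :: "real \<Rightarrow> complex" where "f' \<in> borel_measurable borel" "AE x in lebesgue. f x = f' x"
proof -
  have "(\<lambda>x. Re (f x)) \<in> borel_measurable lebesgue" "(\<lambda>x. Im (f x)) \<in> borel_measurable lebesgue"
    using assms by measurable
  then obtain a b where a: "a \<in> borel_measurable lborel" "AE x in lborel. Re (f x) = a x"
    and b: "b \<in> borel_measurable lborel" "AE x in lborel. Im (f x) = b x"
    using completion_ex_borel_measurable_real by metis
  have "AE x in lborel. f x = of_real (a x) + \<i> * of_real (b x)"
    using a(2) b(2) by eventually_elim (simp add: complex_eq_iff)
  then have "AE x in lebesgue. f x = of_real (a x) + \<i> * of_real (b x)"
    by (rule AE_completion)
  moreover have "(\<lambda>x. of_real (a x) + \<i> * of_real (b x)) \<in> borel_measurable borel"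
    using a(1) b(1) by measurable
  ultimately show thesis using that by blast
qed

text \<open>Both sides have the same transform and are integrable, so uniqueness identifies them
  a.e. In particular the generator is a.e. real and exponentially decaying.\<close>

lemma tp_gaussian_type_representation:
  assumes "tp_gaussian_type g"
  obtains n \<delta> a A where "a > 0" "A \<noteq> 0"
    "AE x in lebesgue. g x = of_real (exp_avgs \<delta> (\<lambda>x. A * exp (- (a * x\<^sup>2))) n x)"
proof -
  from assms obtain n :: nat and \<delta> :: "nat \<Rightarrow> real" and c :: real where int: "integrable lebesgue g" and "c > 0"
    and F: "\<And>\<xi>. fourier g \<xi> = (\<Prod>j=1..n. inverse (1 + 2 * complex_of_real pi * \<i> * of_real (\<delta> j) * of_real \<xi>))
           * of_real (exp (- c * \<xi>^2))"
    unfolding tp_gaussian_type_def by blast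
  obtain g' where g' [measurable]: "g' \<in> borel_measurable borel" and AEg: "AE x in lebesgue. g x = g' x"
    using borel_representative [OF borel_measurable_integrable [OF int]] by blast
  have g'l [measurable]: "g' \<in> borel_measurable lebesgue"
    by (rule measurable_completion) simp
  have "integrable lebesgue g'"
    using int AEg by (subst integrable_cong_AE [of _ _ g]) (auto elim: AE_mp)
  then have intg': "integrable lborel g'"
    by (subst (asm) integrable_completion) auto
  \<comment> \<open>The solution of \<open>2 * pi\<^sup>2 * \<sigma>\<^sup>2 = c\<close>, which
    matches the exponent in \<open>fourier_gaussian\<close>.\<close>
  define \<sigma> where "\<sigma> = sqrt (c / 2) / pi"
  have \<sigma>: "\<sigma> > 0" using \<open>c > 0\<close> by (simp add: \<sigma>_def)
  have c_eq: "2 * pi\<^sup>2 * \<sigma>\<^sup>2 = c" using \<open>c > 0\<close> by (simp add: \<sigma>_def power_divide)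
  define a A where "a = 1 / (2 * \<sigma>\<^sup>2)" and "A = 1 / sqrt (2 * pi * \<sigma>\<^sup>2)"
  have aA: "a > 0" "A \<noteq> 0" using \<sigma> by (auto simp: a_def A_def)
  have nd: "normal_density 0 \<sigma> = (\<lambda>x. A * exp (- (a * x\<^sup>2)))"
    by (rule ext) (simp add: normal_density_def a_def A_def)
  let ?g = "exp_avgs \<delta> (\<lambda>x. A * exp (- (a * x\<^sup>2))) n"
  have dec: "exp_decay ?g" by (intro exp_decay_exp_avgs exp_decay_gaussian aA)
  have intg: "integrable lborel (\<lambda>x. complex_of_real (?g x))"
    using exp_decay_integrable [OF dec] by simp
  have "fourier_borel (\<lambda>x. g' x - of_real (?g x)) \<xi> = 0" for \<xi>
  proof -
    let ?e = "\<lambda>x. exp (- (2 * complex_of_real pi * \<i> * of_real x * of_real \<xi>))"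
    have me: "?e \<in> borel_measurable lebesgue"
      by (rule measurable_completion) simp
    have gl: "g \<in> borel_measurable lebesgue" using int by (rule borel_measurable_integrable)
    have "fourier g \<xi> = (LINT x|lebesgue. g' x * ?e x)"
      unfolding fourier_def
    proof (rule integral_cong_AE)
      show "(\<lambda>x. g x * ?e x) \<in> borel_measurable lebesgue" "(\<lambda>x. g' x * ?e x) \<in> borel_measurable lebesgue"
        by (intro borel_measurable_times me gl g'l)+
      show "AE x in lebesgue. g x * ?e x = g' x * ?e x"
        using AEg by eventually_elim simp
    qed
    also have "\<dots> = fourier_borel g' \<xi>"
      unfolding fourier_borel_def by (rule integral_completion) measurable
    finally have "fourier_borel g' \<xi> = fourier_borel (\<lambda>x. of_real (?g x)) \<xi>"
      using fourier_gaussian [OF \<sigma>, of \<xi>]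
      by (simp add: F fourier_exp_avgs exp_decay_gaussian aA nd c_eq)
    then show ?thesis
      unfolding fourier_borel_def left_diff_distrib
      by (subst Bochner_Integration.integral_diff) (intro integrable_fourier_kernel intg' intg | simp)+
  qed
  then have "AE x in lborel. g' x - of_real (?g x) = 0"
    by (intro AE_zero_of_fourier_zero Bochner_Integration.integrable_diff intg' intg)
  then have "AE x in lebesgue. g' x - of_real (?g x) = 0"
    by (rule AE_completion)
  with AEg have "AE x in lebesgue. g x = of_real (?g x)"
    by eventually_elim simp
  with aA that show thesis by blast
qed

section \<open>Frame bounds\<close>

lemma AE_lebesgue_translate:
  assumes "AE x in lebesgue. P x"
  shows "AE x in lebesgue. P (x - s :: real)"
proof -
  have "AE x in lborel. P x" using assms by (simp add: AE_completion_iff)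
  then obtain N where N: "N \<in> null_sets lborel" "{x \<in> space lborel. \<not> P x} \<subseteq> N"
    by (auto simp: eventually_ae_filter)
  have "{x. x - s \<in> N} \<in> null_sets lborel" by (rule null_sets_translation [OF N(1)])
  moreover have "{x \<in> space lborel. \<not> P (x - s)} \<subseteq> {x. x - s \<in> N}" using N(2) by auto
  ultimately have "AE x in lborel. P (x - s)" by (auto simp: eventually_ae_filter)
  then show ?thesis by (rule AE_completion)
qed

text \<open>Bridge between iterated counting integrals in \<open>ennreal\<close> and the real
  \<open>infsum\<close> over a set of points of the plane; positive steps make the parametrization
  of the lattice by pairs of integers injective.\<close>

lemma infsum_rect_lattice:
  fixes h :: "real \<times> real \<Rightarrow> real"
  assumes "\<alpha> > 0" "\<beta> > 0" "\<And>i. h i \<ge> 0" "S \<ge> 0"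
    and S: "(\<integral>\<^sup>+k. (\<integral>\<^sup>+l. ennreal (h (\<alpha> * of_int k, \<beta> * of_int l)) \<partial>int_count) \<partial>int_count) = ennreal S"
  shows "h summable_on rect_lattice \<alpha> \<beta>" "(\<Sum>\<^sub>\<infinity>i\<in>rect_lattice \<alpha> \<beta>. h i) = S"
proof -
  define \<phi> :: "int \<times> int \<Rightarrow> real \<times> real" where "\<phi> p = (\<alpha> * of_int (fst p), \<beta> * of_int (snd p))" for p
  have inj: "inj \<phi>" using assms by (auto simp: \<phi>_def inj_on_def prod_eq_iff)
  have range: "rect_lattice \<alpha> \<beta> = range \<phi>"
    by (auto simp: rect_lattice_def \<phi>_def image_iff)
  have nn: "(\<integral>\<^sup>+p. ennreal (h (\<phi> p)) \<partial>count_space UNIV) = ennreal S"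
    using S nn_integral_fst_count_space [of "\<lambda>p. ennreal (h (\<phi> p))"] by (simp add: \<phi>_def)
  have int: "integrable (count_space UNIV) (\<lambda>p. h (\<phi> p))"
    by (rule integrableI_nonneg) (use assms nn in auto)
  then have abs: "Infinite_Set_Sum.abs_summable_on (\<lambda>p. h (\<phi> p)) UNIV"
    by (simp add: abs_summable_on_def)
  then have sum: "(\<lambda>p. h (\<phi> p)) summable_on UNIV"
    using assms(3) by (simp add: abs_summable_equivalent [symmetric])
  have "infsum (\<lambda>p. h (\<phi> p)) UNIV = (LINT p|count_space UNIV. h (\<phi> p))"
    using infsetsum_infsum [OF abs] by (simp add: infsetsum_def)
  also have "\<dots> = enn2real (\<integral>\<^sup>+p. ennreal (h (\<phi> p)) \<partial>count_space UNIV)"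
    using assms by (intro integral_eq_nn_integral) auto
  also have "\<dots> = S" using assms by (simp add: nn)
  finally have inf: "infsum (\<lambda>p. h (\<phi> p)) UNIV = S" .
  show "h summable_on rect_lattice \<alpha> \<beta>"
    unfolding range using summable_on_reindex [OF inj, of h] sum by (simp add: comp_def)
  show "(\<Sum>\<^sub>\<infinity>i\<in>rect_lattice \<alpha> \<beta>. h i) = S"
    unfolding range using infsum_reindex [OF inj, of h] inf by (simp add: comp_def)
qed

text \<open>Since \<open>g\<close> is real, real and imaginary parts of the coefficients do not mix.
  This is how the stability estimate passes from real to complex sequences.\<close>

lemma fiber_Re_Im:
  assumes g: "exp_decay g" and L: "L > 0" and c: "\<And>j. norm (c j :: complex) \<le> M"
  shows "(norm (fiber L g c t))\<^sup>2 = (fiber L g (\<lambda>j. Re (c j)) t)\<^sup>2 + (fiber L g (\<lambda>j. Im (c j)) t)\<^sup>2"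
proof -
  have int: "integrable int_count (\<lambda>j. g (t + of_int j * L) *\<^sub>R c j)"
    by (rule integrable_fiber [OF g L c])
  have "Re (fiber L g c t) = fiber L g (\<lambda>j. Re (c j)) t" "Im (fiber L g c t) = fiber L g (\<lambda>j. Im (c j)) t"
    unfolding fiber_def by (simp_all add: integral_Re [OF int, symmetric] integral_Im [OF int, symmetric])
  then show ?thesis by (simp add: cmod_power2)
qed

section \<open>The frame sum of a generator that is a.e. real and exponentially decaying\<close>

context
  fixes g :: "real \<Rightarrow> complex" and W :: "real \<Rightarrow> real" and \<alpha> \<beta> :: real
  assumes g: "g \<in> borel_measurable lebesgue" and AEg: "AE x in lebesgue. g x = of_real (W x)"
    and W: "exp_decay W" and \<alpha>: "\<alpha> > 0" and \<beta>: "\<beta> > 0"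
begin

text \<open>The frame sum for a Borel function, with the generator replaced by its real
  representative. As an extended nonnegative number it can be compared before convergence is
  known.\<close>

definition gabor_energy :: "(real \<Rightarrow> complex) \<Rightarrow> ennreal" where
  "gabor_energy f = (\<integral>\<^sup>+k. (\<integral>\<^sup>+l. ennreal ((norm (LINT t|lborel. f t * of_real (W (t - of_int k * \<alpha>))
      * cnj (four_exp (1 / \<beta>) l t)))\<^sup>2) \<partial>int_count) \<partial>int_count)"

lemma measurable_W [measurable]: "W \<in> borel_measurable borel"
  using W by (auto simp: exp_decay_def intro: borel_measurable_continuous_onI)

lemma measurable_gabor: "gabor_system g (\<mu>, \<nu>) \<in> borel_measurable lebesgue"
proof -
  have "(\<lambda>t. - \<mu> + t) \<in> lebesgue \<rightarrow>\<^sub>M lebesgue"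
    using lebesgue_affine_measurable [where c = "\<lambda>x::real. 1" and t = "- \<mu>"] by simp
  then have "(\<lambda>t. g (- \<mu> + t)) \<in> borel_measurable lebesgue"
    by (rule measurable_compose [OF _ g])
  moreover have "(\<lambda>t. exp (2 * complex_of_real pi * \<i> * of_real \<nu> * of_real t)) \<in> borel_measurable lebesgue"
    by (rule measurable_completion) (simp add: borel_measurable_continuous_onI continuous_intros)
  ultimately show ?thesis
    unfolding gabor_system_def modulation_def translation_def by simp
qed

lemma AE_gabor:
  "AE t in lebesgue. gabor_system g (\<mu>, \<nu>) t = exp (2 * complex_of_real pi * \<i> * of_real \<nu> * of_real t) * of_real (W (t - \<mu>))"
  using AE_lebesgue_translate [OF AEg, of \<mu>]
  by eventually_elim (simp add: gabor_system_def modulation_def translation_def)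

lemma gabor_in_L2: "gabor_system g (\<mu>, \<nu>) \<in> L2"
proof -
  have norm1: "norm (exp (2 * complex_of_real pi * \<i> * of_real \<nu> * of_real t)) = 1" for t :: real
    by (subst norm_exp_eq_Re) simp
  have "integrable lborel (\<lambda>t. (W (- \<mu> + 1 * t))\<^sup>2)"
    using exp_decay_integrable [OF exp_decay_square [OF W]]
    by (intro lborel_integrable_real_affine [where f = "\<lambda>x. (W x)\<^sup>2"]) auto
  then have "integrable lebesgue (\<lambda>t. (W (t - \<mu>))\<^sup>2)"
    by (subst integrable_completion) auto
  moreover have "AE t in lebesgue. (norm (gabor_system g (\<mu>, \<nu>) t))\<^sup>2 = (W (t - \<mu>))\<^sup>2"
    using AE_gabor [of \<mu> \<nu>] by eventually_elim (simp only: norm_mult norm1, simp)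
  moreover have "(\<lambda>t. (W (t - \<mu>))\<^sup>2) \<in> borel_measurable lebesgue"
    by (rule measurable_completion) measurable
  moreover have "(\<lambda>t. (norm (gabor_system g (\<mu>, \<nu>) t))\<^sup>2) \<in> borel_measurable lebesgue"
    by (intro borel_measurable_power measurable_compose [OF measurable_gabor borel_measurable_norm])
  ultimately have "integrable lebesgue (\<lambda>t. (norm (gabor_system g (\<mu>, \<nu>) t))\<^sup>2)"
    using integrable_cong_AE [of "\<lambda>t. (norm (gabor_system g (\<mu>, \<nu>) t))\<^sup>2" lebesgue "\<lambda>t. (W (t - \<mu>))\<^sup>2"] by blast
  then show ?thesis by (simp add: L2_def measurable_gabor)
qed

lemma L2_inner_gabor:
  assumes "f \<in> L2" and [measurable]: "f' \<in> borel_measurable borel" and AEf: "AE x in lebesgue. f x = f' x"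
  shows "L2_inner f (gabor_system g (\<alpha> * of_int k, \<beta> * of_int l))
    = (LINT t|lborel. f' t * of_real (W (t - of_int k * \<alpha>)) * cnj (four_exp (1 / \<beta>) l t))"
proof -
  let ?h = "\<lambda>t. f' t * of_real (W (t - of_int k * \<alpha>)) * cnj (four_exp (1 / \<beta>) l t)"
  have mh: "?h \<in> borel_measurable borel" unfolding cnj_four_exp by measurable
  have mf: "f \<in> borel_measurable lebesgue" using assms(1) by (simp add: L2_def)
  have "L2_inner f (gabor_system g (\<alpha> * of_int k, \<beta> * of_int l)) = (LINT t|lebesgue. ?h t)"
    unfolding L2_inner_def
  proof (rule integral_cong_AE)
    have "(\<lambda>t. cnj (gabor_system g (\<alpha> * of_int k, \<beta> * of_int l) t)) \<in> borel_measurable lebesgue"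
      by (rule measurable_compose [OF measurable_gabor]) (intro borel_measurable_continuous_onI continuous_intros)
    then show "(\<lambda>t. f t * cnj (gabor_system g (\<alpha> * of_int k, \<beta> * of_int l) t)) \<in> borel_measurable lebesgue"
      by (intro borel_measurable_times mf)
    show "?h \<in> borel_measurable lebesgue" by (rule measurable_completion) (simp add: mh)
    show "AE t in lebesgue. f t * cnj (gabor_system g (\<alpha> * of_int k, \<beta> * of_int l) t) = ?h t"
      using AEf AE_gabor [of "\<alpha> * of_int k" "\<beta> * of_int l"]
      by eventually_elim (simp add: four_exp_def mult_ac)
  qed
  also have "\<dots> = (LINT t|lborel. ?h t)"
    by (rule integral_completion) (simp add: mh)
  finally show ?thesis .
qed

lemma gabor_energy_fiber:
  assumes "f \<in> borel_measurable borel" "(\<integral>\<^sup>+x. ennreal ((norm (f x))\<^sup>2) \<partial>lborel) < \<infinity>"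
  shows "gabor_energy f = ennreal (1 / \<beta>) * (\<integral>\<^sup>+x. (\<integral>\<^sup>+k. ennreal ((norm (fiber (1 / \<beta>) W
      (\<lambda>j. f (x + of_int j * (1 / \<beta>))) (x - of_int k * \<alpha>)))\<^sup>2) \<partial>int_count) \<partial>per (1 / \<beta>))"
  unfolding gabor_energy_def using \<beta> by (intro gabor_fiber_identity W \<alpha> assms) auto

text \<open>The Schur bound holds with one constant for every base point, so it can be integrated
  over the period and unfolded.\<close>

lemma gabor_energy_le:
  obtains B where "B > 0" "\<And>f. f \<in> borel_measurable borel \<Longrightarrow> (\<integral>\<^sup>+x. ennreal ((norm (f x))\<^sup>2) \<partial>lborel) < \<infinity> \<Longrightarrow>
     gabor_energy f \<le> ennreal B * (\<integral>\<^sup>+x. ennreal ((norm (f x))\<^sup>2) \<partial>lborel)"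
proof -
  let ?L = "1 / \<beta>"
  have L: "?L > 0" using \<beta> by simp
  obtain B where B: "B > 0" "\<And>(c :: int \<Rightarrow> complex) x.
    (\<integral>\<^sup>+k. ennreal ((norm (fiber ?L W c (x - of_int k * \<alpha>)))\<^sup>2) \<partial>int_count)
      \<le> ennreal B * (\<integral>\<^sup>+j. ennreal ((norm (c j))\<^sup>2) \<partial>int_count)"
    using nn_integral_fiber_le [OF W L \<alpha>, where 'a = complex] by metis
  show ?thesis
  proof (rule that [of "?L * B"])
    show "?L * B > 0" using L B by simp
    fix f :: "real \<Rightarrow> complex"
    assume [measurable]: "f \<in> borel_measurable borel" and fin: "(\<integral>\<^sup>+x. ennreal ((norm (f x))\<^sup>2) \<partial>lborel) < \<infinity>"
    have "gabor_energy f \<le> ennreal ?L * (\<integral>\<^sup>+x. ennreal B * (\<integral>\<^sup>+j. ennreal ((norm (f (x + of_int j * ?L)))\<^sup>2) \<partial>int_count) \<partial>per ?L)"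
      unfolding gabor_energy_fiber [OF \<open>f \<in> borel_measurable borel\<close> fin]
      by (intro mult_left_mono nn_integral_mono B) auto
    also have "(\<integral>\<^sup>+x. ennreal B * (\<integral>\<^sup>+j. ennreal ((norm (f (x + of_int j * ?L)))\<^sup>2) \<partial>int_count) \<partial>per ?L)
       = ennreal B * (\<integral>\<^sup>+x. (\<integral>\<^sup>+j. ennreal ((norm (f (x + of_int j * ?L)))\<^sup>2) \<partial>int_count) \<partial>per ?L)"
      by (rule nn_integral_cmult) (intro measurable_restrict_space1 measurable_nn_integral_int_count, measurable)
    also have "\<dots> = ennreal B * (\<integral>\<^sup>+x. ennreal ((norm (f x))\<^sup>2) \<partial>lborel)"
      by (subst nn_integral_unfold_period [OF L, of "\<lambda>x. ennreal ((norm (f x))\<^sup>2)"]) auto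
    also have "ennreal ?L * (ennreal B * (\<integral>\<^sup>+x. ennreal ((norm (f x))\<^sup>2) \<partial>lborel))
       = ennreal (?L * B) * (\<integral>\<^sup>+x. ennreal ((norm (f x))\<^sup>2) \<partial>lborel)"
      using L B(1) by (subst ennreal_mult) (simp_all only: less_imp_le mult.assoc)
    finally show "gabor_energy f \<le> ennreal (?L * B) * (\<integral>\<^sup>+x. ennreal ((norm (f x))\<^sup>2) \<partial>lborel)" .
  qed
qed

text \<open>The stability estimate is applied at almost every base point and integrated over the
  period; the constant \<open>?L / A\<close> combines the factor \<open>?L\<close> of Parseval with
  the inverse of the stability constant.\<close>

lemma gabor_energy_ge:
  assumes unique: "\<forall>(c :: int \<Rightarrow> real) M x p. (\<forall>j. \<bar>c j\<bar> \<le> M) \<longrightarrow>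
      (\<forall>k. fiber (1 / \<beta>) W c (x + \<alpha> * of_int k) = 0) \<longrightarrow> c p = 0"
  obtains A where "A > 0" "\<And>f. f \<in> borel_measurable borel \<Longrightarrow> (\<integral>\<^sup>+x. ennreal ((norm (f x))\<^sup>2) \<partial>lborel) < \<infinity> \<Longrightarrow>
     ennreal A * (\<integral>\<^sup>+x. ennreal ((norm (f x))\<^sup>2) \<partial>lborel) \<le> gabor_energy f"
proof -
  let ?L = "1 / \<beta>"
  have L: "?L > 0" using \<beta> by simp
  obtain A where A: "A > 0" "\<And>(c :: int \<Rightarrow> real) M x. (\<And>j. \<bar>c j\<bar> \<le> M) \<Longrightarrow>
      (\<integral>\<^sup>+j. ennreal ((c j)\<^sup>2) \<partial>int_count)
        \<le> ennreal A * (\<integral>\<^sup>+k. ennreal ((fiber ?L W c (x + \<alpha> * of_int k))\<^sup>2) \<partial>int_count)"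
    using fiber_l2_stable [OF W L \<alpha> unique] by blast
  have complex: "(\<integral>\<^sup>+j. ennreal ((norm (c j))\<^sup>2) \<partial>int_count)
        \<le> ennreal A * (\<integral>\<^sup>+k. ennreal ((norm (fiber ?L W c (x - of_int k * \<alpha>)))\<^sup>2) \<partial>int_count)"
    if c: "\<And>j. norm (c j :: complex) \<le> M" for c M x
  proof -
    have "\<bar>Re (c j)\<bar> \<le> M" "\<bar>Im (c j)\<bar> \<le> M" for j
      using c [of j] abs_Re_le_cmod [of "c j"] abs_Im_le_cmod [of "c j"] by linarith+
    note AR = A(2) [of "\<lambda>j. Re (c j)", OF this(1)] and AI = A(2) [of "\<lambda>j. Im (c j)", OF this(2)]
    have "(\<integral>\<^sup>+j. ennreal ((norm (c j))\<^sup>2) \<partial>int_count)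
       = (\<integral>\<^sup>+j. ennreal ((Re (c j))\<^sup>2) \<partial>int_count) + (\<integral>\<^sup>+j. ennreal ((Im (c j))\<^sup>2) \<partial>int_count)"
      by (subst nn_integral_add [symmetric]) (auto simp: cmod_power2)
    also have "\<dots> \<le> ennreal A * (\<integral>\<^sup>+k. ennreal ((fiber ?L W (\<lambda>j. Re (c j)) (x + \<alpha> * of_int k))\<^sup>2) \<partial>int_count)
       + ennreal A * (\<integral>\<^sup>+k. ennreal ((fiber ?L W (\<lambda>j. Im (c j)) (x + \<alpha> * of_int k))\<^sup>2) \<partial>int_count)"
      by (intro add_mono AR AI)
    also have "\<dots> = ennreal A * (\<integral>\<^sup>+k. ennreal ((norm (fiber ?L W c (x + \<alpha> * of_int k)))\<^sup>2) \<partial>int_count)"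
      unfolding fiber_Re_Im [OF W L c] distrib_left [symmetric]
      by (subst nn_integral_add [symmetric]) auto
    also have "(\<integral>\<^sup>+k. ennreal ((norm (fiber ?L W c (x + \<alpha> * of_int k)))\<^sup>2) \<partial>int_count)
       = (\<integral>\<^sup>+k. ennreal ((norm (fiber ?L W c (x - of_int k * \<alpha>)))\<^sup>2) \<partial>int_count)"
      using nn_integral_int_uminus [of "\<lambda>k. ennreal ((norm (fiber ?L W c (x + \<alpha> * of_int k)))\<^sup>2)"]
      by (simp add: mult.commute)
    finally show ?thesis .
  qed
  show ?thesis
  proof (rule that [of "?L / A"])
    show "?L / A > 0" using L A by simp
    fix f :: "real \<Rightarrow> complex"
    assume [measurable]: "f \<in> borel_measurable borel" and fin: "(\<integral>\<^sup>+x. ennreal ((norm (f x))\<^sup>2) \<partial>lborel) < \<infinity>"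
    define N where "N x = (\<integral>\<^sup>+j. ennreal ((norm (f (x + of_int j * ?L)))\<^sup>2) \<partial>int_count)" for x
    define G where "G x = (\<integral>\<^sup>+k. ennreal ((norm (fiber ?L W (\<lambda>j. f (x + of_int j * ?L)) (x - of_int k * \<alpha>)))\<^sup>2) \<partial>int_count)" for x
    have [measurable]: "N \<in> borel_measurable borel" "G \<in> borel_measurable borel"
      unfolding N_def G_def fiber_def
      by (intro measurable_nn_integral_int_count borel_measurable_power measurable_compose [OF _ borel_measurable_norm]
          measurable_compose [OF _ measurable_ennreal] measurable_integral_int_count; measurable)+
    have mN: "N \<in> borel_measurable (per ?L)" "G \<in> borel_measurable (per ?L)"
      by (intro measurable_restrict_space1; simp)+
    have N_int: "(\<integral>\<^sup>+x. N x \<partial>per ?L) = (\<integral>\<^sup>+x. ennreal ((norm (f x))\<^sup>2) \<partial>lborel)"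
      unfolding N_def by (rule nn_integral_unfold_period [OF L, of "\<lambda>x. ennreal ((norm (f x))\<^sup>2)"]) measurable
    \<comment> \<open>Square integrability of \<open>f\<close> makes almost every fiber square
      summable, hence bounded, as the stability estimate requires.\<close>
    then have "AE x in per ?L. N x \<noteq> \<infinity>"
      using fin by (intro nn_integral_PInf_AE mN) simp
    then have "AE x in per ?L. N x \<le> ennreal A * G x"
    proof eventually_elim
      case (elim x)
      have "norm (f (x + of_int j * ?L)) \<le> sqrt (enn2real (N x))" for j
      proof -
        have "ennreal ((norm (f (x + of_int j * ?L)))\<^sup>2) \<le> N x"
          unfolding N_def by (rule nn_integral_ge_point) simp
        also have "N x = ennreal (enn2real (N x))" using elim by (simp add: less_top)
        finally have "(norm (f (x + of_int j * ?L)))\<^sup>2 \<le> enn2real (N x)" by (simp add: ennreal_le_iff)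
        then show ?thesis by (rule real_le_rsqrt)
      qed
      then show ?case unfolding N_def G_def by (rule complex)
    qed
    then have "(\<integral>\<^sup>+x. N x \<partial>per ?L) \<le> (\<integral>\<^sup>+x. ennreal A * G x \<partial>per ?L)"
      by (rule nn_integral_mono_AE)
    also have "\<dots> = ennreal A * (\<integral>\<^sup>+x. G x \<partial>per ?L)"
      by (rule nn_integral_cmult [OF mN(2)])
    finally have "ennreal (?L / A) * (\<integral>\<^sup>+x. ennreal ((norm (f x))\<^sup>2) \<partial>lborel) \<le> ennreal (?L / A) * (ennreal A * (\<integral>\<^sup>+x. G x \<partial>per ?L))"
      unfolding N_int by (rule mult_left_mono) simp
    also have "\<dots> = ennreal ?L * (\<integral>\<^sup>+x. G x \<partial>per ?L)"
      using A L by (simp add: mult.assoc [symmetric] ennreal_mult [symmetric])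
    also have "\<dots> = gabor_energy f"
      unfolding G_def by (rule gabor_energy_fiber [symmetric]) (use fin in auto)
    finally show "ennreal (?L / A) * (\<integral>\<^sup>+x. ennreal ((norm (f x))\<^sup>2) \<partial>lborel) \<le> gabor_energy f" .
  qed
qed

text \<open>The upper bound enters already here: finiteness of the energy is what yields summability
  of the frame sum.\<close>

lemma gabor_sums:
  assumes "f \<in> L2" and f': "f' \<in> borel_measurable borel" and AEf: "AE x in lebesgue. f x = f' x"
  shows "ennreal ((L2_norm f)\<^sup>2) = (\<integral>\<^sup>+x. ennreal ((norm (f' x))\<^sup>2) \<partial>lborel)"
    and "(\<lambda>i. (norm (L2_inner f (gabor_system g i)))\<^sup>2) summable_on rect_lattice \<alpha> \<beta>"
    and "ennreal (\<Sum>\<^sub>\<infinity>i\<in>rect_lattice \<alpha> \<beta>. (norm (L2_inner f (gabor_system g i)))\<^sup>2) = gabor_energy f'"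
proof -
  have int: "integrable lebesgue (\<lambda>x. (norm (f x))\<^sup>2)" using assms(1) by (simp add: L2_def)
  have "ennreal ((L2_norm f)\<^sup>2) = ennreal (LINT x|lebesgue. (norm (f x))\<^sup>2)"
    unfolding L2_norm_def by (simp add: integral_nonneg_AE)
  also have "\<dots> = (\<integral>\<^sup>+x. ennreal ((norm (f x))\<^sup>2) \<partial>lebesgue)"
    by (rule nn_integral_eq_integral [OF int, symmetric]) simp
  also have "\<dots> = (\<integral>\<^sup>+x. ennreal ((norm (f' x))\<^sup>2) \<partial>lebesgue)"
    using AEf by (intro nn_integral_cong_AE) (auto elim: AE_mp)
  also have "\<dots> = (\<integral>\<^sup>+x. ennreal ((norm (f' x))\<^sup>2) \<partial>lborel)"
    by (rule nn_integral_completion)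
  finally show norm: "ennreal ((L2_norm f)\<^sup>2) = (\<integral>\<^sup>+x. ennreal ((norm (f' x))\<^sup>2) \<partial>lborel)" .
  then have fin: "(\<integral>\<^sup>+x. ennreal ((norm (f' x))\<^sup>2) \<partial>lborel) < \<infinity>"
    by (metis ennreal_less_top infinity_ennreal_def)
  obtain B where "B > 0" "gabor_energy f' \<le> ennreal B * (\<integral>\<^sup>+x. ennreal ((norm (f' x))\<^sup>2) \<partial>lborel)"
    using gabor_energy_le f' fin by metis
  then have "gabor_energy f' < \<infinity>"
    using fin by (auto simp: ennreal_mult_less_top intro: le_less_trans)
  then have E: "gabor_energy f' = ennreal (enn2real (gabor_energy f'))" by (simp add: less_top)
  have "(\<integral>\<^sup>+k. (\<integral>\<^sup>+l. ennreal ((norm (L2_inner f (gabor_system g (\<alpha> * of_int k, \<beta> * of_int l))))\<^sup>2) \<partial>int_count) \<partial>int_count)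
     = ennreal (enn2real (gabor_energy f'))"
    unfolding L2_inner_gabor [OF assms] gabor_energy_def [symmetric] by (rule E)
  from infsum_rect_lattice [OF \<alpha> \<beta> _ enn2real_nonneg this]
  show "(\<lambda>i. (norm (L2_inner f (gabor_system g i)))\<^sup>2) summable_on rect_lattice \<alpha> \<beta>"
    and "ennreal (\<Sum>\<^sub>\<infinity>i\<in>rect_lattice \<alpha> \<beta>. (norm (L2_inner f (gabor_system g i)))\<^sup>2) = gabor_energy f'"
    using E by simp_all
qed

lemma frame_lower_bound:
  assumes "L2_frame (rect_lattice \<alpha> \<beta>) (gabor_system g)"
  obtains A where "A > 0" "\<And>f. f \<in> borel_measurable borel \<Longrightarrow> (\<integral>\<^sup>+x. ennreal ((norm (f x))\<^sup>2) \<partial>lborel) < \<infinity> \<Longrightarrow>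
     ennreal A * (\<integral>\<^sup>+x. ennreal ((norm (f x))\<^sup>2) \<partial>lborel) \<le> gabor_energy f"
proof -
  from assms obtain A where A: "A > 0"
    "\<And>f. f \<in> L2 \<Longrightarrow> A * (L2_norm f)\<^sup>2 \<le> (\<Sum>\<^sub>\<infinity>i\<in>rect_lattice \<alpha> \<beta>. (norm (L2_inner f (gabor_system g i)))\<^sup>2)"
    unfolding L2_frame_def by blast
  show ?thesis
  proof (rule that [OF A(1)])
    fix f :: "real \<Rightarrow> complex"
    assume f [measurable]: "f \<in> borel_measurable borel" and fin: "(\<integral>\<^sup>+x. ennreal ((norm (f x))\<^sup>2) \<partial>lborel) < \<infinity>"
    have "integrable lborel (\<lambda>x. (norm (f x))\<^sup>2)"
      by (rule integrableI_nonneg) (use fin in auto)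
    then have "f \<in> L2"
      unfolding L2_def by (auto simp: integrable_completion intro!: measurable_completion)
    have "ennreal A * (\<integral>\<^sup>+x. ennreal ((norm (f x))\<^sup>2) \<partial>lborel) = ennreal (A * (L2_norm f)\<^sup>2)"
      using A(1) gabor_sums(1) [OF \<open>f \<in> L2\<close> f] by (simp add: ennreal_mult)
    also have "\<dots> \<le> ennreal (\<Sum>\<^sub>\<infinity>i\<in>rect_lattice \<alpha> \<beta>. (norm (L2_inner f (gabor_system g i)))\<^sup>2)"
      by (rule ennreal_leI [OF A(2) [OF \<open>f \<in> L2\<close>]])
    also have "\<dots> = gabor_energy f"
      by (rule gabor_sums(3) [OF \<open>f \<in> L2\<close> f]) simp
    finally show "ennreal A * (\<integral>\<^sup>+x. ennreal ((norm (f x))\<^sup>2) \<partial>lborel) \<le> gabor_energy f" .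
  qed
qed

lemma frame_imp_dense:
  assumes "L2_frame (rect_lattice \<alpha> \<beta>) (gabor_system g)"
  shows "\<alpha> < 1 / \<beta>"
proof (rule frame_lower_bound [OF assms])
  fix A :: real
  assume A: "A > 0" "\<And>f. f \<in> borel_measurable borel \<Longrightarrow> (\<integral>\<^sup>+x. ennreal ((norm (f x))\<^sup>2) \<partial>lborel) < \<infinity> \<Longrightarrow>
     ennreal A * (\<integral>\<^sup>+x. ennreal ((norm (f x))\<^sup>2) \<partial>lborel) \<le> gabor_energy f"
  have "1 / \<beta> > 0" using \<beta> by simp
  from lower_bound_imp_dense [OF W this \<alpha> A [unfolded gabor_energy_def]]
  show "\<alpha> < 1 / \<beta>" .
qed

lemma frame_of_bounds:
  assumes "A > 0" and A: "\<And>f. f \<in> borel_measurable borel \<Longrightarrow> (\<integral>\<^sup>+x. ennreal ((norm (f x))\<^sup>2) \<partial>lborel) < \<infinity> \<Longrightarrow>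
     ennreal A * (\<integral>\<^sup>+x. ennreal ((norm (f x))\<^sup>2) \<partial>lborel) \<le> gabor_energy f"
  shows "L2_frame (rect_lattice \<alpha> \<beta>) (gabor_system g)"
proof -
  obtain B where B: "B > 0" "\<And>f. f \<in> borel_measurable borel \<Longrightarrow> (\<integral>\<^sup>+x. ennreal ((norm (f x))\<^sup>2) \<partial>lborel) < \<infinity> \<Longrightarrow>
     gabor_energy f \<le> ennreal B * (\<integral>\<^sup>+x. ennreal ((norm (f x))\<^sup>2) \<partial>lborel)"
    using gabor_energy_le by metis
  have bounds: "(\<lambda>i. (norm (L2_inner f (gabor_system g i)))\<^sup>2) summable_on rect_lattice \<alpha> \<beta> \<and>
           A * (L2_norm f)\<^sup>2 \<le> (\<Sum>\<^sub>\<infinity>i\<in>rect_lattice \<alpha> \<beta>. (norm (L2_inner f (gabor_system g i)))\<^sup>2) \<and>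
           (\<Sum>\<^sub>\<infinity>i\<in>rect_lattice \<alpha> \<beta>. (norm (L2_inner f (gabor_system g i)))\<^sup>2) \<le> B * (L2_norm f)\<^sup>2"
    (is "_ \<and> _ \<le> ?S \<and> _") if f: "f \<in> L2" for f
  proof -
    obtain f' where f': "f' \<in> borel_measurable borel" "AE x in lebesgue. f x = f' x"
      using borel_representative [of f] f by (auto simp: L2_def)
    note sums = gabor_sums [OF f f']
    have fin: "(\<integral>\<^sup>+x. ennreal ((norm (f' x))\<^sup>2) \<partial>lborel) < \<infinity>"
      using sums(1) by (metis ennreal_less_top infinity_ennreal_def)
    have S: "?S \<ge> 0" by (intro infsum_nonneg) simp
    have "ennreal (A * (L2_norm f)\<^sup>2) \<le> ennreal ?S"
      using A [OF f'(1) fin] \<open>A > 0\<close> sums(1,3) by (simp add: ennreal_mult)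
    moreover have "ennreal ?S \<le> ennreal (B * (L2_norm f)\<^sup>2)"
      using B(2) [OF f'(1) fin] \<open>B > 0\<close> sums(1,3) by (simp add: ennreal_mult)
    ultimately show ?thesis
      using sums(2) S \<open>B > 0\<close> by (simp add: ennreal_le_iff)
  qed
  have "gabor_system g i \<in> L2" for i
    by (cases i) (simp add: gabor_in_L2)
  then show ?thesis
    unfolding L2_frame_def
    by (intro conjI [OF ballI] exI [of _ A] exI [of _ B] conjI [OF \<open>0 < A\<close>] conjI [OF \<open>0 < B\<close>])
      (simp, rule ballI, rule bounds)
qed

end

theorem corollary1p5:
  fixes g :: "real \<Rightarrow> complex" and \<alpha> \<beta> :: real
  assumes "tp_gaussian_type g" and "\<alpha> > 0" and "\<beta> > 0"
  shows "L2_frame (rect_lattice \<alpha> \<beta>) (gabor_system g) \<longleftrightarrow> \<alpha> * \<beta> < 1"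
proof -
  have g: "g \<in> borel_measurable lebesgue"
    using assms(1) by (auto simp: tp_gaussian_type_def)
  obtain n \<delta> a A where a: "a > 0" "A \<noteq> 0"
    and AEg: "AE x in lebesgue. g x = of_real (exp_avgs \<delta> (\<lambda>x. A * exp (- (a * x\<^sup>2))) n x)"
    using tp_gaussian_type_representation [OF assms(1)] by metis
  let ?W = "exp_avgs \<delta> (\<lambda>x. A * exp (- (a * x\<^sup>2))) n"
  have W: "exp_decay ?W" by (intro exp_decay_exp_avgs exp_decay_gaussian a)
  have iff: "\<alpha> * \<beta> < 1 \<longleftrightarrow> \<alpha> < 1 / \<beta>"
    using assms by (simp add: field_simps)
  show ?thesis
  proof
    assume "L2_frame (rect_lattice \<alpha> \<beta>) (gabor_system g)"
    from frame_imp_dense [OF g AEg W assms(2,3) this] have "\<alpha> < 1 / \<beta>" .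
    then show "\<alpha> * \<beta> < 1" by (simp add: iff)
  next
    assume "\<alpha> * \<beta> < 1"
    then have lt: "\<alpha> < 1 / \<beta>" by (simp add: iff)
    have unique: "\<forall>(c :: int \<Rightarrow> real) M x p. (\<forall>j. \<bar>c j\<bar> \<le> M) \<longrightarrow>
      (\<forall>k. fiber (1 / \<beta>) ?W c (x + \<alpha> * of_int k) = 0) \<longrightarrow> c p = 0"
    proof (intro allI impI)
      fix c :: "int \<Rightarrow> real" and M x p
      assume c: "\<forall>j. \<bar>c j\<bar> \<le> M" and z: "\<forall>k. fiber (1 / \<beta>) ?W c (x + \<alpha> * of_int k) = 0"
      have "strict_mono (\<lambda>k::int. x + \<alpha> * of_int k)"
        using assms(2) by (auto simp: strict_mono_def)
      \<comment> \<open>The nodes \<open>x + \<alpha> * k\<close> deviate from \<alpha> \<int> by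
        the constant \<open>|x|\<close>, which is the initial deviation \<open>D\<close> of the
        Rolle argument.\<close>
      then show "c p = 0"
        by (rule fiber_zeros_imp_zero_coeff [where D = "\<bar>x\<bar>", OF a assms(2) lt spec [OF c] _ _ spec [OF z]]) simp
    qed
    obtain A0 where "A0 > 0" "\<And>f. f \<in> borel_measurable borel \<Longrightarrow> (\<integral>\<^sup>+x. ennreal ((norm (f x))\<^sup>2) \<partial>lborel) < \<infinity> \<Longrightarrow>
       ennreal A0 * (\<integral>\<^sup>+x. ennreal ((norm (f x))\<^sup>2) \<partial>lborel) \<le> gabor_energy ?W \<alpha> \<beta> f"
      using gabor_energy_ge [OF g AEg W assms(2,3) unique] by blast
    then show "L2_frame (rect_lattice \<alpha> \<beta>) (gabor_system g)"
      by (rule frame_of_bounds [OF g AEg W assms(2,3)])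
  qed
qed

end
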